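(* Let $\eta\in L^\infty_+(\Omega)$, and let $\mathbf J$ be a source-free current density, i.e. $\mathbf J\in L^2(0,T;H_L(\Omega))$ for every $0<T<+\infty$ and $$\langle\eta\mathbf J,\mathbf w\rangle=-\partial_t\langle A\mathbf J,\mathbf w\rangle\qquad\text{for all }\mathbf w\in H_L(\Omega),\ t>0 .$$ Then there exist real constants $c_n$, $n\in\mathbb{N}$, such that $$\mathbf J(x,t)=\sum_{n=1}^\infty c_n\,\mathbf j_n(x)\,e^{-t/\tau_n(\eta)}\qquad\text{in }\Omega\times[0,+\infty),$$ the series converging in $L^2(0,T;H_L(\Omega))$ for every $0<T<+\infty$.
   Context: $\Omega\subset\mathbb{R}^3$ is an open bounded domain with Lipschitz boundary and outer unit normal $\hat{\mathbf n}$. $\langle \mathbf u,\mathbf v\rangle=\int_\Omega \mathbf u\cdot\mathbf v\,\mathrm dV$ is the $L^2(\Omega;\mathbb{R}^3)$ inner product (taken at fixed $t$ for time-dependent fields; the time derivative is understood in the sense of distributions on $(0,+\infty)$). $L^\infty_+(\Omega)$ is the set of $\theta\in L^\infty(\Omega)$ such that $\theta\ge c_0$ a.e. in $\Omega$ for some constant $c_0>0$. $H_L(\Omega)$ is the space of $\mathbf v\in L^2(\Omega;\mathbb{R}^3)$ with $\operatorname{div}\mathbf v=0$ in $\Omega$ and $\mathbf v\cdot\hat{\mathbf n}=0$ on $\partial\Omega$ (normal trace in the weak sense), and $L^2(0,T;H_L(\Omega))$ is the associated Bochner space. The operator $A:H_L(\Omega)\to L^2(\Omega;\mathbb{R}^3)$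 is $(A\mathbf v)(x)=\frac{\mu_0}{4\pi}\int_\Omega\frac{\mathbf v(x')}{\|x-x'\|}\,\mathrm dV(x')$ with $\mu_0>0$ a constant; it is compact, self-adjoint and positive definite. For $\eta\in L^\infty_+(\Omega)$ put $\|\mathbf v\|_\eta=\sqrt{\langle \eta\mathbf v,\mathbf v\rangle}$. The time constants $\tau_n(\eta)>0$ and modes $\mathbf j_n$, $n=1,2,\dots$, are defined inductively by $$\tau_n(\eta)=\max\{\langle A\mathbf j,\mathbf j\rangle : \mathbf j\in H_L^n(\Omega),\ \|\mathbf j\|_\eta=1\},$$ where $H_L^1(\Omega)=H_L(\Omega)$, $H_L^n(\Omega)=\{\mathbf v\in H_L(\Omega): \langle \mathbf v,\eta\mathbf j_1\rangle=\dots=\langle\mathbf v,\eta\mathbf j_{n-1}\rangle=0\}$ for $n\ge2$, and $\mathbf j_n$ is a chosen maximizer at step $n$. *)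

theory Defs
  imports "HOL-Analysis.Analysis"
begin

section \<open>Domains, test functions and Lebesgue spaces\<close>

text \<open>
  Near every boundary point the set is, after a rotation of the coordinates, the strict epigraph
  of a Lipschitz function. The function is defined on the whole plane, so it absorbs translations.
\<close>

definition lipschitz_boundary :: "(real^3) set \<Rightarrow> bool" where
  "lipschitz_boundary \<Omega> \<longleftrightarrow>
    (\<forall>p\<in>frontier \<Omega>. \<exists>r>0. \<exists>(Q :: real^3 \<Rightarrow> real^3) L (\<gamma> :: real^2 \<Rightarrow> real).
       orthogonal_transformation Q \<and> L-lipschitz_on UNIV \<gamma> \<and>
       \<Omega> \<inter> ball p r = {x \<in> ball p r. \<gamma> (vector [Q x $ 1, Q x $ 2]) < Q x $ 3})"

primrec C_times :: "nat \<Rightarrow> ('a::euclidean_space \<Rightarrow> real) \<Rightarrow> bool" where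
  "C_times 0 f \<longleftrightarrow> continuous_on UNIV f"
| "C_times (Suc k) f \<longleftrightarrow>
     (\<forall>x. f differentiable (at x)) \<and>
     (\<forall>b\<in>Basis. C_times k (\<lambda>x. frechet_derivative f (at x) b))"

text \<open>Smooth functions with compact support in \<open>S\<close>, extended by zero to the whole space.\<close>

definition test_functions :: "'a::euclidean_space set \<Rightarrow> ('a \<Rightarrow> real) set" where
  "test_functions S =
    {\<phi>. (\<forall>k. C_times k \<phi>) \<and> compact (closure {x. \<phi> x \<noteq> 0}) \<and> closure {x. \<phi> x \<noteq> 0} \<subseteq> S}"

definition grad :: "(real^3 \<Rightarrow> real) \<Rightarrow> real^3 \<Rightarrow> real^3" where
  "grad \<phi> x = (\<chi> i. frechet_derivative \<phi> (at x) (axis i 1))"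

text \<open>
  Elements of the Lebesgue and Sobolev spaces are represented by functions; equality of elements
  is equality almost everywhere, and all sets below are closed under changes on null sets.
\<close>

definition L2 :: "(real^3) set \<Rightarrow> (real^3 \<Rightarrow> 'b::euclidean_space) set" where
  "L2 \<Omega> = {v \<in> borel_measurable (lebesgue_on \<Omega>). integrable (lebesgue_on \<Omega>) (\<lambda>x. (norm (v x))\<^sup>2)}"

definition L2_inner ::
  "(real^3) set \<Rightarrow> (real^3 \<Rightarrow> 'b::euclidean_space) \<Rightarrow> (real^3 \<Rightarrow> 'b) \<Rightarrow> real" where
  "L2_inner \<Omega> u v = (\<integral>x. u x \<bullet> v x \<partial>lebesgue_on \<Omega>)"

definition L2_norm :: "(real^3) set \<Rightarrow> (real^3 \<Rightarrow> 'b::euclidean_space) \<Rightarrow> real" where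
  "L2_norm \<Omega> v = sqrt (L2_inner \<Omega> v v)"

definition Linf_plus :: "(real^3) set \<Rightarrow> (real^3 \<Rightarrow> real) set" where
  "Linf_plus \<Omega> =
    {\<theta> \<in> borel_measurable (lebesgue_on \<Omega>).
      (\<exists>C. AE x in lebesgue_on \<Omega>. \<bar>\<theta> x\<bar> \<le> C) \<and> (\<exists>c\<^sub>0>0. AE x in lebesgue_on \<Omega>. c\<^sub>0 \<le> \<theta> x)}"

section \<open>Solenoidal fields with vanishing normal trace\<close>

text \<open>Weak gradients of square integrable functions: \<open>has_weak_grad \<Omega> \<phi> G\<close> says that
  \<open>\<phi>\<close> is in \<open>H\<^sup>1(\<Omega>)\<close> and that \<open>G\<close> is its gradient.\<close>

definition has_weak_grad ::
  "(real^3) set \<Rightarrow> (real^3 \<Rightarrow> real) \<Rightarrow> (real^3 \<Rightarrow> real^3) \<Rightarrow> bool" where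
  "has_weak_grad \<Omega> \<phi> G \<longleftrightarrow> \<phi> \<in> L2 \<Omega> \<and> G \<in> L2 \<Omega> \<and>
    (\<forall>\<psi>\<in>test_functions \<Omega>.
      (\<integral>x. \<phi> x *\<^sub>R grad \<psi> x \<partial>lebesgue_on \<Omega>) = - (\<integral>x. \<psi> x *\<^sub>R G x \<partial>lebesgue_on \<Omega>))"

definition has_weak_div ::
  "(real^3) set \<Rightarrow> (real^3 \<Rightarrow> real^3) \<Rightarrow> (real^3 \<Rightarrow> real) \<Rightarrow> bool" where
  "has_weak_div \<Omega> v g \<longleftrightarrow> v \<in> L2 \<Omega> \<and> g \<in> L2 \<Omega> \<and>
    (\<forall>\<psi>\<in>test_functions \<Omega>. L2_inner \<Omega> v (grad \<psi>) = - L2_inner \<Omega> g \<psi>)"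

text \<open>
  The weak normal trace of \<open>v\<close> is the functional on traces of \<open>H\<^sup>1(\<Omega>)\<close> functions given by Green's
  formula, \<open>\<langle>v \<cdot> n, \<phi>\<rangle> = \<integral> v \<cdot> \<nabla>\<phi> + \<integral> (div v) \<phi>\<close>.
\<close>

definition normal_trace_zero :: "(real^3) set \<Rightarrow> (real^3 \<Rightarrow> real^3) \<Rightarrow> bool" where
  "normal_trace_zero \<Omega> v \<longleftrightarrow>
    (\<exists>g. has_weak_div \<Omega> v g \<and>
      (\<forall>\<phi> G. has_weak_grad \<Omega> \<phi> G \<longrightarrow> L2_inner \<Omega> v G + L2_inner \<Omega> g \<phi> = 0))"

definition HL :: "(real^3) set \<Rightarrow> (real^3 \<Rightarrow> real^3) set" where
  "HL \<Omega> = {v \<in> L2 \<Omega>. has_weak_div \<Omega> v (\<lambda>_. 0) \<and> normal_trace_zero \<Omega> v}"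

section \<open>Bochner space\<close>

definition strongly_measurable_HL ::
  "(real^3) set \<Rightarrow> real \<Rightarrow> (real \<Rightarrow> real^3 \<Rightarrow> real^3) \<Rightarrow> bool" where
  "strongly_measurable_HL \<Omega> T u \<longleftrightarrow>
    (\<exists>s. (\<forall>k. simple_function (lebesgue_on {0<..<T}) (s k) \<and> s k ` {0<..<T} \<subseteq> HL \<Omega>) \<and>
         (AE t in lebesgue_on {0<..<T}.
            (\<lambda>k::nat. L2_norm \<Omega> (\<lambda>x. s k t x - u t x)) \<longlonglongrightarrow> 0))"

text \<open>\<open>L\<^sup>2(0,T;H\<^sub>L(\<Omega>))\<close>; values outside \<open>(0,T)\<close> are ignored.\<close>

definition L2_HL :: "(real^3) set \<Rightarrow> real \<Rightarrow> (real \<Rightarrow> real^3 \<Rightarrow> real^3) set" where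
  "L2_HL \<Omega> T =
    {u. (AE t in lebesgue_on {0<..<T}. u t \<in> HL \<Omega>) \<and> strongly_measurable_HL \<Omega> T u \<and>
        integrable (lebesgue_on {0<..<T}) (\<lambda>t. (L2_norm \<Omega> (u t))\<^sup>2)}"

definition L2_HL_norm :: "(real^3) set \<Rightarrow> real \<Rightarrow> (real \<Rightarrow> real^3 \<Rightarrow> real^3) \<Rightarrow> real" where
  "L2_HL_norm \<Omega> T u = sqrt (\<integral>t. (L2_norm \<Omega> (u t))\<^sup>2 \<partial>lebesgue_on {0<..<T})"

definition converges_in_L2_HL ::
  "(real^3) set \<Rightarrow> real \<Rightarrow> (nat \<Rightarrow> real \<Rightarrow> real^3 \<Rightarrow> real^3) \<Rightarrow> (real \<Rightarrow> real^3 \<Rightarrow> real^3) \<Rightarrow> bool"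
where
  "converges_in_L2_HL \<Omega> T U u \<longleftrightarrow>
    (\<forall>N. U N \<in> L2_HL \<Omega> T) \<and> u \<in> L2_HL \<Omega> T \<and>
    (\<lambda>N. L2_HL_norm \<Omega> T (\<lambda>t x. U N t x - u t x)) \<longlonglongrightarrow> 0"

section \<open>The operator, time constants, modes and source-free currents\<close>

definition A_op :: "real \<Rightarrow> (real^3) set \<Rightarrow> (real^3 \<Rightarrow> real^3) \<Rightarrow> real^3 \<Rightarrow> real^3" where
  "A_op \<mu>\<^sub>0 \<Omega> v x =
    (\<mu>\<^sub>0 / (4 * pi)) *\<^sub>R (\<integral>x'. (1 / norm (x - x')) *\<^sub>R v x' \<partial>lebesgue_on \<Omega>)"

definition weighted_norm :: "(real^3) set \<Rightarrow> (real^3 \<Rightarrow> real) \<Rightarrow> (real^3 \<Rightarrow> real^3) \<Rightarrow> real" where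
  "weighted_norm \<Omega> \<eta> v = sqrt (L2_inner \<Omega> (\<lambda>x. \<eta> x *\<^sub>R v x) v)"

definition HL_n ::
  "(real^3) set \<Rightarrow> (real^3 \<Rightarrow> real) \<Rightarrow> (nat \<Rightarrow> real^3 \<Rightarrow> real^3) \<Rightarrow> nat \<Rightarrow> (real^3 \<Rightarrow> real^3) set"
where
  "HL_n \<Omega> \<eta> j n = {v \<in> HL \<Omega>. \<forall>k\<in>{1..<n}. L2_inner \<Omega> v (\<lambda>x. \<eta> x *\<^sub>R j k x) = 0}"

text \<open>
  \<open>\<tau> n\<close> is the maximum at step \<open>n\<close> and \<open>j n\<close> a maximizer. The indices are \<open>n = 1, 2, \<dots>\<close>; the values
  at \<open>0\<close> play no role.
\<close>

definition time_constants_modes ::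
  "real \<Rightarrow> (real^3) set \<Rightarrow> (real^3 \<Rightarrow> real) \<Rightarrow> (nat \<Rightarrow> real) \<Rightarrow> (nat \<Rightarrow> real^3 \<Rightarrow> real^3) \<Rightarrow> bool"
where
  "time_constants_modes \<mu>\<^sub>0 \<Omega> \<eta> \<tau> j \<longleftrightarrow>
    (\<forall>n\<ge>1.
       j n \<in> HL_n \<Omega> \<eta> j n \<and> weighted_norm \<Omega> \<eta> (j n) = 1 \<and>
       L2_inner \<Omega> (A_op \<mu>\<^sub>0 \<Omega> (j n)) (j n) = \<tau> n \<and>
       (\<forall>v\<in>HL_n \<Omega> \<eta> j n. weighted_norm \<Omega> \<eta> v = 1 \<longrightarrow>
          L2_inner \<Omega> (A_op \<mu>\<^sub>0 \<Omega> v) v \<le> \<tau> n))"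

text \<open>
  \<open>g\<close> is the derivative of \<open>f\<close> in the sense of distributions on the open set \<open>S\<close>; meant for \<open>f\<close>
  and \<open>g\<close> locally integrable on \<open>S\<close>.
\<close>

definition has_distr_deriv :: "real set \<Rightarrow> (real \<Rightarrow> real) \<Rightarrow> (real \<Rightarrow> real) \<Rightarrow> bool" where
  "has_distr_deriv S f g \<longleftrightarrow>
    (\<forall>\<phi>\<in>test_functions S.
      (\<integral>t. f t * deriv \<phi> t \<partial>lebesgue_on S) = - (\<integral>t. g t * \<phi> t \<partial>lebesgue_on S))"

definition source_free_current ::
  "real \<Rightarrow> (real^3) set \<Rightarrow> (real^3 \<Rightarrow> real) \<Rightarrow> (real \<Rightarrow> real^3 \<Rightarrow> real^3) \<Rightarrow> bool" where
  "source_free_current \<mu>\<^sub>0 \<Omega> \<eta> J \<longleftrightarrow>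
    (\<forall>T>0. J \<in> L2_HL \<Omega> T) \<and>
    (\<forall>w\<in>HL \<Omega>. has_distr_deriv {0<..}
       (\<lambda>t. L2_inner \<Omega> (A_op \<mu>\<^sub>0 \<Omega> (J t)) w)
       (\<lambda>t. - L2_inner \<Omega> (\<lambda>x. \<eta> x *\<^sub>R J t x) w))"

end

theory Submission
  imports Defs "HOL-Computational_Algebra.Polynomial"
begin

text \<open>
  Testing the evolution equation with \<open>j\<^sub>n\<close> and using the Euler--Lagrange equation
  \<open>\<langle>A j\<^sub>n, w\<rangle> = \<tau>\<^sub>n \<langle>\<eta> j\<^sub>n, w\<rangle>\<close> for \<open>w \<in> H\<^sub>L\<close> gives \<open>\<tau>\<^sub>n f\<^sub>n' = - f\<^sub>n\<close> in the sense of distributions for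
  \<open>f\<^sub>n(t) = \<langle>\<eta> J(t), j\<^sub>n\<rangle>\<close>, so \<open>f\<^sub>n(t) = c\<^sub>n e\<^bsup>-t/\<tau>\<^sub>n\<^esup>\<close> almost everywhere. The partial sums are thus the
  \<open>\<eta>\<close>-orthogonal projections of \<open>J(t)\<close>, and by dominated convergence in \<open>t\<close> it suffices that the modes
  are complete in \<open>H\<^sub>L\<close>. If \<open>r\<^sub>n\<close> is the residual of \<open>v \<in> H\<^sub>L\<close> after projecting on the first \<open>n\<close> modes, then
  \<open>\<langle>A r\<^sub>n, r\<^sub>n\<rangle> \<le> \<tau>\<^sub>n\<^sub>+\<^sub>1 \<parallel>v\<parallel>\<^sub>\<eta>\<^sup>2 \<longrightarrow> 0\<close> because the kernel of \<open>A\<close> is square integrable; \<open>r\<^sub>n\<close> converges in \<open>L\<^sup>2\<close>, and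
  its limit \<open>r\<close> has \<open>\<langle>A r, r\<rangle> = 0\<close>, hence vanishes. Definiteness of \<open>A\<close> comes from writing \<open>1 / \<bar>x - y\<bar>\<close>
  as an integral over balls of \<open>1\<^sub>B(x) 1\<^sub>B(y)\<close>: a null vector of the form has zero integral over
  almost every ball.
\<close>

section \<open>Functions with vanishing integrals over balls\<close>

text \<open>Fields are plain functions compared almost everywhere, and \<open>J\<close> is only
  strongly measurable in time; joint measurability in \<open>(t, x)\<close> is not assumed.
  Arguments in time therefore run through the scalar functions \<open>W (j n) (J t)\<close>, where
  \<open>W\<close> is the inner product weighted by \<open>\<eta>\<close>. Even the measurability of
  the energy \<open>W (J t) (J t)\<close> comes out of completeness, as a limit of Bessel sums.

  The modes are orthonormal for \<open>W\<close> and not for the plain inner product. This is why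
  the kernel is divided by \<open>\<eta>\<close> before Bessel's inequality is applied; the outcome
  is that the \<open>\<tau> n\<close> are square summable, which takes the place of the theory of
  compact operators. Definiteness is proved on all of \<open>L2\<close>, so the limit of the
  residuals can be taken there and the constraints defining \<open>HL\<close> need not be followed
  through the limit.

  The weight \<open>r^-5\<close> in the ball representation is forced by scaling in dimension three:
  the volume of a lens has degree 3 in the distance s of the centres, \<open>dr\<close> adds one
  degree, and s^(3 + 1 - 5) is the Coulomb kernel.\<close>

lemma borel_Int_in_sets_lebesgue_on:
  assumes "open S" "A \<in> sets borel"
  shows "A \<inter> S \<in> sets (lebesgue_on S)"
proof -
  have "A \<inter> S \<in> sets lebesgue" using assms by (metis borel_open lborelD sets.Int sets_completionI_sets sets_lborel)
  moreover have "S \<in> sets lebesgue" using assms(1) by (metis borel_open sets_completionI_sets sets_lborel)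
  ultimately show ?thesis by (subst sets_restrict_space_iff) auto
qed

text \<open>By the Vitali covering theorem, countably many disjoint balls with vanishing integral
  exhaust the part of \<open>U\<close> inside \<open>\<Omega>\<close> up to a null set, and their
  integrals add up. The balls in \<open>fine\<close> only have to contain \<open>x\<close>, not be
  centred at it, because positive definiteness will give information on almost every ball and not on
  every ball.\<close>

lemma set_integral_open_zero_if_ball_integrals_zero:
  fixes f :: "'a::euclidean_space \<Rightarrow> 'b::euclidean_space"
  assumes \<Omega>: "open \<Omega>" and f: "integrable (lebesgue_on \<Omega>) f"
    and fine: "\<And>x d. \<lbrakk>x \<in> \<Omega>; 0 < d\<rbrakk> \<Longrightarrow> \<exists>z r. 0 < r \<and> r < d \<and> x \<in> cball z r \<and>
      (\<integral>y. indicator (cball z r) y *\<^sub>R f y \<partial>lebesgue_on \<Omega>) = 0"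
    and U: "open U"
  shows "(\<integral>y. indicator U y *\<^sub>R f y \<partial>lebesgue_on \<Omega>) = 0"
proof -
  define M where "M = lebesgue_on \<Omega>"
  define S where "S = U \<inter> \<Omega>"
  have mM: "A \<inter> \<Omega> \<in> sets M" if "A \<in> sets borel" for A :: "'a set"
    using borel_Int_in_sets_lebesgue_on[OF \<Omega> that] by (simp add: M_def)
  define K where "K = {(z, r). 0 < r \<and> cball z r \<subseteq> S \<and> (\<integral>y. indicator (cball z r) y *\<^sub>R f y \<partial>M) = 0}"
  have S: "open S" using U \<Omega> by (auto simp: S_def)
  have "\<exists>i. i \<in> K \<and> x \<in> cball (fst i) (snd i) \<and> snd i < d" if x: "x \<in> S" and d: "0 < d" for x d
  proof -
    obtain e where e: "e > 0" "ball x e \<subseteq> S" using S x by (meson openE)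
    have "x \<in> \<Omega>" using x by (simp add: S_def)
    \<comment> \<open>A ball that contains \<open>x\<close> and has radius below \<open>e/2\<close>
      lies in the ball of radius \<open>e\<close> around \<open>x\<close>, hence in
      \<open>S\<close>.\<close>
    then obtain z r where zr: "0 < r" "r < min d (e/2)" "x \<in> cball z r"
        "(\<integral>y. indicator (cball z r) y *\<^sub>R f y \<partial>M) = 0"
      using fine[of x "min d (e/2)"] d e unfolding M_def by auto
    have "cball z r \<subseteq> ball x e"
    proof
      fix y assume "y \<in> cball z r"
      then show "y \<in> ball x e" using zr dist_triangle[of x y z] by (auto simp: dist_commute)
    qed
    then show ?thesis using zr e unfolding K_def
      by (intro exI[of _ "(z,r)"]) auto
  qed
  note fineK = this
  have posK: "0 < snd i" if "i \<in> K" for i using that by (auto simp: K_def)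
  obtain C where C: "countable C" "C \<subseteq> K"
     "pairwise (\<lambda>i j. disjnt (cball (fst i) (snd i)) (cball (fst j) (snd j))) C"
     "negligible (S - (\<Union>i \<in> C. cball (fst i) (snd i)))"
    by (rule Vitali_covering_theorem_cballs[of K snd S fst, OF posK fineK])
  \<comment> \<open>Countable additivity wants a sequence, but \<open>C\<close> may be finite:
    indices that no member of \<open>C\<close> takes get the empty set.\<close>
  define A where "A n = (\<Union>i\<in>{i\<in>C. to_nat_on C i = n}. cball (fst i) (snd i))" for n
  have Acase: "A n = {} \<or> (\<exists>i\<in>C. A n = cball (fst i) (snd i))" for n
  proof (cases "\<exists>i\<in>C. to_nat_on C i = n")
    case True
    then obtain i where i: "i \<in> C" "to_nat_on C i = n" by auto
    then have "{i\<in>C. to_nat_on C i = n} = {i}" using C(1) by (auto simp: )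
    then show ?thesis using i by (auto simp: A_def)
  qed (auto simp: A_def)
  have Asub: "A n \<subseteq> \<Omega>" for n using Acase[of n] C(2) by (fastforce simp: K_def S_def)
  have Ab: "A n \<in> sets borel" for n using Acase[of n] by (auto)
  have Am: "A n \<in> sets M" for n using mM[OF Ab[of n]] Asub[of n] by (simp add: Int_absorb2)
  have disj: "A m \<inter> A n = {}" if "m \<noteq> n" for m n
  proof (rule ccontr)
    assume "A m \<inter> A n \<noteq> {}"
    then obtain x i k where *: "i \<in> C" "to_nat_on C i = m" "x \<in> cball (fst i) (snd i)"
        "k \<in> C" "to_nat_on C k = n" "x \<in> cball (fst k) (snd k)"
      unfolding A_def by blast
    then have "i \<noteq> k" using that by auto
    then have "disjnt (cball (fst i) (snd i)) (cball (fst k) (snd k))"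
      using C(3) * by (auto simp only: pairwise_def)
    then show False using *(3,6) by (auto simp only: disjnt_iff)
  qed
  have UA: "(\<Union>n. A n) = (\<Union>i \<in> C. cball (fst i) (snd i))" by (auto simp: A_def)
  have "(LINT y:(\<Union>n. A n)|M. f y) = (\<Sum>n. (LINT y:(A n)|M. f y))"
  proof (rule lebesgue_integral_countable_add)
    show "set_integrable M (\<Union>n. A n) f"
      unfolding set_integrable_def using f Am by (intro integrable_mult_indicator) (auto simp: M_def)
  qed (use Am disj in auto)
  also have "\<dots> = 0"
  proof -
    have "(LINT y:(A n)|M. f y) = 0" for n
      using Acase[of n] C(2) by (auto simp: set_lebesgue_integral_def K_def subset_iff)
    then show ?thesis by simp
  qed
  finally have z: "(\<integral>y. indicator (\<Union>n. A n) y *\<^sub>R f y \<partial>M) = 0" by (simp add: set_lebesgue_integral_def)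
  have sub: "(\<Union>n. A n) \<subseteq> S"
    unfolding UA using C(2) by (fastforce simp: K_def)
  have N: "S - (\<Union>n. A n) \<in> null_sets M"
    using C(4) sub \<Omega> unfolding M_def UA
    by (subst null_sets_restrict_space) (auto simp: negligible_iff_null_sets S_def)
  have "(\<integral>y. indicator U y *\<^sub>R f y \<partial>M) = (\<integral>y. indicator (\<Union>n. A n) y *\<^sub>R f y \<partial>M)"
  proof (rule integral_cong_AE)
    have U': "U \<inter> \<Omega> \<in> sets M" using U by (intro mM) auto
    have *: "(\<lambda>y. indicator B y *\<^sub>R f y) \<in> borel_measurable M" if "B \<in> sets borel" for B
    proof -
      have "(\<lambda>y. indicator (B \<inter> \<Omega>) y *\<^sub>R f y) \<in> borel_measurable M"
        using f mM[OF that] by (auto simp: M_def)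
      then show ?thesis by (rule measurable_cong[THEN iffD1, rotated]) (auto simp: M_def indicator_def)
    qed
    show "(\<lambda>y. indicator U y *\<^sub>R f y) \<in> borel_measurable M" using U by (intro *) auto
    show "(\<lambda>y. indicator (\<Union>n. A n) y *\<^sub>R f y) \<in> borel_measurable M" using Ab by (intro *) auto
    show "AE y in M. indicator U y *\<^sub>R f y = indicator (\<Union>n. A n) y *\<^sub>R f y"
      using AE_not_in[OF N] AE_space[of M]
    proof eventually_elim
      case (elim y)
      then show ?case using sub by (auto simp: S_def M_def indicator_def)
    qed
  qed
  then show ?thesis using z by (simp add: M_def)
qed

text \<open>Open sets form an intersection-stable generator of the Borel sets, so vanishing
  integrals pass to all Borel sets by the Dynkin argument, and to Lebesgue sets since these are
  Borel up to a null set. The result is used twice: for fields on \<open>\<Omega>\<close>, and on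
  the line, where balls are intervals.\<close>

lemma AE_zero_if_ball_integrals_zero:
  fixes f :: "'a::euclidean_space \<Rightarrow> 'b::euclidean_space"
  assumes \<Omega>: "open \<Omega>" and bounded: "bounded \<Omega>" and f: "integrable (lebesgue_on \<Omega>) f"
    and fine: "\<And>x d. \<lbrakk>x \<in> \<Omega>; 0 < d\<rbrakk> \<Longrightarrow> \<exists>z r. 0 < r \<and> r < d \<and> x \<in> cball z r \<and>
      (\<integral>y. indicator (cball z r) y *\<^sub>R f y \<partial>lebesgue_on \<Omega>) = 0"
  shows "AE x in lebesgue_on \<Omega>. f x = 0"
proof -
  define M where "M = lebesgue_on \<Omega>"
  have mM: "A \<inter> \<Omega> \<in> sets M" if "A \<in> sets borel" for A :: "'a set"
    using borel_Int_in_sets_lebesgue_on[OF \<Omega> that] by (simp add: M_def)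
  have int: "integrable M (\<lambda>y. indicator B y *\<^sub>R f y)" if "B \<in> sets borel" for B
  proof -
    have "integrable M (\<lambda>y. indicator (B \<inter> \<Omega>) y *\<^sub>R f y)"
      using f mM[OF that] by (intro integrable_mult_indicator) (auto simp: M_def)
    then show ?thesis by (rule Bochner_Integration.integrable_cong[THEN iffD1, rotated -1]) (auto simp: M_def indicator_def)
  qed
  have op: "(\<integral>y. indicator U y *\<^sub>R f y \<partial>M) = 0" if "open U" for U
    unfolding M_def using that assms by (intro set_integral_open_zero_if_ball_integrals_zero) auto
  have bor: "(\<integral>y. indicator B y *\<^sub>R f y \<partial>M) = 0" if "B \<in> sets borel" for B
  proof -
    have "B \<in> sigma_sets UNIV {S. open S}" using that by (simp add: borel_def)
    have Is: "Int_stable {S::'a set. open S}" by (auto simp: Int_stable_def)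
    have cl: "{S::'a set. open S} \<subseteq> Pow UNIV" by simp
    show ?thesis using \<open>B \<in> sigma_sets _ _\<close>
    proof (induction rule: sigma_sets_induct_disjoint[OF Is cl, consumes 1, case_names basic empty compl union])
      case (compl A)
      then have A: "A \<in> sets borel" by (simp add: borel_def)
      have "(\<integral>y. indicator (UNIV - A) y *\<^sub>R f y \<partial>M) = (\<integral>y. indicator UNIV y *\<^sub>R f y - indicator A y *\<^sub>R f y \<partial>M)"
        by (intro Bochner_Integration.integral_cong) (auto simp: indicator_def)
      also have "\<dots> = 0"
        using op[of UNIV] compl int[of UNIV] int[OF A] by (subst Bochner_Integration.integral_diff) auto
      finally show ?case .
    next
      case (union A)
      then have A: "A i \<in> sets borel" for i by (auto simp: borel_def)
      have "(LINT y:(\<Union>n. A n)|M. f y) = (LINT y:(\<Union>n. A n \<inter> \<Omega>)|M. f y)"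
        unfolding set_lebesgue_integral_def
        by (intro Bochner_Integration.integral_cong) (auto simp: indicator_def M_def)
      also have "\<dots> = (\<Sum>n. (LINT y:(A n \<inter> \<Omega>)|M. f y))"
      proof (rule lebesgue_integral_countable_add)
        show "set_integrable M (\<Union>n. A n \<inter> \<Omega>) f"
          unfolding set_integrable_def using f mM[OF A]
          by (intro integrable_mult_indicator sets.countable_UN) (auto simp: M_def)
      qed (use mM[OF A] union(1) in \<open>auto simp: disjoint_family_on_def\<close>)
      also have "\<dots> = (\<Sum>n. (LINT y:(A n)|M. f y))"
        unfolding set_lebesgue_integral_def
        by (intro suminf_cong Bochner_Integration.integral_cong) (auto simp: indicator_def M_def)
      also have "\<dots> = 0" using union(3) by (simp add: set_lebesgue_integral_def)
      finally show ?case by (simp add: set_lebesgue_integral_def)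
    qed (use op in auto)
  qed
  have "AE x in M. f x = 0"
  proof (rule sigma_finite_measure.density_zero)
    show "sigma_finite_measure M" unfolding M_def
      using lmeasurable_open[OF bounded \<Omega>] finite_measure.axioms(1) finite_measure_lebesgue_on by blast
    show "integrable M f" using f by (simp add: M_def)
    fix A assume "A \<in> sets M"
    then have A: "A \<in> sets lebesgue" "A \<subseteq> \<Omega>" using \<Omega>
      by (auto simp: M_def sets_restrict_space_iff)
    \<comment> \<open>Integrals are under control for Borel sets only; the Lebesgue set is replaced
      by an F-sigma set, at the cost of a null set.\<close>
    obtain C T where CT: "fsigma C" "T \<in> null_sets lebesgue" "C \<union> T = A" "disjnt C T"
      using lebesgue_set_almost_fsigma[OF A(1)] .
    have C: "C \<in> sets borel" using CT(1) by (auto elim!: fsigma.cases)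
    have "T \<in> null_sets M" using CT A \<Omega> unfolding M_def
      by (subst null_sets_restrict_space) auto
    then have "AE y in M. y \<notin> T" by (rule AE_not_in)
    then have "AE y in M. indicator A y *\<^sub>R f y = indicator C y *\<^sub>R f y"
      by eventually_elim (use CT(3) in \<open>auto simp: indicator_def\<close>)
    moreover have "(\<lambda>y. indicator A y *\<^sub>R f y) \<in> borel_measurable M"
      using f \<open>A \<in> sets M\<close> by (auto simp: M_def)
    ultimately have "(LINT y:A|M. f y) = (\<integral>y. indicator C y *\<^sub>R f y \<partial>M)"
      unfolding set_lebesgue_integral_def using int[OF C]
      by (intro integral_cong_AE) auto
    then show "(LINT y:A|M. f y) = 0" using bor[OF C] by simp
  qed
  then show ?thesis unfolding M_def .
qed

section \<open>Smooth functions of one real variable\<close>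

text \<open>On the line \<open>Basis\<close> is the singleton of 1, so the recursion through Frechet
  derivatives turns into one through ordinary derivatives. With the derivative as a witness
  \<open>g\<close>, smoothness proofs become inductions on the order, generalised over the
  function.\<close>

lemma C_times_Suc_real:
  fixes f :: "real \<Rightarrow> real"
  shows "C_times (Suc k) f \<longleftrightarrow> (\<exists>g. (\<forall>x. (f has_real_derivative g x) (at x)) \<and> C_times k g)"
proof
  assume f: "C_times (Suc k) f"
  then have d: "f differentiable (at x)" for x by simp
  have "(f has_real_derivative frechet_derivative f (at x) 1) (at x)" for x
  proof -
    have "(f has_derivative frechet_derivative f (at x)) (at x)" using d frechet_derivative_works by blast
    moreover have "frechet_derivative f (at x) = (\<lambda>h. frechet_derivative f (at x) 1 * h)"
      using calculation has_derivative_bounded_linear real_bounded_linear by (metis mult.commute mult_1)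
    ultimately show ?thesis by (simp add: has_field_derivative_def)
  qed
  moreover have "C_times k (\<lambda>x. frechet_derivative f (at x) 1)" using f by simp
  ultimately show "\<exists>g. (\<forall>x. (f has_real_derivative g x) (at x)) \<and> C_times k g"
    by (intro exI[of _ "\<lambda>x. frechet_derivative f (at x) 1"]) simp
next
  assume "\<exists>g. (\<forall>x. (f has_real_derivative g x) (at x)) \<and> C_times k g"
  then obtain g where g: "\<And>x. (f has_real_derivative g x) (at x)" "C_times k g" by blast
  have "frechet_derivative f (at x) 1 = g x" for x
    using frechet_derivative_at[OF g(1)[of x, unfolded has_field_derivative_def]] by (metis mult_1_right)
  moreover have "f differentiable (at x)" for x
    using g(1) by (meson differentiableI has_field_derivative_imp_has_derivative)
  ultimately show "C_times (Suc k) f" using g(2) by simp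
qed

declare C_times.simps(2)[simp del]

lemma C_times_SucI:
  fixes f :: "real \<Rightarrow> real"
  assumes "\<And>x. (f has_real_derivative g x) (at x)" "C_times k g"
  shows "C_times (Suc k) f"
  unfolding C_times_Suc_real using assms by (intro exI[of _ g]) simp

lemma C_times_SucE:
  fixes f :: "real \<Rightarrow> real"
  assumes "C_times (Suc k) f"
  obtains g where "\<And>x. (f has_real_derivative g x) (at x)" "C_times k g"
  using assms C_times_Suc_real by auto

lemma C_times_0I:
  fixes f :: "real \<Rightarrow> real"
  assumes "\<And>x. (f has_real_derivative g x) (at x)"
  shows "C_times 0 f"
  using DERIV_isCont[OF assms] by (simp add: continuous_at_imp_continuous_on)

lemma C_times_Suc_imp:
  fixes f :: "real \<Rightarrow> real"
  assumes "C_times (Suc k) f"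
  shows "C_times k f"
  using assms
proof (induction k arbitrary: f)
  case 0
  obtain g where g: "\<And>x. (f has_real_derivative g x) (at x)" using C_times_SucE[OF 0] by metis
  show ?case by (rule C_times_0I[OF g])
next
  case (Suc k)
  from Suc.prems obtain g where "\<And>x. (f has_real_derivative g x) (at x)" "C_times (Suc k) g"
    using C_times_SucE by metis
  then show ?case by (intro C_times_SucI[of f g] Suc.IH)
qed

lemma C_times_const: "C_times k (\<lambda>x::real. c::real)"
proof (induction k arbitrary: c)
  case (Suc k)
  then show ?case by (intro C_times_SucI[of _ "\<lambda>_. 0"]) auto
qed simp

lemma C_times_add:
  fixes f g :: "real \<Rightarrow> real"
  assumes "C_times k f" "C_times k g"
  shows "C_times k (\<lambda>x. f x + g x)"
  using assms
proof (induction k arbitrary: f g)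
  case (Suc k)
  from Suc.prems obtain f' g' where "\<And>x. (f has_real_derivative f' x) (at x)" "C_times k f'"
    "\<And>x. (g has_real_derivative g' x) (at x)" "C_times k g'"
    using C_times_SucE[OF Suc.prems(1)] C_times_SucE[OF Suc.prems(2)] by metis
  then show ?case by (intro C_times_SucI[of _ "\<lambda>x. f' x + g' x"] DERIV_add Suc.IH)
qed (auto intro: continuous_intros)

lemma C_times_mult:
  fixes f g :: "real \<Rightarrow> real"
  assumes "C_times k f" "C_times k g"
  shows "C_times k (\<lambda>x. f x * g x)"
  using assms
proof (induction k arbitrary: f g)
  case (Suc k)
  from Suc.prems obtain f' g' where *: "\<And>x. (f has_real_derivative f' x) (at x)" "C_times k f'"
    "\<And>x. (g has_real_derivative g' x) (at x)" "C_times k g'"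
    using C_times_SucE[OF Suc.prems(1)] C_times_SucE[OF Suc.prems(2)] by metis
  have s: "C_times k (\<lambda>x. f' x * g x + f x * g' x)"
  proof (rule C_times_add)
    show "C_times k (\<lambda>x. f' x * g x)"
      by (rule Suc.IH[OF *(2) C_times_Suc_imp[OF Suc.prems(2)]])
    show "C_times k (\<lambda>x. f x * g' x)"
      by (rule Suc.IH[OF C_times_Suc_imp[OF Suc.prems(1)] *(4)])
  qed
  have d: "((\<lambda>x. f x * g x) has_real_derivative (f' x * g x + f x * g' x)) (at x)" for x
    using DERIV_mult[OF *(1)[of x] *(3)[of x]] by (simp add: mult.commute)
  show ?case by (rule C_times_SucI[OF d s])
qed (auto intro: continuous_intros)

lemma C_times_affine:
  fixes f :: "real \<Rightarrow> real"
  assumes "C_times k f"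
  shows "C_times k (\<lambda>x. f (a * x + b))"
  using assms
proof (induction k arbitrary: f)
  case 0
  then have "continuous_on UNIV f" by simp
  then have "continuous_on UNIV (\<lambda>x. f (a * x + b))"
    by (rule continuous_on_compose2) (auto intro!: continuous_intros)
  then show ?case by simp
next
  case (Suc k)
  from Suc.prems obtain f' where *: "\<And>x. (f has_real_derivative f' x) (at x)" "C_times k f'"
    using C_times_SucE[OF Suc.prems] by metis
  have s: "C_times k (\<lambda>x. f' (a * x + b) * a)" by (intro C_times_mult C_times_const Suc.IH *)
  have d: "((\<lambda>x. f (a * x + b)) has_real_derivative (f' (a * x + b) * a)) (at x)" for x
    by (rule DERIV_chain2[OF *(1)]) (auto intro!: derivative_eq_intros)
  show ?case by (rule C_times_SucI[OF d s])
qed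

lemma C_times_exp: "C_times k (\<lambda>x::real. exp (a * x))"
proof (induction k)
  case (Suc k)
  have d: "((\<lambda>x. exp (a * x)) has_real_derivative (a * exp (a * x))) (at x)" for x
    by (auto intro!: derivative_eq_intros)
  have s: "C_times k (\<lambda>x. a * exp (a * x))" by (intro C_times_mult C_times_const Suc)
  show ?case by (rule C_times_SucI[OF d s])
qed (auto intro!: continuous_intros)

section \<open>Flat functions and bump functions\<close>

definition flat_poly :: "real poly \<Rightarrow> real \<Rightarrow> real" where
  "flat_poly p t = (if t \<le> 0 then 0 else poly p (1 / t) * exp (- (1 / t)))"

text \<open>The extra power \<open>s ^ k\<close> makes the induction on coefficients close:
  splitting off the constant coefficient leaves \<open>s * poly p s\<close>, which is absorbed by
  raising \<open>k\<close>. The use at the origin takes \<open>k = 1\<close>.\<close>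

lemma tendsto_poly_mult_exp_minus:
  "((\<lambda>s::real. s ^ k * poly p s * exp (- s)) \<longlongrightarrow> 0) at_top"
proof (induction p arbitrary: k)
  case (pCons a p)
  have "((\<lambda>s::real. a * (s ^ k / exp s) + s ^ Suc k * poly p s * exp (- s)) \<longlongrightarrow> a * 0 + 0) at_top"
    by (intro tendsto_intros tendsto_power_div_exp_0 pCons.IH)
  then show ?case by (simp add: exp_minus field_simps)
qed simp

text \<open>The polynomial is carried along because the family is closed under differentiation: with
  s = 1/t, differentiating p(s) exp(-s) in t produces the factor s^2 and the polynomial p - p'.
  Smoothness of exp(-1/t) is then a plain induction. Only the origin escapes the chain rule; there
  the right difference quotient is s p(s) exp(-s) with s tending to infinity.\<close>

lemma flat_poly_has_derivative:
  "(flat_poly p has_real_derivative flat_poly ([:0, 0, 1:] * (p - pderiv p)) t) (at t)"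
proof -
  consider "t > 0" | "t < 0" | "t = 0" by linarith
  then show ?thesis
  proof cases
    case 1
    have "((\<lambda>t. poly p (1 / t) * exp (- (1 / t))) has_real_derivative
        flat_poly ([:0, 0, 1:] * (p - pderiv p)) t) (at t)"
      using 1 by (auto intro!: derivative_eq_intros poly_DERIV[THEN DERIV_chain2]
        simp: flat_poly_def field_simps power2_eq_square)
    then show ?thesis
      by (rule has_field_derivative_transform_within_open[of _ _ _ "{0<..}"]) (use 1 in \<open>auto simp: flat_poly_def\<close>)
  next
    case 2
    have "((\<lambda>t. 0) has_real_derivative flat_poly ([:0, 0, 1:] * (p - pderiv p)) t) (at t)"
      using 2 by (simp add: flat_poly_def)
    then show ?thesis
      by (rule has_field_derivative_transform_within_open[of _ _ _ "{..<0}"]) (use 2 in \<open>auto simp: flat_poly_def\<close>)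
  next
    case 3
    have "((\<lambda>h. poly p (1/h) * exp (- (1/h)) / h) \<longlongrightarrow> 0) (at_right 0)"
    proof -
      have "((\<lambda>h. (inverse h) ^ 1 * poly p (inverse h) * exp (- (inverse h))) \<longlongrightarrow> 0) (at_right (0::real))"
        by (rule filterlim_compose[OF tendsto_poly_mult_exp_minus filterlim_inverse_at_top_right])
      then show ?thesis by (simp add: field_simps)
    qed
    moreover have "\<forall>\<^sub>F h in at_right 0. poly p (1/h) * exp (- (1/h)) / h = (flat_poly p (0 + h) - flat_poly p 0) / h"
      unfolding eventually_at_filter by (auto simp: flat_poly_def)
    ultimately have r: "((\<lambda>h. (flat_poly p (0 + h) - flat_poly p 0) / h) \<longlongrightarrow> 0) (at_right 0)"
      by (rule Lim_transform_eventually)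
    have "\<forall>\<^sub>F h in at_left 0. 0 = (flat_poly p (0 + h) - flat_poly p 0) / h"
      unfolding eventually_at_filter by (auto simp: flat_poly_def)
    then have l: "((\<lambda>h. (flat_poly p (0 + h) - flat_poly p 0) / h) \<longlongrightarrow> 0) (at_left 0)"
      by (rule Lim_transform_eventually[rotated]) simp
    have "(flat_poly p has_real_derivative 0) (at 0)"
      unfolding DERIV_def using l r by (simp add: filterlim_at_split)
    then show ?thesis by (simp add: 3 flat_poly_def)
  qed
qed

lemma C_times_flat_poly: "C_times k (flat_poly p)"
proof (induction k arbitrary: p)
  case 0
  then show ?case
    by (rule C_times_0I[OF flat_poly_has_derivative])
next
  case (Suc k)
  then show ?case by (intro C_times_SucI[OF flat_poly_has_derivative])
qed

text \<open>Two one-sided flat factors vanish outside the open interval. The scale \<open>k\<close>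
  flattens exp(-1/(k s)) towards 1, so the bumps stay between 0 and 1 and tend to the indicator of
  the interval; no mollification is involved.\<close>

definition bump :: "real \<Rightarrow> real \<Rightarrow> nat \<Rightarrow> real \<Rightarrow> real" where
  "bump p q k t = flat_poly 1 (real k * (t - p)) * flat_poly 1 (real k * (q - t))"

lemma C_times_bump: "C_times m (bump p q k)"
proof -
  have "bump p q k = (\<lambda>t. flat_poly 1 (real k * t + (- real k * p)) * flat_poly 1 ((- real k) * t + real k * q))"
    by (auto simp: bump_def algebra_simps)
  moreover have "C_times m \<dots>"
    by (rule C_times_mult[OF C_times_affine[OF C_times_flat_poly] C_times_affine[OF C_times_flat_poly]])
  ultimately show ?thesis by simp
qed

lemma bump_eq_0: "t \<notin> {p<..<q} \<Longrightarrow> bump p q k t = 0"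
  by (auto simp: bump_def flat_poly_def not_less mult_le_0_iff)

lemma bump_bounds: "0 \<le> bump p q k t" "bump p q k t \<le> 1"
proof -
  have "0 \<le> flat_poly 1 s \<and> flat_poly 1 s \<le> 1" for s by (auto simp: flat_poly_def)
  then show "0 \<le> bump p q k t" "bump p q k t \<le> 1" by (auto simp: bump_def intro!: mult_le_one)
qed

lemma bump_tendsto: "(\<lambda>k. bump p q k t) \<longlonglongrightarrow> indicator {p<..<q} t"
proof (cases "t \<in> {p<..<q}")
  case True
  have *: "(\<lambda>k. flat_poly 1 (real k * s)) \<longlonglongrightarrow> 1" if "s > 0" for s
  proof -
    have "(\<lambda>k. exp (- (1/s) * (1 / real k))) \<longlonglongrightarrow> exp (- (1/s) * 0)"
      by (intro tendsto_intros lim_1_over_n)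
    moreover have "\<forall>\<^sub>F k in sequentially. exp (- (1/s) * (1 / real k)) = flat_poly 1 (real k * s)"
      using eventually_gt_at_top[of 0] by eventually_elim (use that in \<open>auto simp: flat_poly_def mult_le_0_iff mult.commute\<close>)
    ultimately show ?thesis by (auto dest: Lim_transform_eventually)
  qed
  have "(\<lambda>k. bump p q k t) \<longlonglongrightarrow> 1 * 1"
    unfolding bump_def using True by (intro tendsto_mult *) auto
  then show ?thesis using True by simp
qed (simp add: bump_eq_0)

section \<open>Test functions on the line and their primitives\<close>

lemma test_functions_realI:
  fixes \<phi> :: "real \<Rightarrow> real"
  assumes "\<And>k. C_times k \<phi>" "\<And>t. t \<notin> {a..b} \<Longrightarrow> \<phi> t = 0" "{a..b} \<subseteq> S"
  shows "\<phi> \<in> test_functions S"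
proof -
  have "{t. \<phi> t \<noteq> 0} \<subseteq> {a..b}" using assms(2) by blast
  then have c: "closure {t. \<phi> t \<noteq> 0} \<subseteq> {a..b}" by (simp add: closure_minimal)
  then have "compact (closure {t. \<phi> t \<noteq> 0})"
    by (meson bounded_closed_interval bounded_subset closed_closure compact_eq_bounded_closed)
  then show ?thesis using assms c by (auto simp: test_functions_def)
qed

text \<open>A test function is the derivative of another one as soon as its mean vanishes: the
  primitive that starts at \<open>a\<close> is zero to the left of \<open>a\<close>, and to the
  right of \<open>b\<close> it equals the total integral.\<close>

lemma smooth_compact_antiderivative:
  fixes g :: "real \<Rightarrow> real"
  assumes g: "\<And>k. C_times k g" "\<And>t. t \<notin> {a..b} \<Longrightarrow> g t = 0" and ab: "a \<le> b" and int: "integral {a..b} g = 0"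
  obtains \<psi> where "\<And>k. C_times k \<psi>" "\<And>t. t \<notin> {a..b} \<Longrightarrow> \<psi> t = 0"
    "\<And>t. (\<psi> has_real_derivative g t) (at t)"
proof -
  have cg: "continuous_on UNIV g" using g(1)[of 0] by simp
  then have "isCont g x" for x by (simp add: continuous_on_eq_continuous_at)
  \<comment> \<open>With both end points infinite, one primitive serves the whole line and its
    derivative at \<open>a\<close> and \<open>b\<close> is two-sided.\<close>
  then have "\<exists>F. \<forall>x::real. -\<infinity> < ereal x \<longrightarrow> ereal x < \<infinity> \<longrightarrow> (F has_vector_derivative g x) (at x)"
    by (intro einterval_antiderivative) simp_all
  then obtain F where "\<forall>x::real. -\<infinity> < ereal x \<longrightarrow> ereal x < \<infinity> \<longrightarrow> (F has_vector_derivative g x) (at x)"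
    by (rule exE)
  then have F: "(F has_vector_derivative g x) (at x)" for x by simp
  have FTC: "(g has_integral (F y - F x)) {x..y}" if "x \<le> y" for x y
    by (rule fundamental_theorem_of_calculus[OF that has_vector_derivative_at_within[OF F]])
  have g0: "(g has_integral 0) {x..y}" if "{x<..<y} \<inter> {a..b} = {}" for x y
  proof -
    have "(g has_integral 0) {x<..<y}"
    proof (rule has_integral_is_0)
      fix s assume "s \<in> {x<..<y}"
      then have "s \<notin> {a..b}" using that by blast
      then show "g s = 0" by (rule g(2))
    qed
    then show ?thesis by (simp add: has_integral_Icc_iff_Ioo)
  qed
  define \<psi> where "\<psi> t = F t - F a" for t
  have d: "(\<psi> has_real_derivative g t) (at t)" for t
    using F[of t] unfolding \<psi>_def has_real_derivative_iff_has_vector_derivative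
    by (auto intro!: derivative_eq_intros)
  have "C_times k \<psi>" for k
  proof (cases k)
    case 0
    then show ?thesis using C_times_0I[OF d] by simp
  next
    case (Suc n)
    then show ?thesis using C_times_SucI[OF d g(1)] by simp
  qed
  moreover have "\<psi> t = 0" if "t \<notin> {a..b}" for t
  proof (cases "t < a")
    case True
    have "F a - F t = 0"
      by (rule has_integral_unique[OF FTC g0]) (use True in auto)
    then show ?thesis by (simp add: \<psi>_def)
  next
    case False
    have "F t - F b = 0"
      by (rule has_integral_unique[OF FTC g0]) (use False that in auto)
    moreover have "F b - F a = 0" using FTC[OF ab] int by (simp add: integral_unique)
    ultimately show ?thesis by (simp add: \<psi>_def)
  qed
  ultimately show ?thesis using that d by blast
qed

section \<open>Du Bois-Reymond lemma and exponential decay\<close>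

lemma continuous_measurable_lebesgue_on:
  fixes g :: "'a::euclidean_space \<Rightarrow> 'b::euclidean_space"
  assumes "continuous_on UNIV g"
  shows "g \<in> borel_measurable (lebesgue_on S)"
  using assms by (intro measurable_restrict_space1 measurable_completion) (simp add: borel_measurable_continuous_onI)

text \<open>Completeness of Lebesgue measure. It supplies measurability for functions of time about
  which only an almost everywhere identity is known.\<close>

lemma borel_measurable_lebesgue_on_AE:
  fixes f g :: "'a::euclidean_space \<Rightarrow> 'b::euclidean_space"
  assumes S: "S \<in> sets lebesgue" and f: "f \<in> borel_measurable (lebesgue_on S)"
    and ae: "AE x in lebesgue_on S. f x = g x"
  shows "g \<in> borel_measurable (lebesgue_on S)"
proof -
  have "(\<lambda>x. indicator S x *\<^sub>R f x) \<in> borel_measurable lebesgue"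
    using f S by (simp add: borel_measurable_restrict_space_iff)
  moreover have "AE x in lebesgue. indicator S x *\<^sub>R f x = indicator S x *\<^sub>R g x"
    using ae S by (auto simp: AE_restrict_space_iff indicator_def elim!: eventually_mono)
  ultimately have "(\<lambda>x. indicator S x *\<^sub>R g x) \<in> borel_measurable lebesgue"
    by (rule borel_measurable_AE)
  then show ?thesis using S by (simp add: borel_measurable_restrict_space_iff)
qed

lemma borel_measurable_lebesgue_on_AE_LIMSEQ:
  fixes f :: "nat \<Rightarrow> 'a::euclidean_space \<Rightarrow> 'b::euclidean_space"
  assumes S: "S \<in> sets lebesgue" and f: "\<And>k. f k \<in> borel_measurable (lebesgue_on S)"
    and lim: "AE x in lebesgue_on S. (\<lambda>k. f k x) \<longlonglongrightarrow> g x"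
  shows "g \<in> borel_measurable (lebesgue_on S)"
proof (rule borel_measurable_lebesgue_on_AE[OF S borel_measurable_lim_metric[OF f]])
  show "AE x in lebesgue_on S. lim (\<lambda>k. f k x) = g x"
    using lim by eventually_elim (rule limI)
qed

lemma AE_lebesgue_on_neq: "AE y in lebesgue_on \<Omega>. y \<noteq> x" if "\<Omega> \<in> sets lebesgue" for x :: "'a::euclidean_space"
proof -
  have "AE y in lebesgue. y \<noteq> x" by (intro AE_completion AE_lborel_singleton)
  then show ?thesis using that by (auto simp: AE_restrict_space_iff)
qed

lemma integrable_lebesgue_on_supset:
  fixes f :: "'a::euclidean_space \<Rightarrow> 'b::euclidean_space"
  assumes "integrable (lebesgue_on S) f" "S \<in> sets lebesgue" "T \<in> sets lebesgue" "S \<subseteq> T"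
    "\<And>x. x \<in> T - S \<Longrightarrow> f x = 0"
  shows "integrable (lebesgue_on T) f"
proof -
  have "integrable lebesgue (\<lambda>x. indicator S x *\<^sub>R f x)"
    using assms by (simp add: integrable_restrict_space)
  moreover have "indicator S x *\<^sub>R f x = indicator T x *\<^sub>R f x" for x
    using assms(4,5) by (auto simp: indicator_def)
  ultimately show ?thesis using assms(3) by (simp add: integrable_restrict_space)
qed

lemma integral_lebesgue_on_supset:
  fixes f :: "'a::euclidean_space \<Rightarrow> 'b::euclidean_space"
  assumes "S \<in> sets lebesgue" "T \<in> sets lebesgue" "S \<subseteq> T" "\<And>x. x \<in> T - S \<Longrightarrow> f x = 0"
  shows "integral\<^sup>L (lebesgue_on T) f = integral\<^sup>L (lebesgue_on S) f"
proof -
  have eq: "(\<lambda>x. indicator S x *\<^sub>R f x) = (\<lambda>x. indicator T x *\<^sub>R f x)"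
    using assms(3,4) by (auto simp: indicator_def fun_eq_iff)
  show ?thesis using assms(1,2) by (simp add: integral_restrict_space eq)
qed

lemma integrable_mult_compact_support:
  fixes h g :: "real \<Rightarrow> real"
  assumes h: "\<And>T. integrable (lebesgue_on {0<..<T}) h"
    and g: "continuous_on UNIV g" "\<And>t. t \<notin> {a..b} \<Longrightarrow> g t = 0"
  shows "integrable (lebesgue_on {0<..}) (\<lambda>t. h t * g t)"
\<comment> \<open>The open interval up to \<open>b+1\<close> contains the part of the closed support
  that lies in the half-line.\<close>
proof (rule integrable_lebesgue_on_supset[of "{0<..<b+1}"])
  have "compact (g ` {a..b})"
    by (rule compact_continuous_image[OF continuous_on_subset[OF g(1)]]) simp_all
  then obtain B where "\<forall>y\<in>g ` {a..b}. norm y \<le> B"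
    by (auto dest!: compact_imp_bounded simp: bounded_iff)
  then have B: "norm (g t) \<le> B" if "t \<in> {a..b}" for t using that by blast
  have B': "norm (g t) \<le> \<bar>B\<bar>" for t 
  proof (cases "t \<in> {a..b}")
    case True
    then show ?thesis using B[OF True] by linarith
  next
    case False
    then show ?thesis using g(2)[OF False] by simp
  qed
  show "integrable (lebesgue_on {0<..<b+1}) (\<lambda>t. h t * g t)"
  proof (rule Bochner_Integration.integrable_bound[of _ "\<lambda>t. \<bar>B\<bar> * h t"])
    show "integrable (lebesgue_on {0<..<b+1}) (\<lambda>t. \<bar>B\<bar> * h t)" using h by simp
    show "(\<lambda>t. h t * g t) \<in> borel_measurable (lebesgue_on {0<..<b+1})"
      using h[of "b+1"] continuous_measurable_lebesgue_on[OF g(1)] by (intro borel_measurable_times) auto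
    show "AE t in lebesgue_on {0<..<b+1}. norm (h t * g t) \<le> norm (\<bar>B\<bar> * h t)"
    proof (rule AE_I2)
      fix t
      show "norm (h t * g t) \<le> norm (\<bar>B\<bar> * h t)"
        using mult_right_mono[OF B'[of t], of "\<bar>h t\<bar>"] by (simp add: abs_mult mult.commute)
    qed
  qed
qed (use g(2) in auto)

lemma integral_compact_support:
  fixes g :: "real \<Rightarrow> real"
  assumes a: "0 < a" and g: "continuous_on UNIV g" "\<And>t. t \<notin> {a..b} \<Longrightarrow> g t = 0"
  shows "(\<integral>t. g t \<partial>lebesgue_on {0<..}) = integral {a..b} g"
proof -
  have "integrable (lebesgue_on {a..b}) g"
    by (rule continuous_imp_integrable_real[OF continuous_on_subset[OF g(1)]]) simp
  then have "(\<integral>t. g t \<partial>lebesgue_on {a..b}) = integral {a..b} g"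
    by (intro lebesgue_integral_eq_integral) auto
  moreover have "(\<integral>t. g t \<partial>lebesgue_on {0<..}) = (\<integral>t. g t \<partial>lebesgue_on {a..b})"
    using a g(2) by (intro integral_lebesgue_on_supset) auto
  ultimately show ?thesis by simp
qed

text \<open>Dominated convergence with majorant \<bar>h\<bar> cut off at \<open>q\<close>, beyond
  which all bumps vanish. The limit of the bumps is the indicator of the open interval; the closed
  interval differs by two points and is the form in which balls appear later.\<close>

lemma bump_integral_tendsto:
  assumes h: "\<And>T. integrable (lebesgue_on {0<..<T}) h"
  shows "(\<lambda>k. \<integral>t. h t * bump p q k t \<partial>lebesgue_on {0<..}) \<longlonglongrightarrow> (\<integral>t. h t * indicator {p..q} t \<partial>lebesgue_on {0<..})"
proof (rule integral_dominated_convergence)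
  let ?M = "lebesgue_on {0::real<..}"
  let ?w = "\<lambda>t. indicator {0<..<q} t * \<bar>h t\<bar>"
  have "integrable (lebesgue_on {0<..<q}) ?w"
    using h[of q] by (subst Bochner_Integration.integrable_cong[of _ _ _ "\<lambda>t. \<bar>h t\<bar>"]) auto
  then show "integrable ?M ?w"
    by (rule integrable_lebesgue_on_supset) auto
  have cont: "continuous_on UNIV (bump p q k)" for k using C_times_bump[of 0] by simp
  show meas: "(\<lambda>t. h t * bump p q k t) \<in> borel_measurable ?M" for k
    by (rule borel_measurable_integrable, rule integrable_mult_compact_support[OF h cont, of p q])
       (auto simp: bump_eq_0)
  have "AE t in ?M. t \<noteq> p" "AE t in ?M. t \<noteq> q" by (simp_all add: AE_lebesgue_on_neq)
  then show lim: "AE t in ?M. (\<lambda>k. h t * bump p q k t) \<longlonglongrightarrow> h t * indicator {p..q} t"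
  proof eventually_elim
    case (elim t)
    then have "indicator {p..q} t = (indicator {p<..<q} t :: real)" by (auto simp: indicator_def)
    then show ?case by (simp only:) (intro tendsto_intros bump_tendsto)
  qed
  show "(\<lambda>t. h t * indicator {p..q} t) \<in> borel_measurable ?M"
    by (rule borel_measurable_lebesgue_on_AE_LIMSEQ[OF _ meas lim]) simp
  show "AE t in ?M. norm (h t * bump p q k t) \<le> ?w t" for k
  proof (rule AE_I2)
    fix t assume "t \<in> space ?M"
    then show "norm (h t * bump p q k t) \<le> ?w t"
      using bump_eq_0[of t p q k] bump_bounds[of p q k t]
      by (cases "t < q") (auto simp: abs_mult intro!: mult_left_le)
  qed
qed

text \<open>Du Bois-Reymond. A combination of two bumps with vanishing mean is a derivative, so
  \<open>h\<close> annihilates it; in the limit the mean of \<open>h\<close> over an interval is the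
  same for all intervals. Intervals are the balls of the line, so subtracting this common mean
  leaves a function whose integrals over small balls vanish.\<close>

lemma AE_const_if_weak_deriv_zero:
  fixes h :: "real \<Rightarrow> real"
  assumes h: "\<And>T. integrable (lebesgue_on {0<..<T}) h"
    and weak: "\<And>\<psi> g a b. \<lbrakk>0 < a; \<And>k. C_times k \<psi>; \<And>t. t \<notin> {a..b} \<Longrightarrow> \<psi> t = 0;
      \<And>t. (\<psi> has_real_derivative g t) (at t); continuous_on UNIV g; \<And>t. t \<notin> {a..b} \<Longrightarrow> g t = 0\<rbrakk>
      \<Longrightarrow> (\<integral>t. h t * g t \<partial>lebesgue_on {0<..}) = 0"
  shows "\<exists>c. AE t in lebesgue_on {0<..}. h t = c"
proof -
  define M where "M = lebesgue_on {0::real<..}"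
  have one: "integrable (lebesgue_on {0<..<T}) (\<lambda>_. 1::real)" for T :: real
    using finite_measure.integrable_const[OF finite_measure_lebesgue_on[of "{0<..<T}"]] by simp
  define I where "I k p q = (\<integral>t. bump p q k t \<partial>M)" for k p q
  define H where "H k p q = (\<integral>t. h t * bump p q k t \<partial>M)" for k p q
  define L where "L p q = (\<integral>t. h t * indicator {p..q} t \<partial>M)" for p q
  have cont: "continuous_on UNIV (bump p q k)" for p q k using C_times_bump[of 0] by simp
  have ih: "integrable M (\<lambda>t. h t * bump p q k t)" for p q k
    unfolding M_def by (rule integrable_mult_compact_support[OF h cont, of p q]) (auto simp: bump_eq_0)
  have ii: "integrable M (\<lambda>t. bump p q k t)" for p q k
  proof -
    have "integrable M (\<lambda>t. 1 * bump p q k t)"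
      unfolding M_def by (rule integrable_mult_compact_support[OF one cont, of p q]) (auto simp: bump_eq_0)
    then show ?thesis by simp
  qed
  have cross: "I k p' q' * H k p q = I k p q * H k p' q'"
    if "0 < p" "p < q" "0 < p'" "p' < q'" for k p q p' q'
  proof -
    \<comment> \<open>The coefficients are the masses of the opposite bumps, which makes the mean of
      \<open>g\<close> zero without normalising either bump.\<close>
    define g where "g t = I k p' q' * bump p q k t + (- I k p q) * bump p' q' k t" for t
    define a where "a = min p p'"
    define b where "b = max q q'"
    have ab: "0 < a" "a \<le> b" using that by (auto simp: a_def b_def)
    have gs: "C_times m g" for m
      unfolding g_def by (intro C_times_add C_times_mult C_times_const C_times_bump)
    have gc: "continuous_on UNIV g" using gs[of 0] by simp
    have g0: "g t = 0" if "t \<notin> {a..b}" for t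
    proof -
      have "t \<notin> {p<..<q}" "t \<notin> {p'<..<q'}" using that by (auto simp: a_def b_def)
      then show ?thesis by (simp add: g_def bump_eq_0)
    qed
    have "integral {a..b} g = (\<integral>t. g t \<partial>M)"
      unfolding M_def by (rule integral_compact_support[OF ab(1) gc g0, symmetric])
    also have "\<dots> = I k p' q' * I k p q - I k p q * I k p' q'"
      unfolding g_def using ii by (simp add: I_def)
    finally have "integral {a..b} g = 0" by simp
    then obtain \<psi> where \<psi>: "\<And>k. C_times k \<psi>" "\<And>t. t \<notin> {a..b} \<Longrightarrow> \<psi> t = 0"
       "\<And>t. (\<psi> has_real_derivative g t) (at t)"
      using smooth_compact_antiderivative[OF gs g0 ab(2)] by metis
    have "0 = (\<integral>t. h t * g t \<partial>M)"
      unfolding M_def using weak[OF ab(1) \<psi> gc g0] by simp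
    also have "\<dots> = (\<integral>t. I k p' q' * (h t * bump p q k t) - I k p q * (h t * bump p' q' k t) \<partial>M)"
      by (simp add: g_def algebra_simps)
    also have "\<dots> = I k p' q' * H k p q - I k p q * H k p' q'"
      using ih by (simp add: H_def)
    finally show ?thesis by simp
  qed
  have limH: "(\<lambda>k. H k p q) \<longlonglongrightarrow> L p q" for p q
    unfolding H_def L_def M_def by (rule bump_integral_tendsto[OF h])
  have limI: "(\<lambda>k. I k p q) \<longlonglongrightarrow> q - p" if "0 < p" "p < q" for p q
  proof -
    have "(\<lambda>k. I k p q) \<longlonglongrightarrow> (\<integral>t. indicator {p..q} t \<partial>M)"
      unfolding I_def M_def using bump_integral_tendsto[OF one, of p q] by simp
    moreover have "(\<integral>t. indicator {p..q} t \<partial>M) = measure M ({p..q} \<inter> space M)"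
      using Bochner_Integration.integral_indicator by blast
    moreover have "{p..q} \<inter> space M = {p..q}" using that by (auto simp: M_def)
    moreover have "measure M {p..q} = q - p"
      unfolding M_def using that by (subst measure_restrict_space) auto
    ultimately show ?thesis by simp
  qed
  have L: "L p q = L 1 2 * (q - p)" if "0 < p" "p < q" for p q
  proof -
    have "(\<lambda>k. I k 1 2 * H k p q) \<longlonglongrightarrow> (2 - 1) * L p q"
      by (intro tendsto_mult limI limH) auto
    moreover have "(\<lambda>k. I k 1 2 * H k p q) \<longlonglongrightarrow> (q - p) * L 1 2"
      using tendsto_mult[OF limI[OF that] limH[of 1 2]] cross[OF that, of 1 2] by simp
    ultimately have "(2 - 1) * L p q = (q - p) * L 1 2" by (rule LIMSEQ_unique)
    then show ?thesis by (simp add: mult.commute)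
  qed
  \<comment> \<open>The reference interval from 1 to 2 has length one, so its integral is already
    the common mean.\<close>
  define c where "c = L 1 2"
  have AET: "AE t in lebesgue_on {0<..<T}. h t - c = 0" for T
  proof (rule AE_zero_if_ball_integrals_zero)
    show ih: "integrable (lebesgue_on {0<..<T}) (\<lambda>t. h t - c)"
      using h finite_measure.integrable_const[OF finite_measure_lebesgue_on[of "{0<..<T}"], of c]
      by (intro Bochner_Integration.integrable_diff) simp_all
    fix x d :: real assume x: "x \<in> {0<..<T}" and d: "0 < d"
    \<comment> \<open>Half of the smallest margin: the ball around \<open>x\<close> stays inside the
      interval and its radius stays below \<open>d\<close>.\<close>
    define r where "r = min d (min x (T - x)) / 2"
    have "0 < 2 * r" "2 * r \<le> d" "2 * r \<le> x" "2 * r \<le> T - x" using x d by (auto simp: r_def)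
    then have r: "0 < r" "r < d" "0 < x - r" "x + r < T" by linarith+
    let ?I = "{x-r..x+r}"
    have ball: "cball x r = ?I" by (auto simp: dist_real_def)
    have sub: "?I \<inter> {0<..<T} = ?I" using r by auto
    have S: "?I \<in> sets (lebesgue_on {0<..<T})"
      using r by (subst sets_restrict_space_iff) auto
    have "integrable (lebesgue_on {0<..<T}) (\<lambda>y. h y * indicator ?I y)"
      using integrable_mult_indicator[OF S h] by (simp add: mult.commute)
    moreover have "integrable (lebesgue_on {0<..<T}) (\<lambda>y. indicator ?I y :: real)"
      using integrable_mult_indicator[OF S one] by simp
    ultimately have "(\<integral>y. h y * indicator ?I y - c * indicator ?I y \<partial>lebesgue_on {0<..<T})
      = (\<integral>y. h y * indicator ?I y \<partial>lebesgue_on {0<..<T}) - c * (\<integral>y. indicator ?I y \<partial>lebesgue_on {0<..<T})"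
      by simp
    also have "(\<integral>y. h y * indicator ?I y \<partial>lebesgue_on {0<..<T}) = L (x-r) (x+r)"
      unfolding L_def M_def using r by (intro integral_lebesgue_on_supset[symmetric]) auto
    also have "(\<integral>y. indicator ?I y \<partial>lebesgue_on {0<..<T}) = measure (lebesgue_on {0<..<T}) ?I"
      using Bochner_Integration.integral_indicator[of "lebesgue_on {0<..<T}" ?I] by (simp add: sub)
    also have "\<dots> = 2 * r" using r by (subst measure_restrict_space) auto
    finally have "(\<integral>y. indicator (cball x r) y *\<^sub>R (h y - c) \<partial>lebesgue_on {0<..<T}) = 0"
      using L[of "x-r" "x+r"] r by (simp add: c_def ball algebra_simps)
    then show "\<exists>z r. 0 < r \<and> r < d \<and> x \<in> cball z r \<and> (\<integral>y. indicator (cball z r) y *\<^sub>R (h y - c) \<partial>lebesgue_on {0<..<T}) = 0"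
      using r by (intro exI[of _ x] exI[of _ r]) auto
  qed auto
  have "AE t in lebesgue. \<forall>n::nat. t \<in> {0<..<real n} \<longrightarrow> h t - c = 0"
    using AET by (subst AE_all_countable) (auto simp: AE_restrict_space_iff)
  then have "AE t in lebesgue. t \<in> {0<..} \<longrightarrow> h t = c"
  proof eventually_elim
    case (elim t)
    show ?case using elim reals_Archimedean2[of t] by auto
  qed
  then show ?thesis by (intro exI[of _ c]) (auto simp: AE_restrict_space_iff)
qed

text \<open>Integrating factor: \<open>f\<close> times exp(t/\<tau>) should be constant. Since the
  derivative is distributional, the factor is moved to the test function, and Du Bois-Reymond is
  applied to the product \<open>h\<close>.\<close>

lemma distr_deriv_exponential_decay:
  fixes f F :: "real \<Rightarrow> real"
  assumes \<tau>: "\<tau> > 0" and f: "\<And>T. integrable (lebesgue_on {0<..<T}) f"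
    and F: "AE t in lebesgue_on {0<..}. F t = \<tau> * f t"
    and D: "has_distr_deriv {0<..} F (\<lambda>t. - f t)"
  shows "\<exists>c. AE t in lebesgue_on {0<..}. f t = c * exp (- t / \<tau>)"
proof -
  define h where "h t = f t * exp (t / \<tau>)" for t
  have e: "exp (t / \<tau>) = exp ((1/\<tau>) * t)" for t by simp
  have hi: "integrable (lebesgue_on {0<..<T}) h" for T
  proof (rule Bochner_Integration.integrable_bound[of _ "\<lambda>t. exp (T/\<tau>) * f t"])
    show "integrable (lebesgue_on {0<..<T}) (\<lambda>t. exp (T/\<tau>) * f t)" using f by simp
    have "continuous_on UNIV (\<lambda>t. exp (t/\<tau>))" using \<tau> by (intro continuous_intros) auto
    then show "h \<in> borel_measurable (lebesgue_on {0<..<T})"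
      unfolding h_def using f[of T] continuous_measurable_lebesgue_on by (intro borel_measurable_times) auto
    show "AE t in lebesgue_on {0<..<T}. norm (h t) \<le> norm (exp (T/\<tau>) * f t)"
      using \<tau> by (intro AE_I2) (auto simp: h_def abs_mult mult.commute divide_right_mono intro!: mult_left_mono)
  qed
  have "\<exists>c. AE t in lebesgue_on {0<..}. h t = c"
  proof (rule AE_const_if_weak_deriv_zero[OF hi])
    fix \<psi> g :: "real \<Rightarrow> real" and a b :: real
    assume a: "0 < a" and \<psi>: "\<And>k. C_times k \<psi>" "\<And>t. t \<notin> {a..b} \<Longrightarrow> \<psi> t = 0"
      and d: "\<And>t. (\<psi> has_real_derivative g t) (at t)"
      and g: "continuous_on UNIV g" "\<And>t. t \<notin> {a..b} \<Longrightarrow> g t = 0"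
    \<comment> \<open>Testing with exp(t/\<tau>) \<psi> turns pairings with \<open>f\<close> into
      pairings of \<open>h\<close> with \<psi> and its derivative.\<close>
    define \<phi> where "\<phi> t = exp (t/\<tau>) * \<psi> t" for t
    have "\<phi> \<in> test_functions {0<..}"
    proof (rule test_functions_realI[of _ a b])
      show "C_times k \<phi>" for k unfolding \<phi>_def e by (intro C_times_mult C_times_exp \<psi>(1))
    qed (use a \<psi>(2) in \<open>auto simp: \<phi>_def\<close>)
    then have 1: "(\<integral>t. F t * deriv \<phi> t \<partial>lebesgue_on {0<..}) = - (\<integral>t. - f t * \<phi> t \<partial>lebesgue_on {0<..})"
      using D unfolding has_distr_deriv_def by blast
    have d\<phi>: "deriv \<phi> t = exp (t/\<tau>) * (g t + \<psi> t / \<tau>)" for t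
    proof (rule DERIV_imp_deriv)
      show "(\<phi> has_real_derivative exp (t/\<tau>) * (g t + \<psi> t / \<tau>)) (at t)"
        unfolding \<phi>_def using \<tau> by (auto intro!: derivative_eq_intros d simp: field_simps)
    qed
    have \<psi>c: "continuous_on UNIV \<psi>" using \<psi>(1)[of 0] by simp
    have i1: "integrable (lebesgue_on {0<..}) (\<lambda>t. h t * g t)"
      by (rule integrable_mult_compact_support[OF hi g])
    have i2: "integrable (lebesgue_on {0<..}) (\<lambda>t. h t * \<psi> t)"
      by (rule integrable_mult_compact_support[OF hi \<psi>c \<psi>(2)])
    have "(\<integral>t. F t * deriv \<phi> t \<partial>lebesgue_on {0<..}) = (\<integral>t. \<tau> * (h t * g t) + h t * \<psi> t \<partial>lebesgue_on {0<..})"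
    proof (rule integral_cong_AE)
      show ae: "AE t in lebesgue_on {0<..}. F t * deriv \<phi> t = \<tau> * (h t * g t) + h t * \<psi> t"
        using F by eventually_elim (use \<tau> in \<open>auto simp: d\<phi> h_def field_simps\<close>)
      show m: "(\<lambda>t. \<tau> * (h t * g t) + h t * \<psi> t) \<in> borel_measurable (lebesgue_on {0<..})"
        using i1 i2 by (intro borel_measurable_integrable) simp
      \<comment> \<open>\<open>F\<close> is known only through its almost everywhere identity with
        \<open>\<tau> * f\<close>, so measurability is carried over from the other side.\<close>
      show "(\<lambda>t. F t * deriv \<phi> t) \<in> borel_measurable (lebesgue_on {0<..})"
        by (rule borel_measurable_lebesgue_on_AE[OF _ m]) (use ae in \<open>simp_all add: eq_commute\<close>)
    qed
    also have "\<dots> = \<tau> * (\<integral>t. h t * g t \<partial>lebesgue_on {0<..}) + (\<integral>t. h t * \<psi> t \<partial>lebesgue_on {0<..})"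
      using i1 i2 by simp
    \<comment> \<open>The zero-order term produced by differentiating the exponential is exactly the
      right-hand side of the equation, so it cancels and only the pairing with \<open>g\<close>
      remains.\<close>
    also have "(\<integral>t. h t * \<psi> t \<partial>lebesgue_on {0<..}) = (\<integral>t. F t * deriv \<phi> t \<partial>lebesgue_on {0<..})"
      unfolding 1 by (simp add: h_def \<phi>_def mult_ac)
    finally show "(\<integral>t. h t * g t \<partial>lebesgue_on {0<..}) = 0" using \<tau> by simp
  qed
  then obtain c where "AE t in lebesgue_on {0<..}. h t = c" by blast
  then have "AE t in lebesgue_on {0<..}. f t = c * exp (- t / \<tau>)"
    by eventually_elim (auto simp: h_def exp_minus field_simps)
  then show ?thesis by blast
qed

section \<open>Square integrable fields\<close>

lemma L2D:
  assumes "v \<in> L2 \<Omega>"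
  shows "v \<in> borel_measurable (lebesgue_on \<Omega>)" "integrable (lebesgue_on \<Omega>) (\<lambda>x. (norm (v x))\<^sup>2)"
  using assms by (auto simp: L2_def)

lemma L2_integrable_norm_mult:
  assumes u: "u \<in> L2 \<Omega>" and v: "v \<in> L2 \<Omega>"
  shows "integrable (lebesgue_on \<Omega>) (\<lambda>x. norm (u x) * norm (v x))"
proof (rule Bochner_Integration.integrable_bound)
  show "integrable (lebesgue_on \<Omega>) (\<lambda>x. (norm (u x))\<^sup>2 + (norm (v x))\<^sup>2)"
    using L2D(2)[OF u] L2D(2)[OF v] by simp
  show "(\<lambda>x. norm (u x) * norm (v x)) \<in> borel_measurable (lebesgue_on \<Omega>)"
    using L2D(1)[OF u] L2D(1)[OF v] by measurable
  show "AE x in lebesgue_on \<Omega>. norm (norm (u x) * norm (v x)) \<le> norm ((norm (u x))\<^sup>2 + (norm (v x))\<^sup>2)"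
  proof (rule AE_I2)
    fix x
    have "0 \<le> norm (u x) * norm (v x)" by simp
    then have "norm (u x) * norm (v x) \<le> (norm (u x))\<^sup>2 + (norm (v x))\<^sup>2"
      using sum_squares_bound[of "norm (u x)" "norm (v x)"] by linarith
    then show "norm (norm (u x) * norm (v x)) \<le> norm ((norm (u x))\<^sup>2 + (norm (v x))\<^sup>2)" by simp
  qed
qed

lemma L2_integrable_inner:
  assumes u: "u \<in> L2 \<Omega>" and v: "v \<in> L2 \<Omega>"
  shows "integrable (lebesgue_on \<Omega>) (\<lambda>x. u x \<bullet> v x)"
proof (rule Bochner_Integration.integrable_bound[OF L2_integrable_norm_mult[OF u v]])
  show "(\<lambda>x. u x \<bullet> v x) \<in> borel_measurable (lebesgue_on \<Omega>)"
    using L2D(1)[OF u] L2D(1)[OF v] by measurable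
qed (auto simp: Cauchy_Schwarz_ineq2)

lemma L2_scaleR:
  assumes "v \<in> L2 \<Omega>"
  shows "(\<lambda>x. c *\<^sub>R v x) \<in> L2 \<Omega>"
  using L2D[OF assms] by (auto simp: L2_def power_mult_distrib)

lemma L2_add:
  assumes u: "u \<in> L2 \<Omega>" and v: "v \<in> L2 \<Omega>"
  shows "(\<lambda>x. u x + v x) \<in> L2 \<Omega>"
proof -
  have m: "(\<lambda>x. u x + v x) \<in> borel_measurable (lebesgue_on \<Omega>)"
    using L2D(1)[OF u] L2D(1)[OF v] by measurable
  have "integrable (lebesgue_on \<Omega>) (\<lambda>x. (norm (u x))\<^sup>2 + (norm (v x))\<^sup>2 + 2 * (u x \<bullet> v x))"
    using L2D(2)[OF u] L2D(2)[OF v] L2_integrable_inner[OF u v] by simp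
  moreover have "(norm (u x))\<^sup>2 + (norm (v x))\<^sup>2 + 2 * (u x \<bullet> v x) = (norm (u x + v x))\<^sup>2" for x
    by (simp add: power2_norm_eq_inner inner_add inner_commute algebra_simps)
  ultimately show ?thesis using m by (simp add: L2_def)
qed

lemma L2_diff:
  assumes u: "u \<in> L2 \<Omega>" and v: "v \<in> L2 \<Omega>"
  shows "(\<lambda>x. u x - v x) \<in> L2 \<Omega>"
  using L2_add[OF u L2_scaleR[OF v, of "-1"]] by simp

lemma L2_zero: "(\<lambda>x. 0) \<in> L2 \<Omega>"
  by (simp add: L2_def)

lemma L2_sum:
  assumes "\<And>i. i \<in> I \<Longrightarrow> v i \<in> L2 \<Omega>"
  shows "(\<lambda>x. \<Sum>i\<in>I. v i x) \<in> L2 \<Omega>"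
  using assms by (induction I rule: infinite_finite_induct) (auto intro: L2_add L2_zero)

lemma L2_norm_fun:
  assumes "v \<in> L2 \<Omega>"
  shows "(\<lambda>x. norm (v x)) \<in> L2 \<Omega>"
  using L2D[OF assms] by (simp add: L2_def)

lemma L2_inner_commute: "L2_inner \<Omega> u v = L2_inner \<Omega> v u"
  by (simp add: L2_inner_def inner_commute)

lemma L2_inner_add_left:
  assumes "u \<in> L2 \<Omega>" "v \<in> L2 \<Omega>" "w \<in> L2 \<Omega>"
  shows "L2_inner \<Omega> (\<lambda>x. u x + v x) w = L2_inner \<Omega> u w + L2_inner \<Omega> v w"
  using L2_integrable_inner[OF assms(1,3)] L2_integrable_inner[OF assms(2,3)]
  by (simp add: L2_inner_def inner_add_left)

lemma L2_inner_diff_left: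
  assumes "u \<in> L2 \<Omega>" "v \<in> L2 \<Omega>" "w \<in> L2 \<Omega>"
  shows "L2_inner \<Omega> (\<lambda>x. u x - v x) w = L2_inner \<Omega> u w - L2_inner \<Omega> v w"
  using L2_integrable_inner[OF assms(1,3)] L2_integrable_inner[OF assms(2,3)]
  by (simp add: L2_inner_def inner_diff_left)

lemma L2_inner_scaleR_left: "L2_inner \<Omega> (\<lambda>x. c *\<^sub>R u x) w = c * L2_inner \<Omega> u w"
  by (simp add: L2_inner_def)

lemma L2_inner_add_right:
  assumes "u \<in> L2 \<Omega>" "v \<in> L2 \<Omega>" "w \<in> L2 \<Omega>"
  shows "L2_inner \<Omega> w (\<lambda>x. u x + v x) = L2_inner \<Omega> w u + L2_inner \<Omega> w v"
  using L2_inner_add_left[OF assms] by (simp only: L2_inner_commute[of _ w])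

lemma L2_inner_diff_right:
  assumes "u \<in> L2 \<Omega>" "v \<in> L2 \<Omega>" "w \<in> L2 \<Omega>"
  shows "L2_inner \<Omega> w (\<lambda>x. u x - v x) = L2_inner \<Omega> w u - L2_inner \<Omega> w v"
  using L2_inner_diff_left[OF assms] by (simp only: L2_inner_commute[of _ w])

lemma L2_inner_scaleR_right: "L2_inner \<Omega> w (\<lambda>x. c *\<^sub>R u x) = c * L2_inner \<Omega> w u"
  using L2_inner_scaleR_left by (simp only: L2_inner_commute[of _ w])

lemma L2_inner_zero_left [simp]: "L2_inner \<Omega> (\<lambda>x. 0) w = 0"
  by (simp add: L2_inner_def)

lemma L2_inner_sum_left:
  assumes "\<And>i. i \<in> I \<Longrightarrow> v i \<in> L2 \<Omega>" "w \<in> L2 \<Omega>"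
  shows "L2_inner \<Omega> (\<lambda>x. \<Sum>i\<in>I. v i x) w = (\<Sum>i\<in>I. L2_inner \<Omega> (v i) w)"
  using assms
  by (induction I rule: infinite_finite_induct) (auto simp: L2_inner_add_left L2_sum)

lemma L2_inner_self: "L2_inner \<Omega> v v = (\<integral>x. (norm (v x))\<^sup>2 \<partial>lebesgue_on \<Omega>)"
  by (simp add: L2_inner_def power2_norm_eq_inner)

lemma L2_inner_self_nonneg: "0 \<le> L2_inner \<Omega> v v"
  by (simp add: L2_inner_self)

lemma L2_norm_nonneg: "0 \<le> L2_norm \<Omega> v"
  by (simp add: L2_norm_def L2_inner_self_nonneg)

lemma power2_L2_norm: "(L2_norm \<Omega> v)\<^sup>2 = L2_inner \<Omega> v v"
  by (simp add: L2_norm_def L2_inner_self_nonneg)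

lemma L2_mult_bounded:
  assumes \<theta>: "\<theta> \<in> borel_measurable (lebesgue_on \<Omega>)" "AE x in lebesgue_on \<Omega>. \<bar>\<theta> x\<bar> \<le> C"
    and v: "v \<in> L2 \<Omega>"
  shows "(\<lambda>x. \<theta> x *\<^sub>R v x) \<in> L2 \<Omega>"
    and "0 \<le> C \<Longrightarrow> L2_norm \<Omega> (\<lambda>x. \<theta> x *\<^sub>R v x) \<le> C * L2_norm \<Omega> v"
proof -
  have m: "(\<lambda>x. \<theta> x *\<^sub>R v x) \<in> borel_measurable (lebesgue_on \<Omega>)"
    using L2D(1)[OF v] \<theta>(1) by measurable
  have bi: "integrable (lebesgue_on \<Omega>) (\<lambda>x. C\<^sup>2 * (norm (v x))\<^sup>2)" using L2D(2)[OF v] by simp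
  have b: "AE x in lebesgue_on \<Omega>. (norm (\<theta> x *\<^sub>R v x))\<^sup>2 \<le> C\<^sup>2 * (norm (v x))\<^sup>2"
    using \<theta>(2)
  proof eventually_elim
    case (elim x)
    then have "\<bar>\<theta> x\<bar>\<^sup>2 \<le> C\<^sup>2" by (intro power_mono) auto
    then show ?case by (simp add: power_mult_distrib mult_right_mono)
  qed
  have i: "integrable (lebesgue_on \<Omega>) (\<lambda>x. (norm (\<theta> x *\<^sub>R v x))\<^sup>2)"
  proof (rule Bochner_Integration.integrable_bound[OF bi])
    show "(\<lambda>x. (norm (\<theta> x *\<^sub>R v x))\<^sup>2) \<in> borel_measurable (lebesgue_on \<Omega>)" using m by measurable
  qed (use b in simp)
  then show "(\<lambda>x. \<theta> x *\<^sub>R v x) \<in> L2 \<Omega>" using m by (simp add: L2_def)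
  assume C: "0 \<le> C"
  have "(L2_norm \<Omega> (\<lambda>x. \<theta> x *\<^sub>R v x))\<^sup>2 \<le> (\<integral>x. C\<^sup>2 * (norm (v x))\<^sup>2 \<partial>lebesgue_on \<Omega>)"
    unfolding power2_L2_norm L2_inner_self by (rule integral_mono_AE[OF i bi b])
  also have "\<dots> = (C * L2_norm \<Omega> v)\<^sup>2"
    by (simp add: power_mult_distrib power2_L2_norm L2_inner_self)
  finally show "L2_norm \<Omega> (\<lambda>x. \<theta> x *\<^sub>R v x) \<le> C * L2_norm \<Omega> v"
    by (rule power2_le_imp_le) (simp add: C L2_norm_nonneg)
qed

text \<open>Discriminant of a nonnegative quadratic, including the degenerate case
  \<open>c = 0\<close>. It serves the Cauchy-Schwarz inequality and, with \<open>a = 0\<close>, the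
  Euler-Lagrange equation of the modes.\<close>

lemma power2_le_mult_if_quadratic_nonneg:
  fixes a b c :: real
  assumes "\<And>t. 0 \<le> a + 2 * t * b + t\<^sup>2 * c" "0 \<le> c"
  shows "b\<^sup>2 \<le> a * c"
proof (cases "c = 0")
  case True
  have "b = 0"
  proof (rule ccontr)
    assume "b \<noteq> 0"
    \<comment> \<open>At this \<open>t\<close> the affine expression \<open>a + 2 * t * b\<close>
      equals -1.\<close>
    then show False using assms(1)[of "- (a + 1) / (2 * b)"] True by (simp add: field_simps)
  qed
  then show ?thesis using True by simp
next
  case False
  then have "0 \<le> (a + 2 * (- b / c) * b + (- b / c)\<^sup>2 * c) * c"
    using assms by (intro mult_nonneg_nonneg)
  also have "\<dots> = a * c - b\<^sup>2" using False by (simp add: field_simps power2_eq_square)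
  finally show ?thesis by simp
qed

lemma L2_inner_cauchy_schwarz:
  assumes u: "u \<in> L2 \<Omega>" and v: "v \<in> L2 \<Omega>"
  shows "\<bar>L2_inner \<Omega> u v\<bar> \<le> L2_norm \<Omega> u * L2_norm \<Omega> v"
proof -
  have "0 \<le> L2_inner \<Omega> u u + 2 * t * L2_inner \<Omega> u v + t\<^sup>2 * L2_inner \<Omega> v v" for t
  proof -
    have tv: "(\<lambda>x. t *\<^sub>R v x) \<in> L2 \<Omega>" using v by (rule L2_scaleR)
    have "0 \<le> L2_inner \<Omega> (\<lambda>x. u x + t *\<^sub>R v x) (\<lambda>x. u x + t *\<^sub>R v x)" by (rule L2_inner_self_nonneg)
    also have "\<dots> = L2_inner \<Omega> u u + 2 * t * L2_inner \<Omega> u v + t\<^sup>2 * L2_inner \<Omega> v v"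
      using u v tv L2_add[OF u tv]
      by (simp add: L2_inner_add_left L2_inner_add_right L2_inner_scaleR_left L2_inner_scaleR_right
        L2_inner_commute[of \<Omega> v u] power2_eq_square algebra_simps)
    finally show ?thesis .
  qed
  then have "(L2_inner \<Omega> u v)\<^sup>2 \<le> L2_inner \<Omega> u u * L2_inner \<Omega> v v"
    by (rule power2_le_mult_if_quadratic_nonneg) (rule L2_inner_self_nonneg)
  then have "\<bar>L2_inner \<Omega> u v\<bar>\<^sup>2 \<le> (L2_norm \<Omega> u * L2_norm \<Omega> v)\<^sup>2"
    by (simp add: power_mult_distrib power2_L2_norm)
  then show ?thesis by (rule power2_le_imp_le) (simp add: L2_norm_nonneg)
qed

lemma integral_norm_mult_le:
  assumes u: "u \<in> L2 \<Omega>" and v: "v \<in> L2 \<Omega>"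
  shows "(\<integral>x. norm (u x) * norm (v x) \<partial>lebesgue_on \<Omega>) \<le> L2_norm \<Omega> u * L2_norm \<Omega> v"
  using L2_inner_cauchy_schwarz[OF L2_norm_fun[OF u] L2_norm_fun[OF v]]
  by (simp add: L2_inner_def L2_norm_def power2_norm_eq_inner flip: power2_eq_square)

lemma L2_norm_scaleR: "L2_norm \<Omega> (\<lambda>x. c *\<^sub>R v x) = \<bar>c\<bar> * L2_norm \<Omega> v"
proof -
  have "L2_inner \<Omega> (\<lambda>x. c *\<^sub>R v x) (\<lambda>x. c *\<^sub>R v x) = c\<^sup>2 * L2_inner \<Omega> v v"
    by (simp add: L2_inner_def power2_eq_square)
  then show ?thesis by (simp add: L2_norm_def real_sqrt_mult)
qed

lemma L2_norm_triangle:
  assumes u: "u \<in> L2 \<Omega>" and v: "v \<in> L2 \<Omega>"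
  shows "L2_norm \<Omega> (\<lambda>x. u x + v x) \<le> L2_norm \<Omega> u + L2_norm \<Omega> v"
proof (rule power2_le_imp_le)
  have "(L2_norm \<Omega> (\<lambda>x. u x + v x))\<^sup>2 = L2_inner \<Omega> u u + 2 * L2_inner \<Omega> u v + L2_inner \<Omega> v v"
    unfolding power2_L2_norm using u v L2_add[OF u v]
    by (simp add: L2_inner_add_left L2_inner_add_right L2_inner_commute[of \<Omega> v u])
  also have "\<dots> \<le> (L2_norm \<Omega> u + L2_norm \<Omega> v)\<^sup>2"
    using L2_inner_cauchy_schwarz[OF u v] by (simp add: power2_sum power2_L2_norm)
  finally show "(L2_norm \<Omega> (\<lambda>x. u x + v x))\<^sup>2 \<le> (L2_norm \<Omega> u + L2_norm \<Omega> v)\<^sup>2" .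
qed (simp add: L2_norm_nonneg)

lemma L2_norm_minus_commute: "L2_norm \<Omega> (\<lambda>x. u x - v x) = L2_norm \<Omega> (\<lambda>x. v x - u x)"
  by (simp add: L2_norm_def L2_inner_self norm_minus_commute)

text \<open>Riesz-Fischer for functions instead of classes. Along a fast subsequence the increments
  are summable in \<open>L2\<close>, hence in L1 because the measure is finite, hence pointwise
  almost everywhere; Fatou's lemma upgrades pointwise convergence to convergence in norm.\<close>

lemma L2_complete:
  fixes u :: "nat \<Rightarrow> real^3 \<Rightarrow> 'b::euclidean_space"
  assumes fin: "finite_measure (lebesgue_on \<Omega>)" and u: "\<And>n. u n \<in> L2 \<Omega>"
    and Cauchy: "\<And>e. e > 0 \<Longrightarrow> \<exists>N. \<forall>m\<ge>N. \<forall>n\<ge>N. L2_norm \<Omega> (\<lambda>x. u m x - u n x) \<le> e"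
  obtains w where "w \<in> L2 \<Omega>" "(\<lambda>n. L2_norm \<Omega> (\<lambda>x. u n x - w x)) \<longlonglongrightarrow> 0"
proof -
  define M where "M = lebesgue_on \<Omega>"
  interpret finite_measure M using fin by (simp add: M_def)
  \<comment> \<open>The subsequence is chosen so that from index \<open>s k\<close> on all terms are
    within \<open>2^-k\<close> of \<open>u (s k)\<close>, which bounds the increments by a geometric
    series.\<close>
  have "\<exists>s. \<forall>k. (\<forall>n\<ge>s k. L2_norm \<Omega> (\<lambda>x. u n x - u (s k) x) \<le> (1/2)^k) \<and> s k < s (Suc k)"
  proof (rule dependent_nat_choice)
    show "\<exists>x. \<forall>n\<ge>x. L2_norm \<Omega> (\<lambda>xa. u n xa - u x xa) \<le> (1 / 2) ^ 0"
      using Cauchy[of 1] by auto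
    fix x k
    obtain N where N: "\<forall>m\<ge>N. \<forall>n\<ge>N. L2_norm \<Omega> (\<lambda>x. u m x - u n x) \<le> (1/2)^Suc k"
      using Cauchy[of "(1/2)^Suc k"] by auto
    then show "\<exists>y. (\<forall>n\<ge>y. L2_norm \<Omega> (\<lambda>x. u n x - u y x) \<le> (1 / 2) ^ Suc k) \<and> x < y"
      by (intro exI[of _ "max N (Suc x)"]) auto
  qed
  then obtain s where s: "\<And>k n. n \<ge> s k \<Longrightarrow> L2_norm \<Omega> (\<lambda>x. u n x - u (s k) x) \<le> (1/2)^k"
    and smono: "strict_mono s" by (auto simp: strict_mono_Suc_iff)
  have m: "u n \<in> borel_measurable M" for n using L2D(1)[OF u] by (simp add: M_def)
  define d where "d k x = norm (u (s (Suc k)) x - u (s k) x)" for k x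
  have dL: "(\<lambda>x. u (s (Suc k)) x - u (s k) x) \<in> L2 \<Omega>" for k by (intro L2_diff u)
  \<comment> \<open>Cauchy-Schwarz against the constant 1 bounds L1 norms by \<open>B\<close> times
    \<open>L2\<close> norms.\<close>
  have one: "(\<lambda>x. 1::real) \<in> L2 \<Omega>" using integrable_const by (simp add: L2_def M_def)
  define B where "B = L2_norm \<Omega> (\<lambda>x. 1::real)"
  have di: "integrable M (d k)" for k
    using L2_integrable_norm_mult[OF dL one] by (simp add: d_def[abs_def] M_def)
  have "(\<integral>x. d k x \<partial>M) \<le> (1/2)^k * B" for k
  proof -
    have "(\<integral>x. d k x \<partial>M) \<le> L2_norm \<Omega> (\<lambda>x. u (s (Suc k)) x - u (s k) x) * B"
      using integral_norm_mult_le[OF dL one] by (simp add: d_def M_def B_def)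
    also have "\<dots> \<le> (1/2)^k * B"
      by (intro mult_right_mono s) (auto simp: B_def L2_norm_nonneg strict_mono_less_eq[OF smono])
    finally show ?thesis .
  qed
  then have dB: "(\<integral>\<^sup>+x. ennreal (d k x) \<partial>M) \<le> ennreal ((1/2)^k * B)" for k
  proof -
    have "(\<integral>\<^sup>+x. ennreal (d k x) \<partial>M) = ennreal (\<integral>x. d k x \<partial>M)"
      by (rule nn_integral_eq_integral[OF di]) (simp add: d_def)
    also have "\<dots> \<le> ennreal ((1/2)^k * B)" by (intro ennreal_leI) fact
    finally show ?thesis .
  qed
  have "(\<integral>\<^sup>+x. (\<Sum>k. ennreal (d k x)) \<partial>M) = (\<Sum>k. \<integral>\<^sup>+x. ennreal (d k x) \<partial>M)"
    using di by (intro nn_integral_suminf) auto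
  also have "\<dots> \<le> (\<Sum>k. ennreal ((1/2)^k * B))" by (intro suminf_le dB) auto
  also have "\<dots> < \<infinity>"
  proof -
    have "summable (\<lambda>k. (1/2)^k * B)" by (intro summable_mult2 summable_geometric) simp
    then show ?thesis
      by (subst suminf_ennreal_eq[OF _ summable_sums]) (auto simp: B_def L2_norm_nonneg)
  qed
  finally have "AE x in M. (\<Sum>k. ennreal (d k x)) \<noteq> \<infinity>"
    using di by (intro nn_integral_noteq_infinite) auto
  then have conv: "AE x in M. convergent (\<lambda>k. u (s k) x)"
  proof eventually_elim
    case (elim x)
    then have "summable (\<lambda>k. d k x)" by (intro summable_suminf_not_top) (auto simp: d_def)
    then have "summable (\<lambda>k. u (s (Suc k)) x - u (s k) x)"
      unfolding d_def by (rule summable_norm_cancel)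
    then have "convergent (\<lambda>n. \<Sum>k<n. u (s (Suc k)) x - u (s k) x)" by (simp add: summable_iff_convergent)
    then have "convergent (\<lambda>n. u (s n) x - u (s 0) x)" using sum_lessThan_telescope[of "\<lambda>k. u (s k) x"] by simp
    then have "convergent (\<lambda>n. (u (s n) x - u (s 0) x) + u (s 0) x)"
      by (intro convergent_add convergent_const)
    then show ?case by simp
  qed
  \<comment> \<open>Where the subsequence diverges, the value of \<open>lim\<close> is arbitrary;
    this happens on a null set only.\<close>
  define w where "w x = lim (\<lambda>k. u (s k) x)" for x
  have wm: "w \<in> borel_measurable M"
    unfolding w_def by (rule borel_measurable_lim_metric) (rule m)
  have lim: "AE x in M. (\<lambda>k. u (s k) x) \<longlonglongrightarrow> w x"
    using conv by eventually_elim (simp add: w_def convergent_LIMSEQ_iff)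
  \<comment> \<open>The bound is kept in extended reals because square integrability of
    \<open>u n - w\<close> is not known yet and is deduced from it.\<close>
  have key: "(\<integral>\<^sup>+x. ennreal ((norm (u n x - w x))\<^sup>2) \<partial>M) \<le> ennreal (e\<^sup>2)"
    if N: "\<forall>m\<ge>N. \<forall>n\<ge>N. L2_norm \<Omega> (\<lambda>x. u m x - u n x) \<le> e" and n: "n \<ge> N" for n N e
  proof -
    have "(\<integral>\<^sup>+x. ennreal ((norm (u n x - w x))\<^sup>2) \<partial>M)
        = (\<integral>\<^sup>+x. liminf (\<lambda>k. ennreal ((norm (u n x - u (s k) x))\<^sup>2)) \<partial>M)"
    proof (rule nn_integral_cong_AE)
      show "AE x in M. ennreal ((norm (u n x - w x))\<^sup>2) = liminf (\<lambda>k. ennreal ((norm (u n x - u (s k) x))\<^sup>2))"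
        using lim
      proof eventually_elim
        case (elim x)
        have L: "(\<lambda>k. ennreal ((norm (u n x - u (s k) x))\<^sup>2)) \<longlonglongrightarrow> ennreal ((norm (u n x - w x))\<^sup>2)"
          by (intro tendsto_intros elim tendsto_ennrealI)
        show ?case by (rule lim_imp_Liminf[OF sequentially_bot L, symmetric])
      qed
    qed
    also have "\<dots> \<le> liminf (\<lambda>k. \<integral>\<^sup>+x. ennreal ((norm (u n x - u (s k) x))\<^sup>2) \<partial>M)"
      using m by (intro nn_integral_liminf) auto
    also have "\<dots> \<le> ennreal (e\<^sup>2)"
    proof (rule Liminf_le)
      show "\<forall>\<^sub>F k in sequentially. (\<integral>\<^sup>+x. ennreal ((norm (u n x - u (s k) x))\<^sup>2) \<partial>M) \<le> ennreal (e\<^sup>2)"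
        using eventually_ge_at_top[of N]
      proof eventually_elim
        case (elim k)
        have "s k \<ge> N" using elim strict_mono_imp_increasing[OF smono, of k] by linarith
        then have "L2_norm \<Omega> (\<lambda>x. u n x - u (s k) x) \<le> e" using N n by blast
        then have "(L2_norm \<Omega> (\<lambda>x. u n x - u (s k) x))\<^sup>2 \<le> e\<^sup>2" by (intro power_mono L2_norm_nonneg)
        moreover have "(\<integral>\<^sup>+x. ennreal ((norm (u n x - u (s k) x))\<^sup>2) \<partial>M) = ennreal ((L2_norm \<Omega> (\<lambda>x. u n x - u (s k) x))\<^sup>2)"
          unfolding power2_L2_norm L2_inner_self M_def using L2D(2)[OF L2_diff[OF u u, of n "s k"]]
          by (intro nn_integral_eq_integral) auto
        ultimately show ?case by (simp add: ennreal_leI)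
      qed
    qed simp
    finally show ?thesis .
  qed
  have keyL: "(\<lambda>x. u n x - w x) \<in> L2 \<Omega> \<and> L2_norm \<Omega> (\<lambda>x. u n x - w x) \<le> e"
    if N: "\<forall>m\<ge>N. \<forall>n\<ge>N. L2_norm \<Omega> (\<lambda>x. u m x - u n x) \<le> e" and n: "n \<ge> N" and e: "e > 0" for n N e
  proof -
    have mm: "(\<lambda>x. u n x - w x) \<in> borel_measurable M" using m wm by simp
    have i: "integrable M (\<lambda>x. (norm (u n x - w x))\<^sup>2)"
    proof (rule integrableI_bounded)
      show "(\<integral>\<^sup>+x. ennreal (norm ((norm (u n x - w x))\<^sup>2)) \<partial>M) < \<infinity>"
        using key[OF N n] by (simp add: le_less_trans)
    qed (use mm in measurable)
    then have L: "(\<lambda>x. u n x - w x) \<in> L2 \<Omega>" using mm by (simp add: L2_def M_def)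
    have "ennreal ((L2_norm \<Omega> (\<lambda>x. u n x - w x))\<^sup>2) \<le> ennreal (e\<^sup>2)"
      unfolding power2_L2_norm L2_inner_self using key[OF N n] i
      by (subst (asm) nn_integral_eq_integral) (auto simp: M_def)
    then have "(L2_norm \<Omega> (\<lambda>x. u n x - w x))\<^sup>2 \<le> e\<^sup>2" by simp
    then show ?thesis using L e by (auto intro: power2_le_imp_le)
  qed
  obtain N where "\<forall>m\<ge>N. \<forall>n\<ge>N. L2_norm \<Omega> (\<lambda>x. u m x - u n x) \<le> 1" using Cauchy[of 1] by auto
  then have "(\<lambda>x. u N x - w x) \<in> L2 \<Omega>" using keyL[of N 1 N] by simp
  then have "w \<in> L2 \<Omega>" using L2_diff[OF u[of N]] by fastforce
  moreover have "(\<lambda>n. L2_norm \<Omega> (\<lambda>x. u n x - w x)) \<longlonglongrightarrow> 0"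
  proof (rule LIMSEQ_I)
    fix r :: real assume r: "r > 0"
    then obtain N where N: "\<forall>m\<ge>N. \<forall>n\<ge>N. L2_norm \<Omega> (\<lambda>x. u m x - u n x) \<le> r/2" using Cauchy[of "r/2"] by auto
    have "norm (L2_norm \<Omega> (\<lambda>x. u n x - w x) - 0) < r" if "n \<ge> N" for n
      using keyL[OF N that] r L2_norm_nonneg[of \<Omega> "\<lambda>x. u n x - w x"] by auto
    then show "\<exists>no. \<forall>n\<ge>no. norm (L2_norm \<Omega> (\<lambda>x. u n x - w x) - 0) < r" by blast
  qed
  ultimately show ?thesis using that by blast
qed

section \<open>Ball representation of the Coulomb kernel\<close>

lemma borel_measurable_ident_lebesgue_on: "(\<lambda>x. x) \<in> borel_measurable (lebesgue_on S)"
  using id_borel_measurable_lebesgue_on by (simp add: id_def)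

lemma emeasure_lebesgue_on_cball_le:
  fixes x :: "real^3"
  assumes "\<Omega> \<in> sets lebesgue" "0 \<le> r"
  shows "emeasure (lebesgue_on \<Omega>) {y \<in> \<Omega>. norm (x - y) \<le> r} \<le> ennreal (unit_ball_vol 3 * r ^ 3)"
proof -
  have "{y \<in> \<Omega>. norm (x - y) \<le> r} = \<Omega> \<inter> cball x r" by (auto simp: dist_norm)
  then have "emeasure (lebesgue_on \<Omega>) {y \<in> \<Omega>. norm (x - y) \<le> r} = emeasure lebesgue (\<Omega> \<inter> cball x r)"
    using assms(1) by (subst emeasure_restrict_space) auto
  also have "\<dots> \<le> emeasure lebesgue (cball x r)" by (intro emeasure_mono) auto
  also have "\<dots> = ennreal (unit_ball_vol 3 * r ^ 3)"
    using emeasure_cball[OF assms(2), of x] by simp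
  finally show ?thesis .
qed

section \<open>Square integrability of the Coulomb kernel\<close>

lemma inverse_square_eq_nn_integral:
  fixes s :: real
  assumes "0 < s"
  shows "(\<integral>\<^sup>+r. ennreal (2 / r ^ 3) * indicator {s..} r \<partial>lborel) = ennreal (1 / s\<^sup>2)"
proof -
  have "(\<integral>\<^sup>+r. ennreal (2 / r ^ 3) * indicator {s..} r \<partial>lborel) = ennreal (0 - (- 1 / s\<^sup>2))"
  proof (rule nn_integral_FTC_atLeast)
    show "((\<lambda>r. - 1 / r\<^sup>2) has_real_derivative 2 / r ^ 3) (at r)" if "s \<le> r" for r
      using that assms by (auto intro!: derivative_eq_intros simp: field_simps power2_eq_square power3_eq_cube)
    show "((\<lambda>r. - 1 / r\<^sup>2) \<longlongrightarrow> (0::real)) at_top"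
      by (rule tendsto_divide_0[OF tendsto_const filterlim_at_top_imp_at_infinity[OF filterlim_pow_at_top[OF _ filterlim_ident]]]) simp
  qed (use assms in auto)
  then show ?thesis by simp
qed

text \<open>Layer-cake: writing s^-2 as the integral of 2 r^-3 over r \<ge> s and exchanging
  integrals leaves 2 r^-3 times the volume of the part of \<Omega> within distance r of
  \<open>x\<close>. That volume is at most the ball volume, good for small r, and at most the volume
  of \<Omega>, good for large r. Neither bound depends on \<open>x\<close>.\<close>

lemma inverse_square_kernel_bound:
  fixes \<Omega> :: "(real^3) set"
  assumes \<Omega>: "\<Omega> \<in> lmeasurable"
  obtains C where "0 \<le> C" "\<And>x. (\<integral>\<^sup>+y. ennreal ((1 / norm (x - y))\<^sup>2) \<partial>lebesgue_on \<Omega>) \<le> ennreal C"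
proof -
  define M where "M = lebesgue_on \<Omega>"
  interpret M: finite_measure M unfolding M_def by (rule finite_measure_lebesgue_on[OF \<Omega>])
  interpret P: pair_sigma_finite lborel M ..
  have \<Omega>s: "\<Omega> \<in> sets lebesgue" using \<Omega> by (rule fmeasurableD)
  define V where "V = unit_ball_vol 3"
  \<comment> \<open>Radii up to 1 contribute 2 V, since the factors r^3 cancel; larger radii
    contribute the volume of \<Omega> times the integral of 2 r^-3 from 1, which is 1.\<close>
  define C where "C = 2 * V + measure M \<Omega>"
  have V: "0 \<le> V" by (simp add: V_def)
  have idm [measurable]: "(\<lambda>x. x) \<in> borel_measurable M"
    unfolding M_def by (rule borel_measurable_ident_lebesgue_on)
  have "(\<integral>\<^sup>+y. ennreal ((1 / norm (x - y))\<^sup>2) \<partial>M) \<le> ennreal C" for x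
  proof -
    define f where "f = (\<lambda>(r::real, y). ennreal (2 / r ^ 3) * (if norm (x - y) \<le> r then 1 else 0))"
    have snd': "(\<lambda>p. snd p) \<in> borel_measurable (lborel \<Otimes>\<^sub>M M)"
      using measurable_compose[OF measurable_snd idm] by simp
    have fm: "f \<in> borel_measurable (lborel \<Otimes>\<^sub>M M)"
      unfolding f_def case_prod_beta using snd' by measurable
    have "(\<integral>\<^sup>+y. ennreal ((1 / norm (x - y))\<^sup>2) \<partial>M) \<le> (\<integral>\<^sup>+y. (\<integral>\<^sup>+r. f (r, y) \<partial>lborel) \<partial>M)"
    proof (rule nn_integral_mono)
      fix y
      show "ennreal ((1 / norm (x - y))\<^sup>2) \<le> (\<integral>\<^sup>+r. f (r, y) \<partial>lborel)"
      \<comment> \<open>On the diagonal \<open>1 / 0 = 0\<close> makes the left side zero.\<close>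
      proof (cases "x = y")
        case False
        then have s: "0 < norm (x - y)" by simp
        have "ennreal ((1 / norm (x - y))\<^sup>2) = (\<integral>\<^sup>+r. ennreal (2 / r ^ 3) * indicator {norm (x - y)..} r \<partial>lborel)"
          using inverse_square_eq_nn_integral[OF s] by (simp add: power_divide)
        also have "\<dots> \<le> (\<integral>\<^sup>+r. f (r, y) \<partial>lborel)"
          by (intro nn_integral_mono) (auto simp: f_def indicator_def)
        finally show ?thesis .
      qed simp
    qed
    also have "\<dots> = (\<integral>\<^sup>+r. (\<integral>\<^sup>+y. f (r, y) \<partial>M) \<partial>lborel)"
      by (rule P.Fubini[OF fm])
    also have "\<dots> \<le> (\<integral>\<^sup>+r. ennreal (2 * V) * indicator {0..1} r + ennreal (measure M \<Omega>) * (ennreal (2 / r ^ 3) * indicator {1..} r) \<partial>lborel)"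
    proof (rule nn_integral_mono)
      fix r :: real
      consider "r \<le> 0" | "0 < r" "r \<le> 1" | "1 < r" by linarith
      then show "(\<integral>\<^sup>+y. f (r, y) \<partial>M) \<le> ennreal (2 * V) * indicator {0..1} r + ennreal (measure M \<Omega>) * (ennreal (2 / r ^ 3) * indicator {1..} r)"
      proof cases
        \<comment> \<open>A negative radius admits no \<open>y\<close>, and at radius zero the
          weight is \<open>2 / 0 = 0\<close>.\<close>
        case 1
        then have "f (r, y) = 0" for y
          using norm_ge_zero[of "x - y"] by (cases "r = 0") (auto simp: f_def simp del: norm_ge_zero)
        then show ?thesis by simp
      next
        case 2
        have S: "{y \<in> \<Omega>. norm (x - y) \<le> r} \<in> sets M"
        proof -
          have "{y \<in> space M. norm (x - y) \<le> r} \<in> sets M" by measurable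
          then show ?thesis by (simp add: M_def)
        qed
        have "(\<integral>\<^sup>+y. f (r, y) \<partial>M) = (\<integral>\<^sup>+y. ennreal (2 / r ^ 3) * indicator {y \<in> \<Omega>. norm (x - y) \<le> r} y \<partial>M)"
          using 2 by (intro nn_integral_cong) (auto simp: f_def M_def indicator_def)
        also have "\<dots> = ennreal (2 / r ^ 3) * emeasure M {y \<in> \<Omega>. norm (x - y) \<le> r}"
          using S by (simp add: nn_integral_cmult_indicator)
        also have "\<dots> \<le> ennreal (2 / r ^ 3) * ennreal (V * r ^ 3)"
          using emeasure_lebesgue_on_cball_le[OF \<Omega>s, of r x] 2 by (intro mult_left_mono) (auto simp: M_def V_def)
        also have "\<dots> = ennreal (2 * V)"
          using 2 V by (simp flip: ennreal_mult)
        finally show ?thesis using 2 by (simp add: add_increasing2)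
      next
        case 3
        have "(\<integral>\<^sup>+y. f (r, y) \<partial>M) \<le> (\<integral>\<^sup>+y. ennreal (2 / r ^ 3) \<partial>M)"
          by (intro nn_integral_mono) (auto simp: f_def)
        also have "\<dots> = ennreal (measure M \<Omega>) * ennreal (2 / r ^ 3)"
          by (simp add: M.emeasure_eq_measure mult.commute) (simp add: M_def)
        finally show ?thesis using 3 by (simp add: add_increasing)
      qed
    qed
    also have "\<dots> = ennreal (2 * V) + ennreal (measure M \<Omega>) * ennreal 1"
      using inverse_square_eq_nn_integral[of 1]
      by (subst nn_integral_add) (auto simp: nn_integral_cmult)
    also have "\<dots> = ennreal C" using V by (simp add: C_def ennreal_plus)
    finally show ?thesis .
  qed
  then show ?thesis using that[of C] V by (simp add: M_def C_def)
qed

section \<open>Lens volumes and the representation by balls\<close>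

lemma emeasure_similarity_image:
  fixes T :: "real^3 \<Rightarrow> real^3"
  assumes T: "orthogonal_transformation T" and S: "S \<in> lmeasurable" and s: "0 \<le> s"
  shows "emeasure lebesgue ((\<lambda>z. s *\<^sub>R T z + x) ` S) = ennreal (s ^ 3) * emeasure lebesgue S"
proof -
  have TS: "T ` S \<in> lmeasurable" "measure lebesgue (T ` S) = measure lebesgue S"
    using measurable_orthogonal_image[OF T S] measure_orthogonal_image[OF T S] by auto
  have "(\<lambda>z. s *\<^sub>R T z + x) ` S = (\<lambda>z. s *\<^sub>R z + x) ` (T ` S)" by (simp add: image_image)
  then show ?thesis
    using emeasure_lebesgue_affine[of s x "T ` S"] s TS S
    by (simp add: emeasure_eq_measure2 ennreal_power)
qed

text \<open>The normalised configuration: centres at distance one. Every other pair of equal balls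
  is similar to it.\<close>

definition lens_volume :: "real \<Rightarrow> ennreal" where
  "lens_volume r = emeasure lborel (cball 0 r \<inter> cball (axis 1 1 :: real^3) r)"

text \<open>A similarity of ratio \<bar>x - y\<bar> carries the normalised lens to the given one: a
  rotation turns the reference axis into the direction of \<open>y - x\<close>, and a dilation with
  a translation does the rest. Volumes pick up the cube of the ratio.\<close>

lemma emeasure_cball_Int_cball:
  fixes x y :: "real^3"
  assumes "x \<noteq> y" "0 < r"
  shows "emeasure lborel (cball x r \<inter> cball y r)
    = ennreal (norm (x - y) ^ 3) * lens_volume (r / norm (x - y))"
proof -
  define s where "s = norm (x - y)"
  have s: "0 < s" using assms by (simp add: s_def)
  define e where "e = (axis 1 1 :: real^3)"
  have "norm e = norm ((y - x) /\<^sub>R s)" using s by (simp add: e_def s_def norm_minus_commute)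
  then obtain T where T: "orthogonal_transformation T" "T e = (y - x) /\<^sub>R s"
    by (rule orthogonal_transformation_exists)
  define S where "S z = s *\<^sub>R T z + x" for z
  have T0: "T 0 = 0" using T(1) by (simp add: linear_0 orthogonal_transformation_linear)
  have dS: "dist (S a) (S b) = s * dist a b" for a b
    using s T(1) by (simp add: S_def dist_norm flip: scaleR_diff_right linear_diff[OF orthogonal_transformation_linear[OF T(1)]])
      (simp add: orthogonal_transformation_norm)
  have S0: "S 0 = x" "S e = y" using s T0 T(2) by (auto simp: S_def)
  have sj: "\<exists>a. S a = z" for z
  proof -
    obtain a where "T a = (z - x) /\<^sub>R s" using orthogonal_transformation_surj[OF T(1)] by (metis surjD)
    then show ?thesis using s by (intro exI[of _ a]) (simp add: S_def)
  qed
  have "cball x r \<inter> cball y r = S ` (cball 0 (r / s) \<inter> cball e (r / s))"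
  proof (intro subset_antisym subsetI)
    fix z assume z: "z \<in> cball x r \<inter> cball y r"
    obtain a where a: "S a = z" using sj by blast
    have "s * dist 0 a \<le> r" "s * dist e a \<le> r" using z dS[of 0 a] dS[of e a] S0 a by auto
    then have "a \<in> cball 0 (r / s) \<inter> cball e (r / s)" using s by (simp add: field_simps)
    then show "z \<in> S ` (cball 0 (r / s) \<inter> cball e (r / s))" using a by blast
  next
    fix z assume "z \<in> S ` (cball 0 (r / s) \<inter> cball e (r / s))"
    then obtain a where a: "S a = z" "dist 0 a \<le> r / s" "dist e a \<le> r / s" by auto
    then have "s * dist 0 a \<le> r" "s * dist e a \<le> r" using s by (simp_all add: field_simps)
    then show "z \<in> cball x r \<inter> cball y r" using dS[of 0 a] dS[of e a] S0 a(1) by auto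
  qed
  note image = this
  have "emeasure lborel (cball x r \<inter> cball y r) = emeasure lebesgue (cball x r \<inter> cball y r)" by simp
  also have "\<dots> = emeasure lebesgue (S ` (cball 0 (r / s) \<inter> cball e (r / s)))" by (simp only: image)
  also have "\<dots> = ennreal (s ^ 3) * emeasure lebesgue (cball 0 (r / s) \<inter> cball e (r / s))"
    unfolding S_def using s by (intro emeasure_similarity_image[OF T(1)] fmeasurable.Int) auto
  also have "emeasure lebesgue (cball 0 (r / s) \<inter> cball e (r / s)) = lens_volume (r / s)"
    by (simp add: lens_volume_def e_def)
  finally show ?thesis by (simp add: s_def)
qed

text \<open>The proportionality factor between the superposition of balls and the Coulomb kernel,
  read off at distance one. Its exact value is left open; it has to be positive and finite.\<close>

definition lens_const :: ennreal where
  "lens_const = (\<integral>\<^sup>+r. ennreal (1 / r ^ 5) * indicator {0<..} r * lens_volume r \<partial>lborel)"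

lemma lens_volume_measurable [measurable]: "lens_volume \<in> borel_measurable borel"
proof -
  have "(\<lambda>r. \<integral>\<^sup>+z. indicator (cball 0 r \<inter> cball (axis 1 1 :: real^3) r) z \<partial>lborel) \<in> borel_measurable borel"
  proof (rule lborel.borel_measurable_nn_integral)
    have "(\<lambda>(r, z). indicator (cball 0 r \<inter> cball (axis 1 1 :: real^3) r) z :: ennreal)
      = (\<lambda>p. if norm (snd p) \<le> fst p \<and> norm (axis 1 1 - snd p) \<le> fst p then 1 else 0)"
      by (auto simp: fun_eq_iff indicator_def dist_norm)
    also have "\<dots> \<in> borel_measurable (borel \<Otimes>\<^sub>M lborel)" by measurable
    finally show "(\<lambda>(r, z). indicator (cball 0 r \<inter> cball (axis 1 1 :: real^3) r) z :: ennreal)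
      \<in> borel_measurable (borel \<Otimes>\<^sub>M lborel)" .
  qed
  also have "(\<lambda>r. \<integral>\<^sup>+z. indicator (cball 0 r \<inter> cball (axis 1 1 :: real^3) r) z \<partial>lborel) = lens_volume"
    by (auto simp: fun_eq_iff lens_volume_def)
  finally show ?thesis .
qed

text \<open>Balls of radius below 1/2 with centres at distance one are disjoint, so the singularity
  at zero is cut off; from 1/2 on the lens is at most a full ball, which leaves the integrable tail
  r^-2.\<close>

lemma lens_const_finite: "lens_const < \<infinity>"
proof -
  define V where "V = unit_ball_vol 3"
  have V: "0 \<le> V" by (simp add: V_def)
  have 1: "ennreal (1 / r ^ 5) * indicator {0<..} r * lens_volume r \<le> ennreal V * (ennreal (1 / r\<^sup>2) * indicator {1/2..} r)" for r
  proof (cases "r < 1/2")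
    case True
    have "cball 0 r \<inter> cball (axis 1 1 :: real^3) r = {}"
    proof (rule ccontr)
      assume "cball 0 r \<inter> cball (axis 1 1 :: real^3) r \<noteq> {}"
      then obtain z :: "real^3" where "dist 0 z \<le> r" "dist (axis 1 1) z \<le> r" by auto
      then have "dist 0 (axis 1 1 :: real^3) \<le> 2 * r" using dist_triangle2[of 0 "axis 1 1 :: real^3" z] by simp
      then show False using True by simp
    qed
    then show ?thesis by (simp add: lens_volume_def)
  next
    case False
    then have r: "0 < r" by simp
    have "lens_volume r \<le> emeasure lborel (cball (0::real^3) r)"
      unfolding lens_volume_def by (intro emeasure_mono) auto
    also have "\<dots> = ennreal (V * r ^ 3)" using r emeasure_cball[of r "0::real^3"] by (simp add: V_def)
    finally have "ennreal (1 / r ^ 5) * lens_volume r \<le> ennreal (1 / r ^ 5) * ennreal (V * r ^ 3)"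
      by (intro mult_left_mono) auto
    also have "\<dots> = ennreal (V * (1 / r\<^sup>2))"
      using r V by (simp flip: ennreal_mult) (simp add: field_simps eval_nat_numeral)
    also have "\<dots> = ennreal V * ennreal (1 / r\<^sup>2)" using V by (intro ennreal_mult) auto
    finally show ?thesis using False r by simp
  qed
  have "(\<integral>\<^sup>+r. ennreal (1 / r\<^sup>2) * indicator {1/2..} r \<partial>lborel) = ennreal (0 - (- 1 / (1/2)))"
  proof (rule nn_integral_FTC_atLeast)
    show "((\<lambda>r. - 1 / r) has_real_derivative 1 / r\<^sup>2) (at r)" if "1/2 \<le> r" for r :: real
      using that by (auto intro!: derivative_eq_intros simp: field_simps power2_eq_square)
    show "((\<lambda>r. - 1 / r) \<longlongrightarrow> (0::real)) at_top"
      by (rule tendsto_divide_0[OF tendsto_const filterlim_at_top_imp_at_infinity[OF filterlim_ident]])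
  qed auto
  then have "(\<integral>\<^sup>+r. ennreal V * (ennreal (1 / r\<^sup>2) * indicator {1/2..} r) \<partial>lborel) < \<infinity>"
    by (simp add: nn_integral_cmult ennreal_mult_less_top)
  moreover have "lens_const \<le> (\<integral>\<^sup>+r. ennreal V * (ennreal (1 / r\<^sup>2) * indicator {1/2..} r) \<partial>lborel)"
    unfolding lens_const_def by (intro nn_integral_mono 1)
  ultimately show ?thesis by (rule le_less_trans[rotated])
qed

text \<open>For radii between 1 and 2 the lens contains the ball of radius 1/2 around the midpoint
  of the centres, and the weight is at least 2^-5 = 1/32.\<close>

lemma lens_const_pos: "0 < lens_const"
proof -
  define D where "D = emeasure lborel (ball (axis 1 (1/2) :: real^3) (1/2))"
  have D: "D = ennreal (unit_ball_vol 3 * (1/2) ^ 3)"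
    using emeasure_ball[of "1/2" "axis 1 (1/2) :: real^3"] by (simp add: D_def)
  have "0 < ennreal (1 / 32) * D * emeasure lborel {1..2::real}"
    unfolding D by (simp flip: ennreal_mult add: ennreal_zero_less_mult_iff)
  also have "\<dots> = (\<integral>\<^sup>+r. ennreal (1 / 32) * D * indicator {1..2::real} r \<partial>lborel)"
    by (simp add: nn_integral_cmult_indicator)
  also have "\<dots> \<le> lens_const"
    unfolding lens_const_def
  proof (rule nn_integral_mono)
    fix r :: real
    show "ennreal (1 / 32) * D * indicator {1..2} r \<le> ennreal (1 / r ^ 5) * indicator {0<..} r * lens_volume r"
    proof (cases "r \<in> {1..2}")
      case True
      have "ball (axis 1 (1/2) :: real^3) (1/2) \<subseteq> cball 0 r \<inter> cball (axis 1 1) r"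
      proof
        fix z :: "real^3" assume z: "z \<in> ball (axis 1 (1/2)) (1/2)"
        have a: "axis 1 (1/2) = (1/2) *\<^sub>R (axis 1 1 :: real^3)"
            "axis 1 1 - axis 1 (1/2) = (1/2) *\<^sub>R (axis 1 1 :: real^3)"
          by (simp_all add: axis_def vec_eq_iff)
        have "dist (axis 1 1) (axis 1 (1/2) :: real^3) = 1/2"
          unfolding dist_norm a(2) by simp
        moreover have "dist 0 (axis 1 (1/2) :: real^3) = 1/2"
          unfolding dist_norm a(1) by simp
        ultimately show "z \<in> cball 0 r \<inter> cball (axis 1 1) r"
          using z True dist_triangle[of 0 z "axis 1 (1/2)"] dist_triangle[of "axis 1 1" z "axis 1 (1/2)"] by auto
      qed
      then have "D \<le> lens_volume r" unfolding D_def lens_volume_def by (intro emeasure_mono) auto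
      moreover have "ennreal (1 / 32) \<le> ennreal (1 / r ^ 5)"
        using True power_mono[of r 2 5] by (intro ennreal_leI) (simp add: field_simps)
      ultimately show ?thesis using True by (simp add: mult_mono)
    qed simp
  qed
  finally show ?thesis .
qed

text \<open>The Fefferman--de la Llave representation of the Coulomb kernel as a superposition of
  products of indicator functions of balls.\<close>

lemma nn_integral_cball_pairs:
  fixes x y :: "real^3"
  assumes "x \<noteq> y"
  shows "(\<integral>\<^sup>+r. ennreal (1 / r ^ 5) * indicator {0<..} r * emeasure lborel (cball x r \<inter> cball y r) \<partial>lborel)
    = lens_const * ennreal (1 / norm (x - y))"
proof -
  define s where "s = norm (x - y)"
  have s: "0 < s" using assms by (simp add: s_def)
  have "(\<integral>\<^sup>+r. ennreal (1 / r ^ 5) * indicator {0<..} r * emeasure lborel (cball x r \<inter> cball y r) \<partial>lborel)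
      = (\<integral>\<^sup>+r. ennreal (1 / r ^ 5) * indicator {0<..} r * (ennreal (s ^ 3) * lens_volume (r / s)) \<partial>lborel)"
    using emeasure_cball_Int_cball[OF assms] by (intro nn_integral_cong) (simp add: s_def indicator_def)
  \<comment> \<open>Substituting \<open>s * r\<close> for \<open>r\<close> separates the distance:
    Jacobian s, weight s^-5 and lens s^3 combine to 1/s.\<close>
  also have "\<dots> = ennreal \<bar>s\<bar> * (\<integral>\<^sup>+r. ennreal (1 / (0 + s * r) ^ 5) * indicator {0<..} (0 + s * r) * (ennreal (s ^ 3) * lens_volume ((0 + s * r) / s)) \<partial>lborel)"
    by (rule nn_integral_real_affine) (use s in auto)
  also have "\<dots> = ennreal s * (\<integral>\<^sup>+r. ennreal (1 / s\<^sup>2) * (ennreal (1 / r ^ 5) * indicator {0<..} r * lens_volume r) \<partial>lborel)"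
  proof -
    have "ennreal (1 / (0 + s * r) ^ 5) * indicator {0<..} (0 + s * r) * (ennreal (s ^ 3) * lens_volume ((0 + s * r) / s))
      = ennreal (1 / s\<^sup>2) * (ennreal (1 / r ^ 5) * indicator {0<..} r * lens_volume r)" for r
    proof (cases "0 < r")
      case True
      have "1 / (s * r) ^ 5 * s ^ 3 = 1 / s\<^sup>2 * (1 / r ^ 5)"
        using s True by (simp add: field_simps eval_nat_numeral)
      then have "ennreal (1 / (s * r) ^ 5) * ennreal (s ^ 3) = ennreal (1 / s\<^sup>2) * ennreal (1 / r ^ 5)"
        using s True by (simp flip: ennreal_mult)
      then show ?thesis using s True by (simp add: mult.assoc[symmetric])
    qed (use s in \<open>simp add: zero_less_mult_iff\<close>)
    then show ?thesis using s by simp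
  qed
  also have "\<dots> = ennreal s * (ennreal (1 / s\<^sup>2) * lens_const)"
    unfolding lens_const_def by (subst nn_integral_cmult) auto
  also have "\<dots> = (ennreal s * ennreal (1 / s\<^sup>2)) * lens_const" by (simp add: mult.assoc)
  also have "ennreal s * ennreal (1 / s\<^sup>2) = ennreal (1 / s)"
    using s by (simp flip: ennreal_mult) (simp add: power2_eq_square)
  finally show ?thesis by (simp add: s_def mult.commute)
qed

section \<open>The operator\<close>

lemma L2_if_bounded:
  assumes "\<Omega> \<in> lmeasurable" "f \<in> borel_measurable (lebesgue_on \<Omega>)" "\<And>x. norm (f x) \<le> B"
  shows "f \<in> L2 \<Omega>" "L2_norm \<Omega> f \<le> B * sqrt (measure lebesgue \<Omega>)"
proof -
  interpret finite_measure "lebesgue_on \<Omega>" by (rule finite_measure_lebesgue_on[OF assms(1)])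
  have B: "0 \<le> B" using assms(3)[of undefined] norm_ge_zero order_trans by blast
  have b: "(norm (f x))\<^sup>2 \<le> B\<^sup>2" for x using assms(3) by (intro power_mono) auto
  have i: "integrable (lebesgue_on \<Omega>) (\<lambda>x. (norm (f x))\<^sup>2)"
  proof (rule integrable_const_bound[of _ "B\<^sup>2"])
    show "(\<lambda>x. (norm (f x))\<^sup>2) \<in> borel_measurable (lebesgue_on \<Omega>)" using assms(2) by measurable
  qed (use b in auto)
  then show "f \<in> L2 \<Omega>" using assms(2) by (simp add: L2_def)
  have "(L2_norm \<Omega> f)\<^sup>2 \<le> (\<integral>x. B\<^sup>2 \<partial>lebesgue_on \<Omega>)"
    unfolding power2_L2_norm L2_inner_self using i b by (intro integral_mono) auto
  also have "\<dots> = B\<^sup>2 * measure lebesgue \<Omega>"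
    using fmeasurableD[OF assms(1)] by (simp add: measure_restrict_space)
  finally have "(L2_norm \<Omega> f)\<^sup>2 \<le> (B * sqrt (measure lebesgue \<Omega>))\<^sup>2" by (simp add: power_mult_distrib)
  then show "L2_norm \<Omega> f \<le> B * sqrt (measure lebesgue \<Omega>)"
    by (rule power2_le_imp_le) (simp add: B)
qed

lemma L2_integrable:
  assumes "\<Omega> \<in> lmeasurable" "u \<in> L2 \<Omega>"
  shows "integrable (lebesgue_on \<Omega>) u"
proof -
  have one: "(\<lambda>x. 1::real) \<in> L2 \<Omega>" using L2_if_bounded(1)[OF assms(1), of "\<lambda>_. 1::real" 1] by simp
  have "integrable (lebesgue_on \<Omega>) (\<lambda>x. norm (u x))"
    using L2_integrable_norm_mult[OF assms(2) one] by simp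
  then show ?thesis using L2D(1)[OF assms(2)] by (rule integrable_norm_cancel)
qed

lemma inverse_norm_kernel_L2:
  fixes \<Omega> :: "(real^3) set"
  assumes \<Omega>: "\<Omega> \<in> lmeasurable"
  obtains K where "0 \<le> K" "\<And>x. (\<lambda>y. 1 / norm (x - y)) \<in> L2 \<Omega>"
    "\<And>x. L2_norm \<Omega> (\<lambda>y. 1 / norm (x - y)) \<le> K"
proof -
  obtain C where C: "0 \<le> C" "\<And>x. (\<integral>\<^sup>+y. ennreal ((1 / norm (x - y))\<^sup>2) \<partial>lebesgue_on \<Omega>) \<le> ennreal C"
    using inverse_square_kernel_bound[OF \<Omega>] by metis
  have m: "(\<lambda>y. 1 / norm (x - y)) \<in> borel_measurable (lebesgue_on \<Omega>)" for x
    using borel_measurable_ident_lebesgue_on[of \<Omega>] by measurable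
  have i: "integrable (lebesgue_on \<Omega>) (\<lambda>y. (norm (1 / norm (x - y)))\<^sup>2)" for x
  proof (rule integrableI_bounded)
    show "(\<lambda>y. (norm (1 / norm (x - y)))\<^sup>2) \<in> borel_measurable (lebesgue_on \<Omega>)" using m by measurable
    show "(\<integral>\<^sup>+y. ennreal (norm ((norm (1 / norm (x - y)))\<^sup>2)) \<partial>lebesgue_on \<Omega>) < \<infinity>"
      using C(2)[of x] by (simp add: le_less_trans)
  qed
  have L: "(\<lambda>y. 1 / norm (x - y)) \<in> L2 \<Omega>" for x using m i by (simp add: L2_def)
  have "L2_norm \<Omega> (\<lambda>y. 1 / norm (x - y)) \<le> sqrt C" for x
  proof -
    have "ennreal (\<integral>y. (norm (1 / norm (x - y)))\<^sup>2 \<partial>lebesgue_on \<Omega>) \<le> ennreal C"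
      using C(2)[of x] i[of x] by (subst nn_integral_eq_integral[symmetric]) auto
    then have "L2_inner \<Omega> (\<lambda>y. 1 / norm (x - y)) (\<lambda>y. 1 / norm (x - y)) \<le> C"
      using C(1) unfolding L2_inner_self by simp
    then show ?thesis by (simp add: L2_norm_def)
  qed
  then show ?thesis using that[of "sqrt C"] L C(1) by simp
qed

lemma borel_measurable_pair_lebesgue_on:
  fixes u :: "'a::euclidean_space \<Rightarrow> 'b::topological_space"
  assumes "u \<in> borel_measurable (lebesgue_on \<Omega>)"
  shows "(\<lambda>p. fst p) \<in> borel_measurable (lebesgue_on \<Omega> \<Otimes>\<^sub>M lebesgue_on \<Omega>)"
    "(\<lambda>p. snd p) \<in> borel_measurable (lebesgue_on \<Omega> \<Otimes>\<^sub>M lebesgue_on \<Omega>)"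
    "(\<lambda>p. u (fst p)) \<in> borel_measurable (lebesgue_on \<Omega> \<Otimes>\<^sub>M lebesgue_on \<Omega>)"
    "(\<lambda>p. u (snd p)) \<in> borel_measurable (lebesgue_on \<Omega> \<Otimes>\<^sub>M lebesgue_on \<Omega>)"
  by (rule measurable_compose[OF measurable_fst borel_measurable_ident_lebesgue_on]
      measurable_compose[OF measurable_snd borel_measurable_ident_lebesgue_on]
      measurable_compose[OF measurable_fst assms] measurable_compose[OF measurable_snd assms])+

context
  fixes \<Omega> :: "(real^3) set"
  assumes \<Omega>: "\<Omega> \<in> lmeasurable"
begin

lemma A_op_integrable:
  assumes u: "u \<in> L2 \<Omega>"
  shows "integrable (lebesgue_on \<Omega>) (\<lambda>y. (1 / norm (x - y)) *\<^sub>R u y)"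
proof -
  obtain K where K: "(\<lambda>y. 1 / norm (x - y)) \<in> L2 \<Omega>" using inverse_norm_kernel_L2[OF \<Omega>] by metis
  show ?thesis
  proof (rule Bochner_Integration.integrable_bound[OF L2_integrable_norm_mult[OF K u]])
    show "(\<lambda>y. (1 / norm (x - y)) *\<^sub>R u y) \<in> borel_measurable (lebesgue_on \<Omega>)"
      using L2D(1)[OF K] L2D(1)[OF u] by (rule borel_measurable_scaleR)
  qed auto
qed

lemma A_op_add:
  assumes "u \<in> L2 \<Omega>" "v \<in> L2 \<Omega>"
  shows "A_op \<mu> \<Omega> (\<lambda>x. u x + v x) = (\<lambda>x. A_op \<mu> \<Omega> u x + A_op \<mu> \<Omega> v x)"
  using A_op_integrable[OF assms(1)] A_op_integrable[OF assms(2)]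
  by (simp add: A_op_def fun_eq_iff scaleR_add_right)

lemma A_op_scaleR: "A_op \<mu> \<Omega> (\<lambda>x. c *\<^sub>R u x) = (\<lambda>x. c *\<^sub>R A_op \<mu> \<Omega> u x)"
proof
  fix x
  have "(\<lambda>y. (1 / norm (x - y)) *\<^sub>R c *\<^sub>R u y) = (\<lambda>y. c *\<^sub>R (1 / norm (x - y)) *\<^sub>R u y)"
    by (rule ext) (rule scaleR_left_commute)
  then have "(\<integral>y. (1 / norm (x - y)) *\<^sub>R c *\<^sub>R u y \<partial>lebesgue_on \<Omega>) = c *\<^sub>R (\<integral>y. (1 / norm (x - y)) *\<^sub>R u y \<partial>lebesgue_on \<Omega>)"
    by (simp only: integral_scaleR_right)
  then show "A_op \<mu> \<Omega> (\<lambda>x. c *\<^sub>R u x) x = c *\<^sub>R A_op \<mu> \<Omega> u x"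
    unfolding A_op_def by (simp only: scaleR_left_commute)
qed

lemma A_op_measurable:
  assumes u: "u \<in> L2 \<Omega>"
  shows "A_op \<mu> \<Omega> u \<in> borel_measurable (lebesgue_on \<Omega>)"
proof -
  define M where "M = lebesgue_on \<Omega>"
  interpret M: finite_measure M unfolding M_def by (rule finite_measure_lebesgue_on[OF \<Omega>])
  note [measurable] = borel_measurable_pair_lebesgue_on[OF L2D(1)[OF u], folded M_def]
  have "(\<lambda>x. \<integral>y. (1 / norm (x - y)) *\<^sub>R u y \<partial>M) \<in> borel_measurable M"
    by (rule M.borel_measurable_lebesgue_integral) (simp add: case_prod_beta)
  then show ?thesis by (simp add: A_op_def[abs_def] M_def)
qed

text \<open>The \<open>L2\<close> norm of the kernel is bounded uniformly in \<open>x\<close>, so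
  Cauchy-Schwarz bounds the potential at every point and not merely in the mean.\<close>

lemma A_op_bounded:
  obtains K where "0 \<le> K" "\<And>u x. u \<in> L2 \<Omega> \<Longrightarrow> norm (A_op \<mu> \<Omega> u x) \<le> K * L2_norm \<Omega> u"
proof -
  obtain K where K: "0 \<le> K" "\<And>x. (\<lambda>y. 1 / norm (x - y)) \<in> L2 \<Omega>"
    "\<And>x. L2_norm \<Omega> (\<lambda>y. 1 / norm (x - y)) \<le> K"
    using inverse_norm_kernel_L2[OF \<Omega>] by metis
  have "norm (A_op \<mu> \<Omega> u x) \<le> (\<bar>\<mu> / (4 * pi)\<bar> * K) * L2_norm \<Omega> u" if u: "u \<in> L2 \<Omega>" for u x
  proof -
    have "norm (\<integral>y. (1 / norm (x - y)) *\<^sub>R u y \<partial>lebesgue_on \<Omega>) \<le> (\<integral>y. norm ((1 / norm (x - y)) *\<^sub>R u y) \<partial>lebesgue_on \<Omega>)"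
      by (rule integral_norm_bound)
    also have "\<dots> \<le> L2_norm \<Omega> (\<lambda>y. 1 / norm (x - y)) * L2_norm \<Omega> u"
      using integral_norm_mult_le[OF K(2) u, of x] by simp
    also have "\<dots> \<le> K * L2_norm \<Omega> u" by (intro mult_right_mono K(3) L2_norm_nonneg)
    finally show ?thesis
      unfolding A_op_def norm_scaleR using mult_left_mono[of _ "K * L2_norm \<Omega> u" "\<bar>\<mu> / (4 * pi)\<bar>"]
      by (simp add: mult.assoc)
  qed
  then show ?thesis using that[of "\<bar>\<mu> / (4 * pi)\<bar> * K"] K(1) by simp
qed

lemma A_op_L2:
  assumes "u \<in> L2 \<Omega>"
  shows "A_op \<mu> \<Omega> u \<in> L2 \<Omega>"
proof -
  obtain K where K: "0 \<le> K" "\<And>u x. u \<in> L2 \<Omega> \<Longrightarrow> norm (A_op \<mu> \<Omega> u x) \<le> K * L2_norm \<Omega> u"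
    using A_op_bounded[of \<mu>] by metis
  then show ?thesis by (intro L2_if_bounded(1)[OF \<Omega> A_op_measurable[OF assms] K(2)[OF assms]])
qed

lemma A_op_norm_le:
  obtains K where "0 \<le> K" "\<And>u. u \<in> L2 \<Omega> \<Longrightarrow> L2_norm \<Omega> (A_op \<mu> \<Omega> u) \<le> K * L2_norm \<Omega> u"
proof -
  obtain K where K: "0 \<le> K" "\<And>u x. u \<in> L2 \<Omega> \<Longrightarrow> norm (A_op \<mu> \<Omega> u x) \<le> K * L2_norm \<Omega> u"
    using A_op_bounded[of \<mu>] by metis
  have "L2_norm \<Omega> (A_op \<mu> \<Omega> u) \<le> (K * sqrt (measure lebesgue \<Omega>)) * L2_norm \<Omega> u" if u: "u \<in> L2 \<Omega>" for u
    using L2_if_bounded(2)[OF \<Omega> A_op_measurable[OF u] K(2)[OF u]] by (simp add: mult_ac)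
  then show ?thesis using that[of "K * sqrt (measure lebesgue \<Omega>)"] K(1) by simp
qed

text \<open>Absolute integrability of the double integral. It licenses Fubini both for the symmetry
  of the operator and for the representation of its quadratic form.\<close>

lemma kernel_integrable:
  assumes u: "u \<in> L2 \<Omega>" and v: "v \<in> L2 \<Omega>"
  shows "integrable (lebesgue_on \<Omega> \<Otimes>\<^sub>M lebesgue_on \<Omega>) (\<lambda>(x, y). 1 / norm (x - y) * (u y \<bullet> v x))"
proof -
  define M where "M = lebesgue_on \<Omega>"
  interpret M: finite_measure M unfolding M_def by (rule finite_measure_lebesgue_on[OF \<Omega>])
  interpret MM: pair_sigma_finite M M ..
  note [measurable] = borel_measurable_pair_lebesgue_on[OF L2D(1)[OF u], folded M_def]
    borel_measurable_pair_lebesgue_on[OF L2D(1)[OF v], folded M_def]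
  obtain K where K: "0 \<le> K" "\<And>x. (\<lambda>y. 1 / norm (x - y)) \<in> L2 \<Omega>"
    "\<And>x. L2_norm \<Omega> (\<lambda>y. 1 / norm (x - y)) \<le> K"
    using inverse_norm_kernel_L2[OF \<Omega>] by metis
  let ?f = "\<lambda>(x, y). 1 / norm (x - y) * (u y \<bullet> v x)"
  have i: "integrable M (\<lambda>y. ?f (x, y))" for x
    using integrable_inner_left[of "v x", OF A_op_integrable[OF u, of x]] by (simp add: M_def)
  have fm: "?f \<in> borel_measurable (M \<Otimes>\<^sub>M M)" unfolding case_prod_beta by measurable
  have "integrable (M \<Otimes>\<^sub>M M) ?f"
  proof (rule MM.Fubini_integrable[OF fm])
    show "integrable M (\<lambda>x. \<integral>y. norm (?f (x, y)) \<partial>M)"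
    proof (rule Bochner_Integration.integrable_bound)
      show "integrable M (\<lambda>x. K * L2_norm \<Omega> u * norm (v x))"
        using L2_integrable[OF \<Omega> v] by (simp add: M_def)
      show "(\<lambda>x. \<integral>y. norm (?f (x, y)) \<partial>M) \<in> borel_measurable M"
        using fm by (intro M.borel_measurable_lebesgue_integral) (simp add: case_prod_beta)
      have "(\<integral>y. norm (?f (x, y)) \<partial>M) \<le> K * L2_norm \<Omega> u * norm (v x)" for x
      proof -
        have "(\<integral>y. norm (?f (x, y)) \<partial>M) \<le> (\<integral>y. norm (1 / norm (x - y)) * norm (u y) * norm (v x) \<partial>M)"
        proof (rule integral_mono[OF integrable_norm[OF i]])
          show "integrable M (\<lambda>y. norm (1 / norm (x - y)) * norm (u y) * norm (v x))"
            using L2_integrable_norm_mult[OF K(2)[of x] u] unfolding M_def by (rule integrable_mult_left)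
        qed (simp add: abs_mult divide_right_mono Cauchy_Schwarz_ineq2)
        also have "\<dots> = (\<integral>y. norm (1 / norm (x - y)) * norm (u y) \<partial>M) * norm (v x)"
          by (rule integral_mult_left_zero)
        also have "\<dots> \<le> K * L2_norm \<Omega> u * norm (v x)"
          using integral_norm_mult_le[OF K(2)[of x] u] mult_right_mono[OF K(3)[of x] L2_norm_nonneg[of \<Omega> u]]
          unfolding M_def by (intro mult_right_mono) auto
        finally show ?thesis .
      qed
      moreover have "0 \<le> (\<integral>y. norm (?f (x, y)) \<partial>M)" for x by (intro Bochner_Integration.integral_nonneg) simp
      ultimately show "AE x in M. norm (\<integral>y. norm (?f (x, y)) \<partial>M) \<le> norm (K * L2_norm \<Omega> u * norm (v x))"
        by (intro AE_I2) (auto intro: order_trans[OF _ abs_ge_self])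
    qed
  qed (use i in simp)
  then show ?thesis unfolding M_def .
qed

lemma L2_inner_A_op:
  assumes u: "u \<in> L2 \<Omega>"
  shows "L2_inner \<Omega> (A_op \<mu> \<Omega> u) v
    = \<mu> / (4 * pi) * (\<integral>x. \<integral>y. 1 / norm (x - y) * (u y \<bullet> v x) \<partial>lebesgue_on \<Omega> \<partial>lebesgue_on \<Omega>)"
proof -
  have "(\<integral>y. (1 / norm (x - y)) *\<^sub>R u y \<partial>lebesgue_on \<Omega>) \<bullet> v x = (\<integral>y. 1 / norm (x - y) * (u y \<bullet> v x) \<partial>lebesgue_on \<Omega>)" for x
    using integral_inner_left[of "v x" "lebesgue_on \<Omega>" "\<lambda>y. (1 / norm (x - y)) *\<^sub>R u y"] A_op_integrable[OF u, of x]
    by simp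
  then show ?thesis by (simp add: L2_inner_def A_op_def)
qed

lemma A_op_symmetric:
  assumes u: "u \<in> L2 \<Omega>" and v: "v \<in> L2 \<Omega>"
  shows "L2_inner \<Omega> (A_op \<mu> \<Omega> u) v = L2_inner \<Omega> (A_op \<mu> \<Omega> v) u"
proof -
  define M where "M = lebesgue_on \<Omega>"
  interpret M: finite_measure M unfolding M_def by (rule finite_measure_lebesgue_on[OF \<Omega>])
  interpret MM: pair_sigma_finite M M ..
  have "(\<integral>x. \<integral>y. 1 / norm (x - y) * (u y \<bullet> v x) \<partial>M \<partial>M) = (\<integral>y. \<integral>x. 1 / norm (x - y) * (u y \<bullet> v x) \<partial>M \<partial>M)"
    by (rule MM.Fubini_integral[symmetric]) (use kernel_integrable[OF u v] in \<open>simp add: M_def\<close>)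
  also have "\<dots> = (\<integral>x. \<integral>y. 1 / norm (x - y) * (v y \<bullet> u x) \<partial>M \<partial>M)"
    by (simp add: norm_minus_commute inner_commute)
  finally show ?thesis by (simp add: L2_inner_A_op[OF u] L2_inner_A_op[OF v] M_def)
qed

end

section \<open>Positive definiteness\<close>

text \<open>The cutoff at nonpositive radii lets the parameters (centre, radius) range over the full
  product space with its Lebesgue measure.\<close>

definition radial_weight :: "real \<Rightarrow> real" where
  "radial_weight r = (if 0 < r then 1 / r ^ 5 else 0)"

definition ball_ind :: "real^3 \<Rightarrow> (real^3) \<times> real \<Rightarrow> real" where
  "ball_ind x p = (if norm (x - fst p) \<le> snd p then 1 else 0)"

definition ball_form :: "(real^3) set \<Rightarrow> (real^3 \<Rightarrow> real^3) \<Rightarrow> (real^3) \<times> real \<Rightarrow> real" where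
  "ball_form \<Omega> u p = radial_weight (snd p) * (norm (\<integral>x. ball_ind x p *\<^sub>R u x \<partial>lebesgue_on \<Omega>))\<^sup>2"

lemma radial_weight_nonneg: "0 \<le> radial_weight r"
  by (simp add: radial_weight_def)

lemma ball_ind_bounds: "0 \<le> ball_ind x p" "ball_ind x p \<le> 1"
  by (simp_all add: ball_ind_def)

lemma radial_weight_measurable [measurable]: "radial_weight \<in> borel_measurable borel"
  unfolding radial_weight_def[abs_def] by measurable

lemma ball_ind_pair_measurable: "(\<lambda>p. radial_weight (snd p) * ball_ind x p * ball_ind y p) \<in> borel_measurable (lborel \<Otimes>\<^sub>M lborel)"
  unfolding ball_ind_def by measurable

text \<open>For a fixed radius, the centres \<open>z\<close> whose ball contains both points are
  those in the lens around \<open>x\<close> and \<open>y\<close>; integrating over centres before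
  radii thus meets the lens formula.\<close>

lemma nn_integral_ball_ind_pair:
  fixes x y :: "real^3"
  assumes "x \<noteq> y"
  shows "(\<integral>\<^sup>+p. ennreal (radial_weight (snd p) * ball_ind x p * ball_ind y p) \<partial>(lborel \<Otimes>\<^sub>M lborel))
    = lens_const * ennreal (1 / norm (x - y))"
proof -
  have "(\<integral>\<^sup>+p. ennreal (radial_weight (snd p) * ball_ind x p * ball_ind y p) \<partial>(lborel \<Otimes>\<^sub>M lborel))
    = (\<integral>\<^sup>+r. \<integral>\<^sup>+z. ennreal (radial_weight r * ball_ind x (z, r) * ball_ind y (z, r)) \<partial>lborel \<partial>lborel)"
    using ball_ind_pair_measurable[of x y]
    by (subst lborel_pair.nn_integral_snd[symmetric]) (simp_all add: case_prod_beta)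
  also have "\<dots> = (\<integral>\<^sup>+r. ennreal (1 / r ^ 5) * indicator {0<..} r * emeasure lborel (cball x r \<inter> cball y r) \<partial>lborel)"
  proof (rule nn_integral_cong)
    fix r :: real
    have "(\<integral>\<^sup>+z. ennreal (radial_weight r * ball_ind x (z, r) * ball_ind y (z, r)) \<partial>lborel)
        = (\<integral>\<^sup>+z. ennreal (1 / r ^ 5) * indicator {0<..} r * indicator (cball x r \<inter> cball y r) z \<partial>lborel)"
      by (intro nn_integral_cong) (auto simp: radial_weight_def ball_ind_def indicator_def dist_norm)
    also have "\<dots> = ennreal (1 / r ^ 5) * indicator {0<..} r * emeasure lborel (cball x r \<inter> cball y r)"
      by (rule nn_integral_cmult_indicator) simp
    finally show "(\<integral>\<^sup>+z. ennreal (radial_weight r * ball_ind x (z, r) * ball_ind y (z, r)) \<partial>lborel)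
      = ennreal (1 / r ^ 5) * indicator {0<..} r * emeasure lborel (cball x r \<inter> cball y r)" .
  qed
  also have "\<dots> = lens_const * ennreal (1 / norm (x - y))"
    by (rule nn_integral_cball_pairs[OF assms])
  finally show ?thesis .
qed

lemma integral_ball_ind_pair:
  fixes x y :: "real^3"
  assumes "x \<noteq> y"
  shows "(\<integral>p. radial_weight (snd p) * ball_ind x p * ball_ind y p \<partial>(lborel \<Otimes>\<^sub>M lborel))
    = enn2real lens_const * (1 / norm (x - y))"
proof -
  have "(\<integral>p. radial_weight (snd p) * ball_ind x p * ball_ind y p \<partial>(lborel \<Otimes>\<^sub>M lborel))
    = enn2real (\<integral>\<^sup>+p. ennreal (radial_weight (snd p) * ball_ind x p * ball_ind y p) \<partial>(lborel \<Otimes>\<^sub>M lborel))"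
    using ball_ind_pair_measurable
    by (intro integral_eq_nn_integral) (simp_all add: radial_weight_nonneg ball_ind_bounds)
  then show ?thesis by (simp add: nn_integral_ball_ind_pair[OF assms] enn2real_mult)
qed

text \<open>\<open>\<langle>A u, u\<rangle>\<close> is, up to a positive factor, the integral of \<open>r\<^sup>-\<^sup>5 \<bar>\<integral>\<^bsub>B(z, r)\<^esub> u\<bar>\<^sup>2\<close> over all balls \<open>B(z, r)\<close>.\<close>

lemma A_op_quadratic_form:
  fixes \<Omega> :: "(real^3) set"
  assumes \<Omega>: "\<Omega> \<in> lmeasurable" and u: "u \<in> L2 \<Omega>"
  shows "integrable (lborel \<Otimes>\<^sub>M lborel) (ball_form \<Omega> u)"
    and "enn2real lens_const * L2_inner \<Omega> (A_op \<mu> \<Omega> u) u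
      = \<mu> / (4 * pi) * (\<integral>p. ball_form \<Omega> u p \<partial>(lborel \<Otimes>\<^sub>M lborel))"
proof -
  define M where "M = lebesgue_on \<Omega>"
  define P where "P = (lborel :: (real^3) measure) \<Otimes>\<^sub>M (lborel :: real measure)"
  define \<kappa> where "\<kappa> = enn2real lens_const"
  interpret M: finite_measure M unfolding M_def by (rule finite_measure_lebesgue_on[OF \<Omega>])
  interpret MM: pair_sigma_finite M M ..
  interpret P: sigma_finite_measure P unfolding P_def by (rule sigma_finite_pair_measure) (rule sigma_finite_lborel)+
  interpret MMs: sigma_finite_measure "M \<Otimes>\<^sub>M M" by (rule sigma_finite_pair_measure) (rule M.sigma_finite_measure_axioms)+
  interpret Q: pair_sigma_finite "M \<Otimes>\<^sub>M M" P ..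
  have \<Omega>s: "\<Omega> \<in> sets lebesgue" using \<Omega> by (rule fmeasurableD)
  have idm: "(\<lambda>x. x) \<in> borel_measurable M"
    unfolding M_def by (rule borel_measurable_ident_lebesgue_on)
  have um: "u \<in> borel_measurable M" using L2D(1)[OF u] by (simp add: M_def)
  have ui: "integrable M u" using L2_integrable[OF \<Omega> u] by (simp add: M_def)
  note [measurable] = borel_measurable_pair_lebesgue_on[OF L2D(1)[OF u], folded M_def]
  \<comment> \<open>One integrand on pairs of points times balls. Integrated over the balls it gives
    the Coulomb double integral, integrated over the pairs it gives a square.\<close>
  define F where "F q p = radial_weight (snd p) * ball_ind (fst q) p * ball_ind (snd q) p * (u (snd q) \<bullet> u (fst q))" for q p
  have Fm: "case_prod F \<in> borel_measurable ((M \<Otimes>\<^sub>M M) \<Otimes>\<^sub>M P)"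
  proof -
    have [measurable]: "(\<lambda>w. fst (fst w)) \<in> borel_measurable ((M \<Otimes>\<^sub>M M) \<Otimes>\<^sub>M P)"
      "(\<lambda>w. snd (fst w)) \<in> borel_measurable ((M \<Otimes>\<^sub>M M) \<Otimes>\<^sub>M P)"
      "(\<lambda>w. u (fst (fst w))) \<in> borel_measurable ((M \<Otimes>\<^sub>M M) \<Otimes>\<^sub>M P)"
      "(\<lambda>w. u (snd (fst w))) \<in> borel_measurable ((M \<Otimes>\<^sub>M M) \<Otimes>\<^sub>M P)"
      by measurable
    have [measurable]: "(\<lambda>w. fst (snd w)) \<in> borel_measurable ((M \<Otimes>\<^sub>M M) \<Otimes>\<^sub>M P)"
      "(\<lambda>w. snd (snd w)) \<in> borel_measurable ((M \<Otimes>\<^sub>M M) \<Otimes>\<^sub>M P)"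
      unfolding P_def by measurable
    show ?thesis unfolding F_def ball_ind_def case_prod_beta by measurable
  qed
  \<comment> \<open>The representation of the kernel breaks down on the diagonal, where the integral
    over balls is infinite while \<open>1 / 0 = 0\<close>; the diagonal is a null set of the
    product.\<close>
  have offdiag: "AE q in M \<Otimes>\<^sub>M M. fst q \<noteq> snd q"
  proof (rule MM.AE_pair_measure)
    show "{q \<in> space (M \<Otimes>\<^sub>M M). fst q \<noteq> snd q} \<in> sets (M \<Otimes>\<^sub>M M)" by measurable
    show "AE x in M. AE y in M. fst (x, y) \<noteq> snd (x, y)"
    proof (rule AE_I2)
      fix x
      show "AE y in M. fst (x, y) \<noteq> snd (x, y)"
        using AE_lebesgue_on_neq[OF \<Omega>s, of x] unfolding M_def by eventually_elim auto
    qed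
  qed
  have nnP: "(\<integral>\<^sup>+p. ennreal (norm (F q p)) \<partial>P) = lens_const * ennreal (1 / norm (fst q - snd q)) * ennreal \<bar>u (snd q) \<bullet> u (fst q)\<bar>"
    if "fst q \<noteq> snd q" for q
  proof -
    have "(\<integral>\<^sup>+p. ennreal (norm (F q p)) \<partial>P) = (\<integral>\<^sup>+p. ennreal (radial_weight (snd p) * ball_ind (fst q) p * ball_ind (snd q) p) * ennreal \<bar>u (snd q) \<bullet> u (fst q)\<bar> \<partial>P)"
      by (intro nn_integral_cong)
        (simp add: F_def abs_mult radial_weight_nonneg ball_ind_bounds flip: ennreal_mult)
    also have "\<dots> = (\<integral>\<^sup>+p. ennreal (radial_weight (snd p) * ball_ind (fst q) p * ball_ind (snd q) p) \<partial>P) * ennreal \<bar>u (snd q) \<bullet> u (fst q)\<bar>"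
      using ball_ind_pair_measurable unfolding P_def by (intro nn_integral_multc) simp
    finally show ?thesis using nn_integral_ball_ind_pair[OF that] by (simp add: P_def)
  qed
  have Fi: "integrable ((M \<Otimes>\<^sub>M M) \<Otimes>\<^sub>M P) (case_prod F)"
  proof (rule integrableI_bounded[OF Fm])
    have "(\<integral>\<^sup>+w. ennreal (norm (case_prod F w)) \<partial>((M \<Otimes>\<^sub>M M) \<Otimes>\<^sub>M P)) = (\<integral>\<^sup>+q. \<integral>\<^sup>+p. ennreal (norm (F q p)) \<partial>P \<partial>(M \<Otimes>\<^sub>M M))"
      using Fm by (subst P.nn_integral_fst[symmetric]) simp_all
    also have "\<dots> = (\<integral>\<^sup>+q. lens_const * (ennreal (1 / norm (fst q - snd q)) * ennreal \<bar>u (snd q) \<bullet> u (fst q)\<bar>) \<partial>(M \<Otimes>\<^sub>M M))"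
    proof (rule nn_integral_cong_AE)
      show "AE q in M \<Otimes>\<^sub>M M. (\<integral>\<^sup>+p. ennreal (norm (F q p)) \<partial>P)
        = lens_const * (ennreal (1 / norm (fst q - snd q)) * ennreal \<bar>u (snd q) \<bullet> u (fst q)\<bar>)"
        using offdiag
      proof eventually_elim
        case (elim q)
        show ?case using nnP[OF elim] by (simp only: mult.assoc)
      qed
    qed
    also have "\<dots> = lens_const * (\<integral>\<^sup>+q. ennreal (1 / norm (fst q - snd q)) * ennreal \<bar>u (snd q) \<bullet> u (fst q)\<bar> \<partial>(M \<Otimes>\<^sub>M M))"
      by (intro nn_integral_cmult) measurable
    also have "\<dots> < \<infinity>"
    proof -
      have "(\<integral>\<^sup>+q. ennreal (1 / norm (fst q - snd q)) * ennreal \<bar>u (snd q) \<bullet> u (fst q)\<bar> \<partial>(M \<Otimes>\<^sub>M M))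
        = (\<integral>\<^sup>+q. ennreal (norm (case q of (x, y) \<Rightarrow> 1 / norm (x - y) * (u y \<bullet> u x))) \<partial>(M \<Otimes>\<^sub>M M))"
        by (intro nn_integral_cong) (simp add: case_prod_beta abs_mult flip: ennreal_mult)
      also have "\<dots> < \<infinity>"
        using kernel_integrable[OF \<Omega> u u] unfolding integrable_iff_bounded M_def by simp
      finally show ?thesis using lens_const_finite by (simp add: ennreal_mult_less_top)
    qed
    finally show "(\<integral>\<^sup>+w. ennreal (norm (case_prod F w)) \<partial>((M \<Otimes>\<^sub>M M) \<Otimes>\<^sub>M P)) < \<infinity>" .
  qed
  \<comment> \<open>The other order of integration, pairs of points for a fixed ball. Here the two
    indicators factorise, which is the source of positivity.\<close>
  define R where "R p = (\<integral>q. F q p \<partial>(M \<Otimes>\<^sub>M M))" for p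
  have R1: "integrable P R" unfolding R_def by (rule Q.integrable_snd[OF Fi])
  have "(\<integral>p. R p \<partial>P) = (\<integral>q. \<integral>p. F q p \<partial>P \<partial>(M \<Otimes>\<^sub>M M))"
    unfolding R_def using Q.integral_snd[OF Fi] Q.integral_fst[OF Fi] by simp
  also have "\<dots> = (\<integral>q. \<kappa> * (case q of (x, y) \<Rightarrow> 1 / norm (x - y) * (u y \<bullet> u x)) \<partial>(M \<Otimes>\<^sub>M M))"
  proof (rule integral_cong_AE)
    show "(\<lambda>q. \<integral>p. F q p \<partial>P) \<in> borel_measurable (M \<Otimes>\<^sub>M M)"
      by (rule borel_measurable_integrable[OF Q.integrable_fst[OF Fi]])
    show "(\<lambda>q. \<kappa> * (case q of (x, y) \<Rightarrow> 1 / norm (x - y) * (u y \<bullet> u x))) \<in> borel_measurable (M \<Otimes>\<^sub>M M)"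
      using kernel_integrable[OF \<Omega> u u] by (intro borel_measurable_times) (auto simp: M_def)
    show "AE q in M \<Otimes>\<^sub>M M. (\<integral>p. F q p \<partial>P) = \<kappa> * (case q of (x, y) \<Rightarrow> 1 / norm (x - y) * (u y \<bullet> u x))"
      using offdiag
    proof eventually_elim
      case (elim q)
      have "(\<integral>p. F q p \<partial>P) = (\<integral>p. radial_weight (snd p) * ball_ind (fst q) p * ball_ind (snd q) p \<partial>P) * (u (snd q) \<bullet> u (fst q))"
        unfolding F_def by (rule integral_mult_left_zero)
      then show ?case
        using integral_ball_ind_pair[OF elim] by (simp add: P_def \<kappa>_def case_prod_beta)
    qed
  qed
  also have "\<dots> = \<kappa> * (\<integral>x. \<integral>y. 1 / norm (x - y) * (u y \<bullet> u x) \<partial>M \<partial>M)"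
    using MM.integral_fst[of "\<lambda>x y. 1 / norm (x - y) * (u y \<bullet> u x)"] kernel_integrable[OF \<Omega> u u]
    by (simp only: integral_mult_right_zero M_def)
  finally have form: "\<kappa> * L2_inner \<Omega> (A_op \<mu> \<Omega> u) u = \<mu> / (4 * pi) * (\<integral>p. R p \<partial>P)"
    unfolding L2_inner_A_op[OF \<Omega> u] M_def by (simp add: mult_ac)
  \<comment> \<open>Fubini provides integrability of the section at \<open>p\<close> for almost
    every ball, which suffices to split the integral over pairs into the squared norm.\<close>
  have R2: "AE p in P. R p = ball_form \<Omega> u p"
    using Q.AE_integrable_snd[OF Fi]
  proof eventually_elim
    case (elim p)
    define W where "W = (\<integral>x. ball_ind x p *\<^sub>R u x \<partial>M)"
    have bi: "integrable M (\<lambda>x. ball_ind x p *\<^sub>R u x)"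
    proof (rule Bochner_Integration.integrable_bound[OF ui])
      have "(\<lambda>x. ball_ind x p) \<in> borel_measurable M" unfolding ball_ind_def using idm by measurable
      then show "(\<lambda>x. ball_ind x p *\<^sub>R u x) \<in> borel_measurable M" using um by (rule borel_measurable_scaleR)
      show "AE x in M. norm (ball_ind x p *\<^sub>R u x) \<le> norm (u x)" by (intro AE_I2) (simp add: ball_ind_def)
    qed
    have "R p = (\<integral>x. \<integral>y. F (x, y) p \<partial>M \<partial>M)"
      unfolding R_def by (rule MM.integral_fst'[OF elim, symmetric])
    also have "\<dots> = (\<integral>x. \<integral>y. radial_weight (snd p) * ((ball_ind y p *\<^sub>R u y) \<bullet> (ball_ind x p *\<^sub>R u x)) \<partial>M \<partial>M)"
      by (intro Bochner_Integration.integral_cong) (simp_all add: F_def mult_ac)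
    also have "\<dots> = (\<integral>x. radial_weight (snd p) * (W \<bullet> (ball_ind x p *\<^sub>R u x)) \<partial>M)"
      unfolding W_def using bi by (simp only: integral_mult_right_zero integral_inner_left)
    also have "\<dots> = radial_weight (snd p) * (W \<bullet> W)"
      unfolding W_def using bi by (simp only: integral_mult_right_zero integral_inner_right)
    finally show ?case by (simp add: W_def power2_norm_eq_inner ball_form_def M_def)
  qed
  have bm: "ball_form \<Omega> u \<in> borel_measurable P"
  proof -
    have [measurable]: "(\<lambda>w. snd w) \<in> borel_measurable (P \<Otimes>\<^sub>M M)"
      "(\<lambda>w. u (snd w)) \<in> borel_measurable (P \<Otimes>\<^sub>M M)"
      by (rule measurable_compose[OF measurable_snd idm] measurable_compose[OF measurable_snd um])+
    have [measurable]: "(\<lambda>w. fst (fst w)) \<in> borel_measurable (P \<Otimes>\<^sub>M M)"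
      "(\<lambda>w. snd (fst w)) \<in> borel_measurable (P \<Otimes>\<^sub>M M)" "(\<lambda>p. snd p) \<in> borel_measurable P"
      unfolding P_def by measurable
    have "(\<lambda>p. \<integral>x. ball_ind x p *\<^sub>R u x \<partial>M) \<in> borel_measurable P"
      unfolding ball_ind_def by (rule M.borel_measurable_lebesgue_integral) (simp add: case_prod_beta)
    then show ?thesis unfolding ball_form_def[abs_def] M_def by measurable
  qed
  show "integrable (lborel \<Otimes>\<^sub>M lborel) (ball_form \<Omega> u)"
    using integrable_cong_AE_imp[OF R1 bm] R2 by (simp add: P_def eq_commute)
  show "enn2real lens_const * L2_inner \<Omega> (A_op \<mu> \<Omega> u) u
      = \<mu> / (4 * pi) * (\<integral>p. ball_form \<Omega> u p \<partial>(lborel \<Otimes>\<^sub>M lborel))"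
    using form integral_cong_AE[OF borel_measurable_integrable[OF R1] bm R2] by (simp add: P_def \<kappa>_def)
qed

lemma ball_form_nonneg: "0 \<le> ball_form \<Omega> u p"
  by (simp add: ball_form_def radial_weight_nonneg)

lemma enn2real_lens_const_pos: "0 < enn2real lens_const"
  using lens_const_pos lens_const_finite by (simp add: enn2real_positive_iff)

lemma A_op_nonneg:
  fixes \<Omega> :: "(real^3) set"
  assumes \<Omega>: "\<Omega> \<in> lmeasurable" and u: "u \<in> L2 \<Omega>" and \<mu>: "0 < \<mu>"
  shows "0 \<le> L2_inner \<Omega> (A_op \<mu> \<Omega> u) u"
proof -
  have "0 \<le> enn2real lens_const * L2_inner \<Omega> (A_op \<mu> \<Omega> u) u"
    unfolding A_op_quadratic_form(2)[OF \<Omega> u] using \<mu> ball_form_nonneg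
    by (intro mult_nonneg_nonneg Bochner_Integration.integral_nonneg) auto
  then show ?thesis using enn2real_lens_const_pos by (simp add: zero_le_mult_iff)
qed

text \<open>A nonnegative integrand with zero integral vanishes almost everywhere, so almost every
  ball has vanishing field integral. Around each point the small balls containing it form a
  parameter set of positive measure, hence at least one of them qualifies, which is what the Vitali
  argument asks for.\<close>

lemma A_op_pos_def:
  fixes \<Omega> :: "(real^3) set"
  assumes "open \<Omega>" "bounded \<Omega>" and u: "u \<in> L2 \<Omega>" and \<mu>: "0 < \<mu>"
    and zero: "L2_inner \<Omega> (A_op \<mu> \<Omega> u) u = 0"
  shows "AE x in lebesgue_on \<Omega>. u x = 0"
proof -
  have \<Omega>: "\<Omega> \<in> lmeasurable" using assms(1,2) by (simp add: lmeasurable_open)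
  have "(\<integral>p. ball_form \<Omega> u p \<partial>(lborel \<Otimes>\<^sub>M lborel)) = 0"
    using A_op_quadratic_form(2)[OF \<Omega> u, of \<mu>] zero \<mu> by simp
  then have "AE p in lborel \<Otimes>\<^sub>M lborel. ball_form \<Omega> u p = 0"
    using integral_nonneg_eq_0_iff_AE[OF A_op_quadratic_form(1)[OF \<Omega> u]] by (simp add: ball_form_nonneg)
  then have Z: "AE p in lborel \<Otimes>\<^sub>M lborel. 0 < snd p \<longrightarrow> (\<integral>x. ball_ind x p *\<^sub>R u x \<partial>lebesgue_on \<Omega>) = 0"
    by eventually_elim (auto simp: ball_form_def radial_weight_def)
  show ?thesis
  proof (rule AE_zero_if_ball_integrals_zero[OF assms(1,2) L2_integrable[OF \<Omega> u]])
    fix x d :: "_" assume d: "0 < (d::real)"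
    \<comment> \<open>Centres closer than \<open>d/2\<close> combined with radii above
      \<open>d/2\<close> guarantee that the ball contains \<open>x\<close>; as a product of nonempty
      open sets, \<open>S\<close> has positive measure.\<close>
    define S where "S = ball (x::real^3) (d/2) \<times> {d/2<..<d}"
    obtain N where N: "{p \<in> space (lborel \<Otimes>\<^sub>M lborel). \<not> (0 < snd p \<longrightarrow> (\<integral>x. ball_ind x p *\<^sub>R u x \<partial>lebesgue_on \<Omega>) = 0)} \<subseteq> N"
      "emeasure (lborel \<Otimes>\<^sub>M lborel) N = 0" "N \<in> sets (lborel \<Otimes>\<^sub>M lborel)"
      by (rule AE_E[OF Z])
    have "emeasure (lborel \<Otimes>\<^sub>M lborel) S = emeasure lborel (ball x (d/2)) * emeasure lborel {d/2<..<d}"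
      unfolding S_def by (rule lborel.emeasure_pair_measure_Times) auto
    also have "\<dots> > 0"
      using d emeasure_ball[of "d/2" x] by (simp flip: ennreal_mult)
    finally have "\<not> S \<subseteq> N"
      using emeasure_mono[of S N "lborel \<Otimes>\<^sub>M lborel"] N(2,3) by auto
    then obtain z r where zr: "(z, r) \<in> S" "(z, r) \<notin> N" by auto
    then have r: "0 < r" "r < d" "x \<in> cball z r" using d by (auto simp: S_def dist_commute)
    have "(\<integral>y. ball_ind y (z, r) *\<^sub>R u y \<partial>lebesgue_on \<Omega>) = 0"
    proof (rule ccontr)
      assume "\<not> ?thesis"
      then have "(z, r) \<in> N" using N(1) r(1) by (auto simp: space_pair_measure subset_iff)
      then show False using zr(2) by simp
    qed
    moreover have "ball_ind y (z, r) = indicator (cball z r) y" for y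
      by (simp add: ball_ind_def indicator_def dist_norm norm_minus_commute)
    ultimately show "\<exists>z r. 0 < r \<and> r < d \<and> x \<in> cball z r \<and> (\<integral>y. indicator (cball z r) y *\<^sub>R u y \<partial>lebesgue_on \<Omega>) = 0"
      using r by auto
  qed
qed

section \<open>Linear structure of the solenoidal fields\<close>

lemma L2_continuous:
  fixes f :: "real^3 \<Rightarrow> 'b::euclidean_space"
  assumes "open \<Omega>" "bounded \<Omega>" "continuous_on UNIV f"
  shows "f \<in> L2 \<Omega>"
proof -
  have \<Omega>: "\<Omega> \<in> lmeasurable" using assms(1,2) by (simp add: lmeasurable_open)
  interpret finite_measure "lebesgue_on \<Omega>" by (rule finite_measure_lebesgue_on[OF \<Omega>])
  have m: "f \<in> borel_measurable (lebesgue_on \<Omega>)" by (rule continuous_measurable_lebesgue_on[OF assms(3)])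
  have "compact (closure \<Omega>)" using assms(2) by simp
  then have "compact (f ` closure \<Omega>)"
    by (rule compact_continuous_image[OF continuous_on_subset[OF assms(3)], rotated]) simp
  then have "bounded (f ` closure \<Omega>)" by (rule compact_imp_bounded)
  then obtain B where B: "\<forall>y\<in>f ` closure \<Omega>. norm y \<le> B" by (auto simp: bounded_iff)
  have b: "(norm (f x))\<^sup>2 \<le> B\<^sup>2" if "x \<in> \<Omega>" for x
    using B that closure_subset by (intro power_mono) auto
  have "integrable (lebesgue_on \<Omega>) (\<lambda>x. (norm (f x))\<^sup>2)"
  proof (rule integrable_const_bound[of _ "B\<^sup>2"])
    show "(\<lambda>x. (norm (f x))\<^sup>2) \<in> borel_measurable (lebesgue_on \<Omega>)" using m by measurable
    show "AE x in lebesgue_on \<Omega>. norm ((norm (f x))\<^sup>2) \<le> B\<^sup>2" using b by (intro AE_I2) simp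
  qed
  then show ?thesis using m by (simp add: L2_def)
qed

lemma test_functions_L2:
  assumes "open \<Omega>" "bounded \<Omega>" "\<psi> \<in> test_functions \<Omega>"
  shows "\<psi> \<in> L2 \<Omega>" "grad \<psi> \<in> L2 \<Omega>"
proof -
  have C: "C_times k \<psi>" for k using assms(3) by (simp add: test_functions_def)
  show "\<psi> \<in> L2 \<Omega>" using C[of 0] by (intro L2_continuous assms) simp
  have "continuous_on UNIV (\<lambda>x. frechet_derivative \<psi> (at x) b)" if "b \<in> Basis" for b
  proof -
    have "C_times (Suc 0) (\<lambda>x. frechet_derivative \<psi> (at x) b)"
      using C[of "Suc (Suc 0)"] that unfolding C_times.simps(2) by blast
    then have "(\<lambda>x. frechet_derivative \<psi> (at x) b) differentiable (at x)" for x
      unfolding C_times.simps(2) by blast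
    then show ?thesis
      by (intro continuous_at_imp_continuous_on ballI differentiable_imp_continuous_within)
  qed
  then have "continuous_on UNIV (grad \<psi>)"
    unfolding grad_def by (intro continuous_on_vec_lambda) (simp add: axis_in_Basis_iff)
  then show "grad \<psi> \<in> L2 \<Omega>" by (intro L2_continuous assms)
qed

lemma has_weak_div_add:
  assumes \<Omega>: "open \<Omega>" "bounded \<Omega>" and "has_weak_div \<Omega> u f" "has_weak_div \<Omega> v g"
  shows "has_weak_div \<Omega> (\<lambda>x. u x + v x) (\<lambda>x. f x + g x)"
  using assms(3,4) test_functions_L2[OF \<Omega>]
  by (auto simp: has_weak_div_def L2_add L2_inner_add_left)

lemma has_weak_div_scaleR:
  assumes "has_weak_div \<Omega> v g"
  shows "has_weak_div \<Omega> (\<lambda>x. c *\<^sub>R v x) (\<lambda>x. c *\<^sub>R g x)"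
  using assms L2_scaleR[of g \<Omega> c] unfolding has_weak_div_def
  by (auto simp only: L2_scaleR L2_inner_scaleR_left mult_minus_right)

lemma HL_L2: "v \<in> HL \<Omega> \<Longrightarrow> v \<in> L2 \<Omega>"
  by (simp add: HL_def)

text \<open>The divergence inside \<open>normal_trace_zero\<close> is an existential witness that is
  not identified with zero, so the witnesses of the two fields are added.\<close>

lemma HL_add:
  assumes \<Omega>: "open \<Omega>" "bounded \<Omega>" and u: "u \<in> HL \<Omega>" and v: "v \<in> HL \<Omega>"
  shows "(\<lambda>x. u x + v x) \<in> HL \<Omega>"
proof -
  obtain f where f: "has_weak_div \<Omega> u f" "\<And>\<phi> G. has_weak_grad \<Omega> \<phi> G \<Longrightarrow> L2_inner \<Omega> u G + L2_inner \<Omega> f \<phi> = 0"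
    using u by (auto simp: HL_def normal_trace_zero_def)
  obtain g where g: "has_weak_div \<Omega> v g" "\<And>\<phi> G. has_weak_grad \<Omega> \<phi> G \<Longrightarrow> L2_inner \<Omega> v G + L2_inner \<Omega> g \<phi> = 0"
    using v by (auto simp: HL_def normal_trace_zero_def)
  have L: "u \<in> L2 \<Omega>" "v \<in> L2 \<Omega>" "f \<in> L2 \<Omega>" "g \<in> L2 \<Omega>" using f(1) g(1) by (auto simp: has_weak_div_def)
  have "L2_inner \<Omega> (\<lambda>x. u x + v x) G + L2_inner \<Omega> (\<lambda>x. f x + g x) \<phi> = 0" if "has_weak_grad \<Omega> \<phi> G" for \<phi> G
  proof -
    have "\<phi> \<in> L2 \<Omega>" "G \<in> L2 \<Omega>" using that by (auto simp: has_weak_grad_def)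
    then show ?thesis using f(2)[OF that] g(2)[OF that] L by (simp add: L2_inner_add_left)
  qed
  then have "normal_trace_zero \<Omega> (\<lambda>x. u x + v x)"
    unfolding normal_trace_zero_def using has_weak_div_add[OF \<Omega> f(1) g(1)] by blast
  moreover have "has_weak_div \<Omega> (\<lambda>x. u x + v x) (\<lambda>x. 0)"
    using has_weak_div_add[OF \<Omega>, of u "\<lambda>_. 0" v "\<lambda>_. 0"] u v by (simp add: HL_def)
  ultimately show ?thesis using L2_add[OF L(1,2)] by (simp add: HL_def)
qed

lemma HL_scaleR:
  assumes v: "v \<in> HL \<Omega>"
  shows "(\<lambda>x. c *\<^sub>R v x) \<in> HL \<Omega>"
proof -
  obtain g where g: "has_weak_div \<Omega> v g" "\<And>\<phi> G. has_weak_grad \<Omega> \<phi> G \<Longrightarrow> L2_inner \<Omega> v G + L2_inner \<Omega> g \<phi> = 0"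
    using v by (auto simp: HL_def normal_trace_zero_def)
  have "L2_inner \<Omega> (\<lambda>x. c *\<^sub>R v x) G + L2_inner \<Omega> (\<lambda>x. c *\<^sub>R g x) \<phi> = 0" if "has_weak_grad \<Omega> \<phi> G" for \<phi> G
    using g(2)[OF that] unfolding L2_inner_scaleR_left by (simp flip: distrib_left)
  then have "normal_trace_zero \<Omega> (\<lambda>x. c *\<^sub>R v x)"
    unfolding normal_trace_zero_def using has_weak_div_scaleR[OF g(1)] by blast
  moreover have "has_weak_div \<Omega> (\<lambda>x. c *\<^sub>R v x) (\<lambda>x. 0)"
    using has_weak_div_scaleR[of \<Omega> v "\<lambda>_. 0" c] v by (simp add: HL_def)
  ultimately show ?thesis using v L2_scaleR[of v \<Omega> c] by (simp add: HL_def)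
qed

lemma HL_zero: "(\<lambda>x. 0) \<in> HL \<Omega>"
proof -
  have z: "has_weak_div \<Omega> (\<lambda>x. 0) (\<lambda>x. 0)" by (simp add: has_weak_div_def L2_zero)
  moreover have "normal_trace_zero \<Omega> (\<lambda>x. 0)"
    unfolding normal_trace_zero_def by (rule exI[of _ "\<lambda>x. 0"]) (use z in simp)
  ultimately show ?thesis by (simp add: HL_def L2_zero)
qed

lemma HL_diff:
  assumes "open \<Omega>" "bounded \<Omega>" "u \<in> HL \<Omega>" "v \<in> HL \<Omega>"
  shows "(\<lambda>x. u x - v x) \<in> HL \<Omega>"
  using HL_add[OF assms(1-3) HL_scaleR[OF assms(4), of "-1"]] by simp

lemma HL_sum:
  assumes "open \<Omega>" "bounded \<Omega>" "\<And>i. i \<in> I \<Longrightarrow> v i \<in> HL \<Omega>"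
  shows "(\<lambda>x. \<Sum>i\<in>I. v i x) \<in> HL \<Omega>"
  using assms(3)
  by (induction I rule: infinite_finite_induct) (auto intro: HL_add[OF assms(1,2)] HL_zero)

section \<open>The weighted inner product \<open>W\<close> and the energy form
  \<open>B\<close>\<close>

locale weighted_domain =
  fixes \<Omega> :: "(real^3) set" and \<mu> :: real and \<eta> :: "real^3 \<Rightarrow> real"
  assumes open_\<Omega>: "open \<Omega>" and bounded_\<Omega>: "bounded \<Omega>" and \<mu>_pos: "0 < \<mu>" and \<eta>: "\<eta> \<in> Linf_plus \<Omega>"
begin

abbreviation W :: "(real^3 \<Rightarrow> real^3) \<Rightarrow> (real^3 \<Rightarrow> real^3) \<Rightarrow> real" where
  "W u v \<equiv> L2_inner \<Omega> (\<lambda>x. \<eta> x *\<^sub>R u x) v"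

abbreviation B :: "(real^3 \<Rightarrow> real^3) \<Rightarrow> (real^3 \<Rightarrow> real^3) \<Rightarrow> real" where
  "B u v \<equiv> L2_inner \<Omega> (A_op \<mu> \<Omega> u) v"

lemma lmeasurable_\<Omega>: "\<Omega> \<in> lmeasurable"
  using open_\<Omega> bounded_\<Omega> by (simp add: lmeasurable_open)

lemma \<eta>_measurable: "\<eta> \<in> borel_measurable (lebesgue_on \<Omega>)"
  using \<eta> by (simp add: Linf_plus_def)

lemma \<eta>_upper:
  obtains C where "0 \<le> C" "AE x in lebesgue_on \<Omega>. \<bar>\<eta> x\<bar> \<le> C"
proof -
  obtain C where "AE x in lebesgue_on \<Omega>. \<bar>\<eta> x\<bar> \<le> C" using \<eta> by (auto simp: Linf_plus_def)
  then have "AE x in lebesgue_on \<Omega>. \<bar>\<eta> x\<bar> \<le> \<bar>C\<bar>" by eventually_elim linarith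
  then show ?thesis using that[of "\<bar>C\<bar>"] by simp
qed

lemma \<eta>_lower:
  obtains c where "0 < c" "AE x in lebesgue_on \<Omega>. c \<le> \<eta> x"
  using \<eta> unfolding Linf_plus_def mem_Collect_eq by blast

lemma \<eta>_mult_L2:
  assumes "v \<in> L2 \<Omega>"
  shows "(\<lambda>x. \<eta> x *\<^sub>R v x) \<in> L2 \<Omega>"
proof -
  obtain C where C: "0 \<le> C" "AE x in lebesgue_on \<Omega>. \<bar>\<eta> x\<bar> \<le> C" by (rule \<eta>_upper)
  show ?thesis by (rule L2_mult_bounded(1)[OF \<eta>_measurable C(2) assms])
qed

lemma W_commute: "W u v = W v u"
  by (simp add: L2_inner_def inner_commute)

lemma W_add_left: "\<lbrakk>u \<in> L2 \<Omega>; v \<in> L2 \<Omega>; w \<in> L2 \<Omega>\<rbrakk> \<Longrightarrow> W (\<lambda>x. u x + v x) w = W u w + W v w"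
  using L2_inner_add_left[OF \<eta>_mult_L2 \<eta>_mult_L2] by (simp add: scaleR_add_right)

lemma W_diff_left: "\<lbrakk>u \<in> L2 \<Omega>; v \<in> L2 \<Omega>; w \<in> L2 \<Omega>\<rbrakk> \<Longrightarrow> W (\<lambda>x. u x - v x) w = W u w - W v w"
  using L2_inner_diff_left[OF \<eta>_mult_L2 \<eta>_mult_L2] by (simp add: scaleR_diff_right)

lemma W_scaleR_left: "W (\<lambda>x. c *\<^sub>R u x) w = c * W u w"
  by (simp add: L2_inner_def mult_ac)

lemma W_diff_right: "\<lbrakk>u \<in> L2 \<Omega>; v \<in> L2 \<Omega>; w \<in> L2 \<Omega>\<rbrakk> \<Longrightarrow> W w (\<lambda>x. u x - v x) = W w u - W w v"
  by (rule L2_inner_diff_right[OF _ _ \<eta>_mult_L2])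

lemma W_sum_right:
  assumes "\<And>i. i \<in> I \<Longrightarrow> v i \<in> L2 \<Omega>" "w \<in> L2 \<Omega>"
  shows "W w (\<lambda>x. \<Sum>i\<in>I. v i x) = (\<Sum>i\<in>I. W w (v i))"
  using L2_inner_sum_left[OF assms(1) \<eta>_mult_L2[OF assms(2)], of I]
  by (simp only: L2_inner_commute[of \<Omega> "\<lambda>x. \<eta> x *\<^sub>R w x"])

lemma W_self: "W v v = (\<integral>x. \<eta> x * (norm (v x))\<^sup>2 \<partial>lebesgue_on \<Omega>)"
  by (simp add: L2_inner_def power2_norm_eq_inner)

text \<open>With \<open>W_upper\<close> this makes the weighted norm equivalent to the
  \<open>L2\<close> norm, so that Cauchy estimates and limits can be moved between the two.\<close>

lemma W_lower:
  obtains c where "0 < c" "\<And>v. v \<in> L2 \<Omega> \<Longrightarrow> c * (L2_norm \<Omega> v)\<^sup>2 \<le> W v v"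
proof -
  obtain c where c: "0 < c" "AE x in lebesgue_on \<Omega>. c \<le> \<eta> x" by (rule \<eta>_lower)
  have "c * (L2_norm \<Omega> v)\<^sup>2 \<le> W v v" if v: "v \<in> L2 \<Omega>" for v
  proof -
    have "(\<integral>x. c * (norm (v x))\<^sup>2 \<partial>lebesgue_on \<Omega>) \<le> (\<integral>x. \<eta> x * (norm (v x))\<^sup>2 \<partial>lebesgue_on \<Omega>)"
    proof (rule integral_mono_AE)
      show "integrable (lebesgue_on \<Omega>) (\<lambda>x. \<eta> x * (norm (v x))\<^sup>2)"
        using L2_integrable_inner[OF \<eta>_mult_L2[OF v] v] by (simp add: power2_norm_eq_inner)
      show "AE x in lebesgue_on \<Omega>. c * (norm (v x))\<^sup>2 \<le> \<eta> x * (norm (v x))\<^sup>2"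
        using c(2) by eventually_elim (simp add: mult_right_mono)
    qed (use L2D(2)[OF v] in simp)
    then show ?thesis unfolding W_self power2_L2_norm L2_inner_self by simp
  qed
  then show ?thesis using that c(1) by blast
qed

lemma W_nonneg:
  assumes "v \<in> L2 \<Omega>"
  shows "0 \<le> W v v"
proof -
  obtain c where c: "0 < c" "\<And>v. v \<in> L2 \<Omega> \<Longrightarrow> c * (L2_norm \<Omega> v)\<^sup>2 \<le> W v v"
    using W_lower by blast
  have "0 \<le> c * (L2_norm \<Omega> v)\<^sup>2" using c(1) by simp
  then show ?thesis using c(2)[OF assms] by linarith
qed

lemma W_upper:
  obtains C where "0 \<le> C" "\<And>u v. \<lbrakk>u \<in> L2 \<Omega>; v \<in> L2 \<Omega>\<rbrakk> \<Longrightarrow> \<bar>W u v\<bar> \<le> C * L2_norm \<Omega> u * L2_norm \<Omega> v"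
proof -
  obtain C where C: "0 \<le> C" "AE x in lebesgue_on \<Omega>. \<bar>\<eta> x\<bar> \<le> C" by (rule \<eta>_upper)
  have "\<bar>W u v\<bar> \<le> C * L2_norm \<Omega> u * L2_norm \<Omega> v" if u: "u \<in> L2 \<Omega>" and v: "v \<in> L2 \<Omega>" for u v
  proof -
    have "\<bar>W u v\<bar> \<le> L2_norm \<Omega> (\<lambda>x. \<eta> x *\<^sub>R u x) * L2_norm \<Omega> v"
      by (rule L2_inner_cauchy_schwarz[OF \<eta>_mult_L2[OF u] v])
    also have "\<dots> \<le> C * L2_norm \<Omega> u * L2_norm \<Omega> v"
      by (intro mult_right_mono L2_mult_bounded(2)[OF \<eta>_measurable C(2) u C(1)] L2_norm_nonneg)
    finally show ?thesis .
  qed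
  then show ?thesis using that C(1) by blast
qed

lemma A_L2: "u \<in> L2 \<Omega> \<Longrightarrow> A_op \<mu> \<Omega> u \<in> L2 \<Omega>"
  by (rule A_op_L2[OF lmeasurable_\<Omega>])

lemma B_commute: "\<lbrakk>u \<in> L2 \<Omega>; v \<in> L2 \<Omega>\<rbrakk> \<Longrightarrow> B u v = B v u"
  by (rule A_op_symmetric[OF lmeasurable_\<Omega>])

lemma B_add_left: "\<lbrakk>u \<in> L2 \<Omega>; v \<in> L2 \<Omega>; w \<in> L2 \<Omega>\<rbrakk> \<Longrightarrow> B (\<lambda>x. u x + v x) w = B u w + B v w"
  by (simp add: A_op_add[OF lmeasurable_\<Omega>] L2_inner_add_left A_L2)

lemma B_scaleR_left: "B (\<lambda>x. c *\<^sub>R u x) w = c * B u w"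
  by (simp only: A_op_scaleR[OF lmeasurable_\<Omega>] L2_inner_scaleR_left)

lemma B_upper:
  obtains K where "0 \<le> K" "\<And>u v. \<lbrakk>u \<in> L2 \<Omega>; v \<in> L2 \<Omega>\<rbrakk> \<Longrightarrow> \<bar>B u v\<bar> \<le> K * L2_norm \<Omega> u * L2_norm \<Omega> v"
proof -
  obtain K where K: "0 \<le> K" "\<And>u. u \<in> L2 \<Omega> \<Longrightarrow> L2_norm \<Omega> (A_op \<mu> \<Omega> u) \<le> K * L2_norm \<Omega> u"
    using A_op_norm_le[OF lmeasurable_\<Omega>, of \<mu>] by metis
  have "\<bar>B u v\<bar> \<le> K * L2_norm \<Omega> u * L2_norm \<Omega> v" if u: "u \<in> L2 \<Omega>" and v: "v \<in> L2 \<Omega>" for u v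
    using L2_inner_cauchy_schwarz[OF A_L2[OF u] v] mult_right_mono[OF K(2)[OF u] L2_norm_nonneg[of \<Omega> v]]
    by linarith
  then show ?thesis using that K(1) by blast
qed

end

section \<open>Eigenvalue relations\<close>

locale domain_modes = weighted_domain +
  fixes \<tau> :: "nat \<Rightarrow> real" and j :: "nat \<Rightarrow> real^3 \<Rightarrow> real^3"
  assumes modes: "time_constants_modes \<mu> \<Omega> \<eta> \<tau> j"
begin

lemma W_quadratic:
  assumes u: "u \<in> L2 \<Omega>" and v: "v \<in> L2 \<Omega>"
  shows "W (\<lambda>x. u x + t *\<^sub>R v x) (\<lambda>x. u x + t *\<^sub>R v x) = W u u + 2 * t * W u v + t\<^sup>2 * W v v"
proof -
  have tv: "(\<lambda>x. t *\<^sub>R v x) \<in> L2 \<Omega>" using v by (rule L2_scaleR)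
  have s: "(\<lambda>x. u x + t *\<^sub>R v x) \<in> L2 \<Omega>" using u tv by (rule L2_add)
  have "W (\<lambda>x. u x + t *\<^sub>R v x) (\<lambda>x. u x + t *\<^sub>R v x) = W (\<lambda>x. u x + t *\<^sub>R v x) u + t * W (\<lambda>x. u x + t *\<^sub>R v x) v"
    using W_add_left[OF u tv s] W_commute[of u] W_commute[of v] by (simp only: W_scaleR_left)
  also have "\<dots> = W u u + 2 * t * W u v + t\<^sup>2 * W v v"
    unfolding W_add_left[OF u tv u] W_add_left[OF u tv v] W_scaleR_left W_commute[of v u]
    by (simp add: power2_eq_square algebra_simps)
  finally show ?thesis .
qed

lemma B_quadratic:
  assumes u: "u \<in> L2 \<Omega>" and v: "v \<in> L2 \<Omega>"
  shows "B (\<lambda>x. u x + t *\<^sub>R v x) (\<lambda>x. u x + t *\<^sub>R v x) = B u u + 2 * t * B u v + t\<^sup>2 * B v v"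
proof -
  have tv: "(\<lambda>x. t *\<^sub>R v x) \<in> L2 \<Omega>" using v by (rule L2_scaleR)
  have s: "(\<lambda>x. u x + t *\<^sub>R v x) \<in> L2 \<Omega>" using u tv by (rule L2_add)
  have "B (\<lambda>x. u x + t *\<^sub>R v x) (\<lambda>x. u x + t *\<^sub>R v x) = B (\<lambda>x. u x + t *\<^sub>R v x) u + t * B (\<lambda>x. u x + t *\<^sub>R v x) v"
    using B_add_left[OF u tv s] B_commute[OF u s] B_commute[OF v s] by (simp only: B_scaleR_left)
  also have "\<dots> = B u u + 2 * t * B u v + t\<^sup>2 * B v v"
    unfolding B_add_left[OF u tv u] B_add_left[OF u tv v] B_scaleR_left B_commute[OF v u]
    by (simp add: power2_eq_square algebra_simps)
  finally show ?thesis .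
qed

lemma HL_n_iff: "v \<in> HL_n \<Omega> \<eta> j n \<longleftrightarrow> v \<in> HL \<Omega> \<and> (\<forall>k\<in>{1..<n}. W (j k) v = 0)"
  unfolding HL_n_def mem_Collect_eq L2_inner_commute[of \<Omega> v] ..

lemma
  assumes "1 \<le> n"
  shows mode_HL_n: "j n \<in> HL_n \<Omega> \<eta> j n"
    and mode_W_self: "W (j n) (j n) = 1"
    and mode_B_self: "B (j n) (j n) = \<tau> n"
    and mode_maximal: "\<And>v. \<lbrakk>v \<in> HL_n \<Omega> \<eta> j n; weighted_norm \<Omega> \<eta> v = 1\<rbrakk> \<Longrightarrow> B v v \<le> \<tau> n"
proof -
  have "weighted_norm \<Omega> \<eta> (j n) = 1" using modes assms unfolding time_constants_modes_def by blast
  then show "W (j n) (j n) = 1" by (simp add: weighted_norm_def)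
qed (use modes assms in \<open>unfold time_constants_modes_def, blast+\<close>)

lemma mode_HL: "1 \<le> n \<Longrightarrow> j n \<in> HL \<Omega>"
  using mode_HL_n HL_n_iff by blast

lemma mode_L2: "1 \<le> n \<Longrightarrow> j n \<in> L2 \<Omega>"
  using mode_HL HL_L2 by blast

lemma mode_orthogonal:
  assumes "1 \<le> k" "1 \<le> n" "k \<noteq> n"
  shows "W (j k) (j n) = 0"
proof -
  have "W (j a) (j b) = 0" if "1 \<le> a" "a < b" for a b
  proof -
    have "j b \<in> HL_n \<Omega> \<eta> j b" using that by (intro mode_HL_n) simp
    then show ?thesis using that unfolding HL_n_iff by simp
  qed
  then show ?thesis using assms W_commute[of "j k" "j n"] by (cases "k < n") auto
qed

text \<open>Homogeneity removes the normalisation from the maximum property. In this form it can be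
  applied to perturbations of a mode and to residuals, whose norms are not 1.\<close>

lemma HL_n_rayleigh:
  assumes n: "1 \<le> n" and v: "v \<in> HL_n \<Omega> \<eta> j n"
  shows "B v v \<le> \<tau> n * W v v"
proof -
  have vH: "v \<in> HL \<Omega>" and vo: "\<And>k. k \<in> {1..<n} \<Longrightarrow> W (j k) v = 0" using v HL_n_iff by blast+
  have vL: "v \<in> L2 \<Omega>" using vH by (rule HL_L2)
  show ?thesis
  proof (cases "W v v = 0")
    \<comment> \<open>Such a field cannot be normalised, but its \<open>L2\<close> norm vanishes,
      and with it the energy.\<close>
    case True
    obtain c where c: "0 < c" "\<And>v. v \<in> L2 \<Omega> \<Longrightarrow> c * (L2_norm \<Omega> v)\<^sup>2 \<le> W v v" using W_lower by blast
    have "c * (L2_norm \<Omega> v)\<^sup>2 \<le> 0" using c(2)[OF vL] True by simp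
    then have "L2_norm \<Omega> v = 0" using c(1) by (simp add: mult_le_0_iff)
    then show ?thesis using L2_inner_cauchy_schwarz[OF A_L2[OF vL] vL] True by simp
  next
    case False
    then have pos: "0 < W v v" using W_nonneg[OF vL] by simp
    define s where "s = 1 / sqrt (W v v)"
    have s2: "s\<^sup>2 * W v v = 1" using pos by (simp add: s_def power_divide)
    have sW: "W (\<lambda>x. s *\<^sub>R v x) (\<lambda>x. s *\<^sub>R v x) = 1"
      unfolding W_scaleR_left L2_inner_scaleR_right using s2 by (simp add: power2_eq_square mult.assoc)
    have "(\<lambda>x. s *\<^sub>R v x) \<in> HL_n \<Omega> \<eta> j n"
      unfolding HL_n_iff using HL_scaleR[OF vH] vo by (simp add: L2_inner_scaleR_right)
    then have "B (\<lambda>x. s *\<^sub>R v x) (\<lambda>x. s *\<^sub>R v x) \<le> \<tau> n"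
      by (rule mode_maximal[OF n]) (simp only: weighted_norm_def sW real_sqrt_one)
    then have "s\<^sup>2 * B v v \<le> \<tau> n"
      by (simp only: B_scaleR_left L2_inner_scaleR_right power2_eq_square mult.assoc)
    then have "(s\<^sup>2 * B v v) * W v v \<le> \<tau> n * W v v" using pos by (intro mult_right_mono) auto
    moreover have "(s\<^sup>2 * B v v) * W v v = B v v" using s2 by (simp add: mult_ac)
    ultimately show ?thesis by simp
  qed
qed

text \<open>First variation at a maximizer: \<open>\<tau> n\<close> times the weighted square minus
  the energy is nonnegative along the line through \<open>j n\<close> in direction \<open>w\<close>
  and zero at \<open>j n\<close>. A nonnegative quadratic without constant term has no linear
  term.\<close>

lemma eigen_HL_n:
  assumes n: "1 \<le> n" and w: "w \<in> HL_n \<Omega> \<eta> j n"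
  shows "B (j n) w = \<tau> n * W (j n) w"
proof -
  have jn: "j n \<in> HL_n \<Omega> \<eta> j n" "j n \<in> HL \<Omega>" "j n \<in> L2 \<Omega>" using n mode_HL_n mode_HL mode_L2 by auto
  have wH: "w \<in> HL \<Omega>" and wo: "\<And>k. k \<in> {1..<n} \<Longrightarrow> W (j k) w = 0" using w HL_n_iff by blast+
  have wL: "w \<in> L2 \<Omega>" using wH by (rule HL_L2)
  define d where "d = \<tau> n * W (j n) w - B (j n) w"
  define e where "e = \<tau> n * W w w - B w w"
  \<comment> \<open>The constant term is \<open>\<tau> n * 1 - \<tau> n\<close>, by the
    normalisation of the mode and the value of the maximum.\<close>
  have quad: "0 \<le> 0 + 2 * t * d + t\<^sup>2 * e" for t
  proof -
    have tw: "(\<lambda>x. t *\<^sub>R w x) \<in> HL \<Omega>" by (rule HL_scaleR[OF wH])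
    have "W (j k) (\<lambda>x. j n x + t *\<^sub>R w x) = 0" if k: "k \<in> {1..<n}" for k
    proof -
      have "W (j k) (\<lambda>x. j n x + t *\<^sub>R w x) = W (j k) (j n) + t * W (j k) w"
        using L2_inner_add_right[OF jn(3) HL_L2[OF tw] \<eta>_mult_L2[OF mode_L2]] k
        by (simp add: L2_inner_scaleR_right)
      then show ?thesis using wo[OF k] mode_orthogonal[of k n] k by simp
    qed
    then have "(\<lambda>x. j n x + t *\<^sub>R w x) \<in> HL_n \<Omega> \<eta> j n"
      unfolding HL_n_iff using HL_add[OF open_\<Omega> bounded_\<Omega> jn(2) tw] by simp
    from HL_n_rayleigh[OF n this] show ?thesis
      unfolding W_quadratic[OF jn(3) wL] B_quadratic[OF jn(3) wL] mode_W_self[OF n] mode_B_self[OF n]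
      by (simp add: d_def e_def algebra_simps)
  qed
  have "0 \<le> e" using HL_n_rayleigh[OF n w] by (simp add: e_def)
  with quad have "d\<^sup>2 \<le> 0 * e" by (rule power2_le_mult_if_quadratic_nonneg)
  then show ?thesis by (simp add: d_def)
qed

section \<open>Projections on the modes and residuals\<close>

definition proj :: "nat \<Rightarrow> (real^3 \<Rightarrow> real^3) \<Rightarrow> real^3 \<Rightarrow> real^3" where
  "proj n v x = (\<Sum>k=1..<n. W (j k) v *\<^sub>R j k x)"

text \<open>The half-open range in \<open>proj\<close> follows the indexing of \<open>HL_n\<close>:
  only the modes below \<open>n\<close> are removed, so \<open>residual n v\<close> is admissible in
  the maximum problem of step \<open>n\<close> itself.\<close>

definition residual :: "nat \<Rightarrow> (real^3 \<Rightarrow> real^3) \<Rightarrow> real^3 \<Rightarrow> real^3" where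
  "residual n v x = v x - proj n v x"

lemma proj_HL: "proj n v \<in> HL \<Omega>"
  unfolding proj_def[abs_def] by (intro HL_sum open_\<Omega> bounded_\<Omega> HL_scaleR mode_HL) auto

lemma proj_L2: "proj n v \<in> L2 \<Omega>"
  by (rule HL_L2[OF proj_HL])

lemma residual_HL:
  assumes "v \<in> HL \<Omega>"
  shows "residual n v \<in> HL \<Omega>"
  unfolding residual_def[abs_def] by (rule HL_diff[OF open_\<Omega> bounded_\<Omega> assms proj_HL])

lemma residual_L2:
  assumes "v \<in> L2 \<Omega>"
  shows "residual n v \<in> L2 \<Omega>"
  unfolding residual_def[abs_def] by (rule L2_diff[OF assms proj_L2])

lemma mode_scaleR_L2:
  assumes "k \<in> {1..<n}"
  shows "(\<lambda>x. c *\<^sub>R j k x) \<in> L2 \<Omega>"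
  using assms by (intro L2_scaleR mode_L2) simp

lemma W_proj:
  assumes "w \<in> L2 \<Omega>"
  shows "W w (proj n v) = (\<Sum>k=1..<n. W (j k) v * W w (j k))"
proof -
  have "W w (proj n v) = (\<Sum>k=1..<n. W w (\<lambda>x. W (j k) v *\<^sub>R j k x))"
    unfolding proj_def[abs_def] by (rule W_sum_right[OF mode_scaleR_L2 assms])
  then show ?thesis by (simp only: L2_inner_scaleR_right)
qed

lemma W_residual:
  assumes "w \<in> L2 \<Omega>" "v \<in> L2 \<Omega>"
  shows "W w (residual n v) = W w v - (\<Sum>k=1..<n. W (j k) v * W w (j k))"
  unfolding residual_def[abs_def] W_diff_right[OF assms(2) proj_L2 assms(1)] W_proj[OF assms(1)] ..

lemma W_mode_residual:
  assumes "v \<in> L2 \<Omega>" "k \<in> {1..<n}"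
  shows "W (j k) (residual n v) = 0"
proof -
  have k: "1 \<le> k" using assms(2) by simp
  have "(\<Sum>i=1..<n. W (j i) v * W (j k) (j i)) = (\<Sum>i=1..<n. if i = k then W (j k) v else 0)"
    using k by (intro sum.cong) (auto simp: mode_W_self mode_orthogonal)
  also have "\<dots> = W (j k) v" using assms(2) by simp
  finally show ?thesis using W_residual[OF mode_L2[OF k] assms(1)] by simp
qed

text \<open>The later residual is orthogonal to every mode removed in the earlier one. The case
  \<open>m = n\<close> yields Bessel's inequality; the case \<open>m < n\<close> makes the residuals
  a Cauchy sequence.\<close>

lemma W_residual_residual:
  assumes v: "v \<in> L2 \<Omega>" and mn: "m \<le> n"
  shows "W (residual n v) (residual m v) = W (residual n v) v"
proof -
  have "W (residual n v) (j k) = 0" if "k \<in> {1..<m}" for k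
    using W_mode_residual[OF v, of k n] that mn W_commute[of "residual n v"] by simp
  then show ?thesis using W_residual[OF residual_L2[OF v] v] by simp
qed

lemma bessel:
  assumes v: "v \<in> L2 \<Omega>"
  shows "(\<Sum>k=1..<n. (W (j k) v)\<^sup>2) \<le> W v v"
proof -
  have "0 \<le> W (residual n v) (residual n v)" by (rule W_nonneg[OF residual_L2[OF v]])
  also have "\<dots> = W v (residual n v)"
    using W_residual_residual[OF v order_refl, of n] W_commute[of "residual n v" v] by simp
  also have "\<dots> = W v v - (\<Sum>k=1..<n. W (j k) v * W v (j k))" by (rule W_residual[OF v v])
  also have "\<dots> = W v v - (\<Sum>k=1..<n. (W (j k) v)\<^sup>2)"
    unfolding power2_eq_square using W_commute[of v "j _"] by simp
  finally show ?thesis by simp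
qed

lemma residual_HL_n:
  assumes "v \<in> HL \<Omega>"
  shows "residual n v \<in> HL_n \<Omega> \<eta> j n"
  unfolding HL_n_iff using residual_HL[OF assms] W_mode_residual[OF HL_L2[OF assms]] by blast

text \<open>The variational argument reaches only fields orthogonal to the lower modes. In the
  direction of a lower mode both sides vanish: by symmetry of \<open>B\<close>, the induction
  hypothesis for the lower mode reduces the energy to a weighted product of two distinct
  modes.\<close>

lemma eigen:
  assumes n: "1 \<le> n" and w: "w \<in> HL \<Omega>"
  shows "B (j n) w = \<tau> n * W (j n) w"
  using assms
proof (induction n arbitrary: w rule: less_induct)
  case (less n)
  have jn: "j n \<in> L2 \<Omega>" using less.prems(1) by (rule mode_L2)
  have wL: "w \<in> L2 \<Omega>" using less.prems(2) by (rule HL_L2)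
  have zero: "B (j n) (j k) = 0" "W (j n) (j k) = 0" if k: "k \<in> {1..<n}" for k
  proof -
    have k1: "1 \<le> k" "k < n" using k by auto
    show W: "W (j n) (j k) = 0" using k1 less.prems(1) by (intro mode_orthogonal) auto
    have "B (j n) (j k) = B (j k) (j n)" by (rule B_commute[OF jn mode_L2[OF k1(1)]])
    also have "\<dots> = \<tau> k * W (j k) (j n)"
      using less.IH[OF k1(2,1)] mode_HL[OF less.prems(1)] by blast
    finally show "B (j n) (j k) = 0" using W W_commute[of "j k" "j n"] by simp
  qed
  have "B (j n) (proj n w) = (\<Sum>k=1..<n. L2_inner \<Omega> (\<lambda>x. W (j k) w *\<^sub>R j k x) (A_op \<mu> \<Omega> (j n)))"
    unfolding proj_def[abs_def] L2_inner_commute[of \<Omega> "A_op \<mu> \<Omega> (j n)"]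
    by (rule L2_inner_sum_left[OF mode_scaleR_L2 A_L2[OF jn]])
  also have "\<dots> = 0"
    using zero(1) by (simp add: L2_inner_scaleR_left L2_inner_commute[of \<Omega> _ "A_op \<mu> \<Omega> (j n)"])
  finally have Bp: "B (j n) (proj n w) = 0" .
  have "B (j n) (residual n w) = B (j n) w"
    unfolding residual_def[abs_def] L2_inner_diff_right[OF wL proj_L2 A_L2[OF jn]] Bp by simp
  moreover have "W (j n) (residual n w) = W (j n) w"
    using W_residual[OF jn wL, of n] zero(2) by simp
  ultimately show ?case using eigen_HL_n[OF less.prems(1) residual_HL_n[OF less.prems(2), of n]] by simp
qed

end

section \<open>Completeness of the modes\<close>

lemma L2_norm_zero_if_AE:
  assumes "AE x in lebesgue_on \<Omega>. v x = 0"
  shows "L2_norm \<Omega> v = 0"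
proof -
  have "AE x in lebesgue_on \<Omega>. (norm (v x))\<^sup>2 = 0" using assms by eventually_elim simp
  then have "L2_inner \<Omega> v v = 0" unfolding L2_inner_self by (rule integral_eq_zero_AE)
  then show ?thesis by (simp add: L2_norm_def)
qed

context domain_modes
begin

text \<open>A mode with zero time constant would be a null vector of the energy form, hence zero
  almost everywhere, against its normalisation. Positivity is also what makes the exponential decay
  rate meaningful.\<close>

lemma \<tau>_pos:
  assumes n: "1 \<le> n"
  shows "0 < \<tau> n"
proof (rule ccontr)
  assume "\<not> 0 < \<tau> n"
  moreover have "0 \<le> \<tau> n"
    using A_op_nonneg[OF lmeasurable_\<Omega> mode_L2[OF n] \<mu>_pos] mode_B_self[OF n] by simp
  ultimately have "B (j n) (j n) = 0" using mode_B_self[OF n] by simp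
  then have "L2_norm \<Omega> (j n) = 0"
    by (intro L2_norm_zero_if_AE A_op_pos_def[OF open_\<Omega> bounded_\<Omega> mode_L2[OF n] \<mu>_pos])
  moreover obtain C where "0 \<le> C" and C: "\<And>u v. \<lbrakk>u \<in> L2 \<Omega>; v \<in> L2 \<Omega>\<rbrakk> \<Longrightarrow> \<bar>W u v\<bar> \<le> C * L2_norm \<Omega> u * L2_norm \<Omega> v"
    using W_upper by blast
  ultimately have "\<bar>W (j n) (j n)\<bar> \<le> 0" using C[OF mode_L2[OF n] mode_L2[OF n]] by simp
  then show False using mode_W_self[OF n] by simp
qed

text \<open>The kernel is square integrable, so Bessel's inequality for \<open>\<eta>\<^sup>-\<^sup>1 k(x, \<cdot>)\<close> bounds
  \<open>\<Sum>\<^sub>n \<bar>A j\<^sub>n(x)\<bar>\<^sup>2\<close> uniformly in \<open>x\<close>: this is the compactness of \<open>A\<close> in the form needed here.\<close>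

lemma A_modes_pointwise_bound:
  obtains D where "\<And>x n. (\<Sum>k=1..<n. (norm (A_op \<mu> \<Omega> (j k) x))\<^sup>2) \<le> D"
proof -
  obtain c where c: "0 < c" "AE x in lebesgue_on \<Omega>. c \<le> \<eta> x" by (rule \<eta>_lower)
  obtain C where C: "0 \<le> C" "\<And>u v. \<lbrakk>u \<in> L2 \<Omega>; v \<in> L2 \<Omega>\<rbrakk> \<Longrightarrow> \<bar>W u v\<bar> \<le> C * L2_norm \<Omega> u * L2_norm \<Omega> v"
    using W_upper by blast
  obtain K where K: "0 \<le> K" "\<And>x. (\<lambda>y. 1 / norm (x - y)) \<in> L2 \<Omega>"
    "\<And>x. L2_norm \<Omega> (\<lambda>y. 1 / norm (x - y)) \<le> K"
    using inverse_norm_kernel_L2[OF lmeasurable_\<Omega>] by blast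
  \<comment> \<open>The modes are vector fields, so the scalar kernel is paired with each coordinate
    direction separately.\<close>
  define e where "e i x = (\<lambda>y::real^3. (1 / norm (x - y)) *\<^sub>R (axis i 1 :: real^3))" for i x
  have eL: "e i x \<in> L2 \<Omega>" for i x
  proof -
    have "e i x \<in> borel_measurable (lebesgue_on \<Omega>)"
      unfolding e_def using L2D(1)[OF K(2)[of x]] by (intro borel_measurable_scaleR) auto
    then show ?thesis using L2D(2)[OF K(2)[of x]] by (simp add: L2_def e_def)
  qed
  have eN: "L2_norm \<Omega> (e i x) \<le> K" for i x
    using K(3)[of x] unfolding L2_norm_def L2_inner_self by (simp add: e_def)
  define \<theta> where "\<theta> x = 1 / \<eta> x" for x
  have \<theta>m: "\<theta> \<in> borel_measurable (lebesgue_on \<Omega>)"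
    unfolding \<theta>_def[abs_def] using \<eta>_measurable by (intro borel_measurable_divide) auto
  have \<theta>b: "AE x in lebesgue_on \<Omega>. \<bar>\<theta> x\<bar> \<le> 1 / c"
    using c(2) by eventually_elim (use c(1) in \<open>auto simp: \<theta>_def field_simps\<close>)
  \<comment> \<open>Dividing by \<eta> turns the plain integral of the kernel against a mode into a
    weighted product, where Bessel's inequality is available.\<close>
  define v where "v i x = (\<lambda>y. \<theta> y *\<^sub>R e i x y)" for i x
  have vL: "v i x \<in> L2 \<Omega>" for i x unfolding v_def by (rule L2_mult_bounded(1)[OF \<theta>m \<theta>b eL])
  have vN: "L2_norm \<Omega> (v i x) \<le> K / c" for i x
  proof -
    have "L2_norm \<Omega> (v i x) \<le> 1 / c * L2_norm \<Omega> (e i x)"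
      unfolding v_def by (rule L2_mult_bounded(2)[OF \<theta>m \<theta>b eL]) (use c(1) in simp)
    also have "\<dots> \<le> 1 / c * K" using eN c(1) by (intro mult_left_mono) auto
    finally show ?thesis by simp
  qed
  have WA: "A_op \<mu> \<Omega> (j n) x $ i = \<mu> / (4 * pi) * W (j n) (v i x)" if n: "1 \<le> n" for n x i
  proof -
    have "W (j n) (v i x) = (\<integral>y. ((1 / norm (x - y)) *\<^sub>R j n y) \<bullet> axis i 1 \<partial>lebesgue_on \<Omega>)"
      unfolding L2_inner_def
    proof (rule integral_cong_AE)
      show "(\<lambda>y. (\<eta> y *\<^sub>R j n y) \<bullet> v i x y) \<in> borel_measurable (lebesgue_on \<Omega>)"
        using L2_integrable_inner[OF \<eta>_mult_L2[OF mode_L2[OF n]] vL] by (rule borel_measurable_integrable)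
      show "(\<lambda>y. ((1 / norm (x - y)) *\<^sub>R j n y) \<bullet> axis i 1) \<in> borel_measurable (lebesgue_on \<Omega>)"
        using A_op_integrable[OF lmeasurable_\<Omega> mode_L2[OF n], of x] by (intro borel_measurable_inner) auto
      show "AE y in lebesgue_on \<Omega>. (\<eta> y *\<^sub>R j n y) \<bullet> v i x y = ((1 / norm (x - y)) *\<^sub>R j n y) \<bullet> axis i 1"
        using c(2) by eventually_elim (use c(1) in \<open>auto simp: v_def \<theta>_def e_def field_simps\<close>)
    qed
    also have "\<dots> = (\<integral>y. (1 / norm (x - y)) *\<^sub>R j n y \<partial>lebesgue_on \<Omega>) \<bullet> axis i 1"
      using A_op_integrable[OF lmeasurable_\<Omega> mode_L2[OF n], of x] by (intro integral_inner_left) 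
    finally show ?thesis by (simp add: A_op_def inner_axis)
  qed
  \<comment> \<open>Three coordinates, each bounded by the weighted square of \<open>v i x\<close>,
    with \<eta> bounded through \<open>C\<close> and the norm of \<open>v i x\<close> by
    \<open>K / c\<close>.\<close>
  define D where "D = (\<mu> / (4 * pi))\<^sup>2 * (3 * (C * (K / c) * (K / c)))"
  have "(\<Sum>k=1..<n. (norm (A_op \<mu> \<Omega> (j k) x))\<^sup>2) \<le> D" for x n
  proof -
    have "(norm (A_op \<mu> \<Omega> (j k) x))\<^sup>2 = (\<Sum>i\<in>UNIV. (\<mu> / (4 * pi))\<^sup>2 * (W (j k) (v i x))\<^sup>2)" if "k \<in> {1..<n}" for k
    proof -
      have k: "1 \<le> k" using that by simp
      have "(norm (A_op \<mu> \<Omega> (j k) x))\<^sup>2 = (\<Sum>i\<in>UNIV. (A_op \<mu> \<Omega> (j k) x $ i)\<^sup>2)"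
        by (simp add: power2_norm_eq_inner inner_vec_def flip: power2_eq_square)
      then show ?thesis by (simp only: WA[OF k] power_mult_distrib)
    qed
    then have "(\<Sum>k=1..<n. (norm (A_op \<mu> \<Omega> (j k) x))\<^sup>2)
      = (\<Sum>k=1..<n. \<Sum>i\<in>UNIV. (\<mu> / (4 * pi))\<^sup>2 * (W (j k) (v i x))\<^sup>2)"
      by (intro sum.cong) auto
    also have "\<dots> = (\<Sum>i\<in>UNIV. \<Sum>k=1..<n. (\<mu> / (4 * pi))\<^sup>2 * (W (j k) (v i x))\<^sup>2)"
      by (rule sum.swap)
    also have "\<dots> = (\<mu> / (4 * pi))\<^sup>2 * (\<Sum>i\<in>UNIV. \<Sum>k=1..<n. (W (j k) (v i x))\<^sup>2)"
      by (simp add: sum_distrib_left)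
    also have "\<dots> \<le> (\<mu> / (4 * pi))\<^sup>2 * (\<Sum>i\<in>(UNIV::3 set). C * (K / c) * (K / c))"
    proof (intro mult_left_mono sum_mono)
      fix i :: 3
      have "(\<Sum>k=1..<n. (W (j k) (v i x))\<^sup>2) \<le> W (v i x) (v i x)" by (rule bessel[OF vL])
      also have "\<dots> \<le> C * L2_norm \<Omega> (v i x) * L2_norm \<Omega> (v i x)" using C(2)[OF vL vL, of i x i x] by linarith
      also have "\<dots> \<le> C * (K / c) * (K / c)"
        using C(1) K(1) c(1) by (intro mult_mono vN mult_nonneg_nonneg L2_norm_nonneg) auto
      finally show "(\<Sum>k=1..<n. (W (j k) (v i x))\<^sup>2) \<le> C * (K / c) * (K / c)" .
    qed simp
    also have "\<dots> = D" by (simp add: D_def)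
    finally show ?thesis .
  qed
  then show ?thesis using that by blast
qed

text \<open>Integrating the pointwise bound over the finite measure of \<Omega> makes the squared
  norms of \<open>A_op \<mu> \<Omega> (j n)\<close> summable. Since \<open>\<tau> n\<close> is the
  pairing of this field with \<open>j n\<close>, and the \<open>L2\<close> norms of the modes are
  bounded through the lower bound of \<eta>, the time constants are dominated by a null
  sequence.\<close>

lemma \<tau>_tendsto_0: "(\<lambda>n. \<tau> (Suc n)) \<longlonglongrightarrow> 0"
proof -
  interpret finite_measure "lebesgue_on \<Omega>" by (rule finite_measure_lebesgue_on[OF lmeasurable_\<Omega>])
  obtain D where D: "\<And>x n. (\<Sum>k=1..<n. (norm (A_op \<mu> \<Omega> (j k) x))\<^sup>2) \<le> D"
    using A_modes_pointwise_bound by blast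
  define a where "a n = (L2_norm \<Omega> (A_op \<mu> \<Omega> (j (Suc n))))\<^sup>2" for n
  have "summable a"
  proof (rule summableI_nonneg_bounded)
    show "0 \<le> a n" for n by (simp add: a_def)
    fix n
    have i: "integrable (lebesgue_on \<Omega>) (\<lambda>x. (norm (A_op \<mu> \<Omega> (j k) x))\<^sup>2)" if "k \<in> {1..<Suc n}" for k
      using that by (intro L2D(2)[OF A_L2[OF mode_L2]]) simp
    have "sum a {..<n} = (\<Sum>k=1..<Suc n. (L2_norm \<Omega> (A_op \<mu> \<Omega> (j k)))\<^sup>2)"
      unfolding a_def One_nat_def sum.shift_bounds_Suc_ivl lessThan_atLeast0 ..
    also have "\<dots> = (\<Sum>k=1..<Suc n. \<integral>x. (norm (A_op \<mu> \<Omega> (j k) x))\<^sup>2 \<partial>lebesgue_on \<Omega>)"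
      by (simp only: power2_L2_norm L2_inner_self)
    also have "\<dots> = (\<integral>x. (\<Sum>k=1..<Suc n. (norm (A_op \<mu> \<Omega> (j k) x))\<^sup>2) \<partial>lebesgue_on \<Omega>)"
      by (rule Bochner_Integration.integral_sum[symmetric]) (rule i)
    also have "\<dots> \<le> (\<integral>x. D \<partial>lebesgue_on \<Omega>)"
      by (rule integral_mono[OF Bochner_Integration.integrable_sum[OF i] integrable_const D])
    finally show "sum a {..<n} \<le> (\<integral>x. D \<partial>lebesgue_on \<Omega>)" .
  qed
  then have a0: "a \<longlonglongrightarrow> 0" by (rule summable_LIMSEQ_zero)
  obtain c where c: "0 < c" "\<And>v. v \<in> L2 \<Omega> \<Longrightarrow> c * (L2_norm \<Omega> v)\<^sup>2 \<le> W v v" using W_lower by blast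
  have le: "(\<tau> (Suc n))\<^sup>2 \<le> a n * (1 / c)" for n
  proof -
    have L: "j (Suc n) \<in> L2 \<Omega>" by (rule mode_L2) simp
    have "(L2_norm \<Omega> (j (Suc n)))\<^sup>2 \<le> 1 / c"
      using c(2)[OF L] mode_W_self[of "Suc n"] c(1) by (simp add: field_simps)
    then have "a n * (L2_norm \<Omega> (j (Suc n)))\<^sup>2 \<le> a n * (1 / c)" by (intro mult_left_mono) (auto simp: a_def)
    moreover have "\<bar>\<tau> (Suc n)\<bar> \<le> L2_norm \<Omega> (A_op \<mu> \<Omega> (j (Suc n))) * L2_norm \<Omega> (j (Suc n))"
      using L2_inner_cauchy_schwarz[OF A_L2[OF L] L] mode_B_self[of "Suc n"] by simp
    then have "\<bar>\<tau> (Suc n)\<bar>\<^sup>2 \<le> (L2_norm \<Omega> (A_op \<mu> \<Omega> (j (Suc n))) * L2_norm \<Omega> (j (Suc n)))\<^sup>2"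
      by (intro power_mono) auto
    ultimately show ?thesis by (simp add: a_def power_mult_distrib)
  qed
  have "(\<lambda>n. (\<tau> (Suc n))\<^sup>2) \<longlonglongrightarrow> 0"
  proof (rule tendsto_sandwich[of "\<lambda>_. 0" _ _ "\<lambda>n. a n * (1 / c)"])
    show "(\<lambda>n. a n * (1 / c)) \<longlonglongrightarrow> 0" by (rule tendsto_mult_left_zero[OF a0])
  qed (use le in auto)
  then show ?thesis by (simp only: power_tendsto_0_iff zero_less_numeral)
qed

text \<open>Decay of the energy \<open>B\<close> of the residuals does not by itself control their
  norm, because \<open>B\<close> is not coercive. Strong convergence of the residuals has to be
  established independently, by monotonicity of their weighted norms; the decay of \<open>B\<close>
  then only identifies the limit.\<close>

lemma residual_energy_tendsto_0:
  assumes v: "v \<in> HL \<Omega>"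
  shows "(\<lambda>n. W (residual (Suc n) v) (residual (Suc n) v)) \<longlonglongrightarrow> 0"
proof -
  have vL: "v \<in> L2 \<Omega>" using v by (rule HL_L2)
  define r where "r n = residual (Suc n) v" for n
  define E where "E n = W (r n) (r n)" for n
  have rL: "r n \<in> L2 \<Omega>" for n unfolding r_def by (rule residual_L2[OF vL])
  \<comment> \<open>Pythagoras for nested projections: the distance of two residuals is a difference
    of terms of one decreasing bounded sequence, hence small.\<close>
  have diff: "W (\<lambda>x. r m x - r n x) (\<lambda>x. r m x - r n x) = E m - E n" if "m \<le> n" for m n
  proof -
    have "W (r n) (r m) = E n"
      using W_residual_residual[OF vL, of "Suc m" "Suc n"] W_residual_residual[OF vL, of "Suc n" "Suc n"] that
      by (simp add: r_def E_def)
    then show ?thesis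
      using rL L2_diff[OF rL rL] W_commute[of "r m" "r n"]
      by (simp add: W_diff_left W_diff_right E_def)
  qed
  have E0: "0 \<le> E n" for n unfolding E_def by (rule W_nonneg[OF rL])
  have dec: "decseq E"
  proof (rule decseq_SucI)
    fix n show "E (Suc n) \<le> E n" using diff[of n "Suc n"] W_nonneg[OF L2_diff[OF rL rL], of n "Suc n"] by simp
  qed
  obtain L where "E \<longlonglongrightarrow> L" "\<forall>i. L \<le> E i"
    using decseq_convergent[OF dec, of 0] E0 by blast
  then have Econv: "convergent E" by (auto simp: convergent_def)
  obtain c where c: "0 < c" "\<And>v. v \<in> L2 \<Omega> \<Longrightarrow> c * (L2_norm \<Omega> v)\<^sup>2 \<le> W v v" using W_lower by blast
  obtain C where C: "0 \<le> C" "\<And>u v. \<lbrakk>u \<in> L2 \<Omega>; v \<in> L2 \<Omega>\<rbrakk> \<Longrightarrow> \<bar>W u v\<bar> \<le> C * L2_norm \<Omega> u * L2_norm \<Omega> v"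
    using W_upper by blast
  obtain K where K: "0 \<le> K" "\<And>u v. \<lbrakk>u \<in> L2 \<Omega>; v \<in> L2 \<Omega>\<rbrakk> \<Longrightarrow> \<bar>B u v\<bar> \<le> K * L2_norm \<Omega> u * L2_norm \<Omega> v"
    using B_upper by blast
  have cauchy: "\<exists>N. \<forall>m\<ge>N. \<forall>n\<ge>N. L2_norm \<Omega> (\<lambda>x. r m x - r n x) \<le> e" if e: "e > 0" for e
  proof -
    have "c * e\<^sup>2 > 0" using e c(1) by simp
    then obtain N where N: "\<And>m n. \<lbrakk>m \<ge> N; n \<ge> N\<rbrakk> \<Longrightarrow> \<bar>E m - E n\<bar> < c * e\<^sup>2"
      using CauchyD[OF convergent_Cauchy[OF Econv]] by (metis real_norm_def)
    have *: "L2_norm \<Omega> (\<lambda>x. r m x - r n x) \<le> e" if "m \<ge> N" "n \<ge> N" "m \<le> n" for m n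
    proof -
      have "c * (L2_norm \<Omega> (\<lambda>x. r m x - r n x))\<^sup>2 \<le> c * e\<^sup>2"
        using c(2)[OF L2_diff[OF rL rL], of m n] diff[OF that(3)] N[OF that(1,2)] by simp
      then show ?thesis using c(1) e by (auto intro: power2_le_imp_le)
    qed
    have "L2_norm \<Omega> (\<lambda>x. r m x - r n x) \<le> e" if "m \<ge> N" "n \<ge> N" for m n
    proof (cases "m \<le> n")
      case True
      then show ?thesis by (rule *[OF that])
    next
      case False
      then show ?thesis using *[OF that(2,1)] by (subst L2_norm_minus_commute) simp
    qed
    then show ?thesis by blast
  qed
  obtain w where w: "w \<in> L2 \<Omega>" "(\<lambda>n. L2_norm \<Omega> (\<lambda>x. r n x - w x)) \<longlonglongrightarrow> 0"
    using L2_complete[of \<Omega> r, OF finite_measure_lebesgue_on[OF lmeasurable_\<Omega>] rL cauchy] by blast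
  have Bw: "(\<lambda>n. B (r n) (r n)) \<longlonglongrightarrow> B w w"
  proof (rule LIM_zero_cancel, rule tendsto_rabs_zero_cancel)
    let ?d = "\<lambda>n. L2_norm \<Omega> (\<lambda>x. r n x - w x)"
    \<comment> \<open>From expanding the form at \<open>w\<close> plus the error and bounding the
      linear and the quadratic term by continuity of \<open>B\<close>.\<close>
    let ?b = "\<lambda>n. 2 * (K * L2_norm \<Omega> w * ?d n) + K * ?d n * ?d n"
    have lower: "\<forall>\<^sub>F n in sequentially. 0 \<le> \<bar>B (r n) (r n) - B w w\<bar>" by simp
    have lim: "?b \<longlonglongrightarrow> 0"
      by (rule tendsto_eq_intros w(2) refl)+ simp
    have "\<forall>\<^sub>F n in sequentially. \<bar>B (r n) (r n) - B w w\<bar> \<le> 2 * (K * L2_norm \<Omega> w * ?d n) + K * ?d n * ?d n"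
    proof (intro always_eventually allI)
      fix n
      have dL: "(\<lambda>x. r n x - w x) \<in> L2 \<Omega>" by (rule L2_diff[OF rL w(1)])
      have "B (r n) (r n) = B w w + 2 * B w (\<lambda>x. r n x - w x) + B (\<lambda>x. r n x - w x) (\<lambda>x. r n x - w x)"
        using B_quadratic[OF w(1) dL, of 1] by simp
      then show "\<bar>B (r n) (r n) - B w w\<bar> \<le> 2 * (K * L2_norm \<Omega> w * ?d n) + K * ?d n * ?d n"
        using K(2)[OF w(1) dL] K(2)[OF dL dL] by linarith
    qed
    then show "(\<lambda>n. \<bar>B (r n) (r n) - B w w\<bar>) \<longlonglongrightarrow> 0"
      by (rule tendsto_sandwich[OF lower _ tendsto_const lim])
  qed
  have "(\<lambda>n. \<tau> (Suc n) * W v v) \<longlonglongrightarrow> 0" by (rule tendsto_mult_left_zero[OF \<tau>_tendsto_0])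
  moreover have "B (r n) (r n) \<le> \<tau> (Suc n) * W v v" for n
  proof -
    have "B (r n) (r n) \<le> \<tau> (Suc n) * E n"
      unfolding r_def E_def by (rule HL_n_rayleigh[OF _ residual_HL_n[OF v]]) simp
    also have "E n \<le> W v v"
    proof -
      have "residual 1 v = v" by (simp add: residual_def[abs_def] proj_def)
      then have "E 0 = W v v" by (simp add: E_def r_def)
      then show ?thesis using decseqD[OF dec, of 0 n] by simp
    qed
    finally show ?thesis using \<tau>_pos[of "Suc n"] by (simp add: mult_left_mono)
  qed
  ultimately have "B w w \<le> 0" using Bw by (meson LIMSEQ_le)
  then have "B w w = 0" using A_op_nonneg[OF lmeasurable_\<Omega> w(1) \<mu>_pos] by simp
  then have w0: "AE x in lebesgue_on \<Omega>. w x = 0" by (rule A_op_pos_def[OF open_\<Omega> bounded_\<Omega> w(1) \<mu>_pos])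
  then have "L2_norm \<Omega> w = 0" by (rule L2_norm_zero_if_AE)
  \<comment> \<open>The limit vanishes almost everywhere but need not be the zero function, hence
    the triangle inequality instead of a substitution.\<close>
  then have rn: "L2_norm \<Omega> (r n) \<le> L2_norm \<Omega> (\<lambda>x. r n x - w x)" for n
    using L2_norm_triangle[OF L2_diff[OF rL w(1)] w(1), of n] by simp
  let ?b = "\<lambda>n. C * L2_norm \<Omega> (\<lambda>x. r n x - w x) * L2_norm \<Omega> (\<lambda>x. r n x - w x)"
  have "E n \<le> ?b n" for n
  proof -
    have "E n \<le> C * L2_norm \<Omega> (r n) * L2_norm \<Omega> (r n)" using C(2)[OF rL rL, of n n] by (simp add: E_def)
    also have "\<dots> \<le> ?b n"
      by (intro mult_mono rn C(1) mult_nonneg_nonneg L2_norm_nonneg order_refl)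
    finally show ?thesis .
  qed
  then have upper: "\<forall>\<^sub>F n in sequentially. E n \<le> ?b n" by (intro always_eventually allI)
  have lower: "\<forall>\<^sub>F n in sequentially. 0 \<le> E n" using E0 by (intro always_eventually allI)
  have lim: "?b \<longlonglongrightarrow> 0"
    by (rule tendsto_eq_intros w(2) refl)+ simp
  have "E \<longlonglongrightarrow> 0" by (rule tendsto_sandwich[OF lower upper tendsto_const lim])
  then show ?thesis by (simp add: E_def[abs_def] r_def)
qed

end

section \<open>Measurability in time and convergence\<close>

lemma AE_lebesgue_on_greaterThan_0:
  assumes "\<And>T::real. 0 < T \<Longrightarrow> AE t in lebesgue_on {0<..<T}. P t"
  shows "AE t in lebesgue_on {0<..}. P t"
proof -
  have "AE t in lebesgue_on {0<..<real (Suc n)}. P t" for n by (rule assms) simp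
  then have "AE t in lebesgue. \<forall>n. t \<in> {0<..<real (Suc n)} \<longrightarrow> P t"
    by (subst AE_all_countable) (simp add: AE_restrict_space_iff)
  then have "AE t in lebesgue. t \<in> {0<..} \<longrightarrow> P t"
  proof eventually_elim
    case (elim t)
    obtain n where "t < real n" using reals_Archimedean2 by blast
    then have "t < real (Suc n)" by simp
    then show ?case using elim by (meson greaterThanLessThan_iff greaterThan_iff)
  qed
  then show ?thesis by (simp add: AE_restrict_space_iff)
qed

lemma AE_lebesgue_on_subset:
  assumes "AE t in lebesgue_on S. P t" "S \<in> sets lebesgue" "T \<in> sets lebesgue" "T \<subseteq> S"
  shows "AE t in lebesgue_on T. P t"
proof -
  have "AE t in lebesgue. t \<in> S \<longrightarrow> P t" using assms(1,2) by (simp add: AE_restrict_space_iff)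
  then have "AE t in lebesgue. t \<in> T \<longrightarrow> P t" by eventually_elim (use assms(4) in blast)
  then show ?thesis using assms(3) by (simp add: AE_restrict_space_iff)
qed

text \<open>The easy half of Pettis' theorem: pairings of the simple approximants with
  \<open>w\<close> are simple real functions and converge by Cauchy-Schwarz.\<close>

lemma strongly_measurable_L2_inner:
  assumes u: "strongly_measurable_HL \<Omega> T u" "AE t in lebesgue_on {0<..<T}. u t \<in> HL \<Omega>"
    and w: "w \<in> L2 \<Omega>"
  shows "(\<lambda>t. L2_inner \<Omega> (u t) w) \<in> borel_measurable (lebesgue_on {0<..<T})"
proof -
  obtain s where s: "\<And>k. simple_function (lebesgue_on {0<..<T}) (s k)" "\<And>k. s k ` {0<..<T} \<subseteq> HL \<Omega>"
    "AE t in lebesgue_on {0<..<T}. (\<lambda>k::nat. L2_norm \<Omega> (\<lambda>x. s k t x - u t x)) \<longlonglongrightarrow> 0"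
    using u(1) unfolding strongly_measurable_HL_def by blast
  show ?thesis
  proof (rule borel_measurable_lebesgue_on_AE_LIMSEQ[of _ "\<lambda>k t. L2_inner \<Omega> (s k t) w"])
    show "(\<lambda>t. L2_inner \<Omega> (s k t) w) \<in> borel_measurable (lebesgue_on {0<..<T})" for k
      by (rule borel_measurable_simple_function[OF simple_function_compose1[OF s(1)]])
    show "AE t in lebesgue_on {0<..<T}. (\<lambda>k. L2_inner \<Omega> (s k t) w) \<longlonglongrightarrow> L2_inner \<Omega> (u t) w"
      using s(3) u(2) AE_space
    proof eventually_elim
      case (elim t)
      have uL: "u t \<in> L2 \<Omega>" using elim(2) by (rule HL_L2)
      have sL: "s k t \<in> L2 \<Omega>" for k using elim(3) s(2)[of k] by (intro HL_L2) auto
      have le: "norm (L2_inner \<Omega> (s k t) w - L2_inner \<Omega> (u t) w) \<le> L2_norm \<Omega> (\<lambda>x. s k t x - u t x) * L2_norm \<Omega> w" for k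
        using L2_inner_cauchy_schwarz[OF L2_diff[OF sL uL] w] L2_inner_diff_left[OF sL uL w] by simp
      have "(\<lambda>k. L2_norm \<Omega> (\<lambda>x. s k t x - u t x) * L2_norm \<Omega> w) \<longlonglongrightarrow> 0"
        by (rule tendsto_mult_left_zero[OF elim(1)])
      then have "(\<lambda>k. L2_inner \<Omega> (s k t) w - L2_inner \<Omega> (u t) w) \<longlonglongrightarrow> 0"
        by (rule Lim_null_comparison[OF always_eventually, rotated]) (use le in blast)
      then show ?case by (rule LIM_zero_cancel)
    qed
  qed simp
qed

text \<open>Strong measurability asks for simple approximants with values in \<open>HL\<close>. They
  are obtained by approximating time and not the values: evaluating the sum at simple functions that
  tend to the identity stays in \<open>HL\<close>, and continuity of the coefficients gives
  convergence.\<close>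

lemma continuous_sum_in_L2_HL:
  assumes \<Omega>: "open \<Omega>" "bounded \<Omega>" and I: "finite I" and e: "\<And>n. n \<in> I \<Longrightarrow> e n \<in> HL \<Omega>"
    and a: "\<And>n. n \<in> I \<Longrightarrow> continuous_on UNIV (a n)"
  shows "(\<lambda>t x. \<Sum>n\<in>I. a n t *\<^sub>R e n x) \<in> L2_HL \<Omega> T"
proof -
  define U where "U t x = (\<Sum>n\<in>I. a n t *\<^sub>R e n x)" for t x
  have UH: "U t \<in> HL \<Omega>" for t
    unfolding U_def[abs_def] by (intro HL_sum \<Omega> HL_scaleR e)
  have eL: "n \<in> I \<Longrightarrow> e n \<in> L2 \<Omega>" for n using e HL_L2 by blast
  have diff: "L2_norm \<Omega> (\<lambda>x. \<Sum>n\<in>A. c n *\<^sub>R e n x) \<le> (\<Sum>n\<in>A. \<bar>c n\<bar> * L2_norm \<Omega> (e n))"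
    if "A \<subseteq> I" for A c
    using finite_subset[OF that I] that
  proof (induction A rule: finite_induct)
    case empty
    then show ?case by (simp add: L2_norm_def)
  next
    case (insert n A)
    have "L2_norm \<Omega> (\<lambda>x. c n *\<^sub>R e n x + (\<Sum>n\<in>A. c n *\<^sub>R e n x))
      \<le> L2_norm \<Omega> (\<lambda>x. c n *\<^sub>R e n x) + L2_norm \<Omega> (\<lambda>x. \<Sum>n\<in>A. c n *\<^sub>R e n x)"
      using insert.prems by (intro L2_norm_triangle L2_sum L2_scaleR eL) auto
    then show ?case using insert by (simp add: L2_norm_scaleR)
  qed
  have Udiff: "L2_norm \<Omega> (\<lambda>x. U s x - U t x) \<le> (\<Sum>n\<in>I. \<bar>a n s - a n t\<bar> * L2_norm \<Omega> (e n))" for s t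
  proof -
    have "(\<lambda>x. U s x - U t x) = (\<lambda>x. \<Sum>n\<in>I. (a n s - a n t) *\<^sub>R e n x)"
      by (simp add: U_def sum_subtractf scaleR_diff_left)
    then show ?thesis using diff[OF order_refl, of "\<lambda>n. a n s - a n t"] by simp
  qed
  have "strongly_measurable_HL \<Omega> T U"
  proof -
    have "(\<lambda>t::real. t) \<in> borel_measurable (lebesgue_on {0<..<T})" by (rule borel_measurable_ident_lebesgue_on)
    from borel_measurable_implies_sequence_metric[OF this, of 0]
    obtain d where "\<forall>k. simple_function (lebesgue_on {0<..<T}) (d k)" "\<forall>t\<in>{0<..<T}. (\<lambda>k. d k t) \<longlonglongrightarrow> t"
      by auto
    then have d: "simple_function (lebesgue_on {0<..<T}) (d k)" "t \<in> {0<..<T} \<Longrightarrow> (\<lambda>k. d k t) \<longlonglongrightarrow> t" for k t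
      by blast+
    have "(\<lambda>k. L2_norm \<Omega> (\<lambda>x. U (d k t) x - U t x)) \<longlonglongrightarrow> 0" if t: "t \<in> {0<..<T}" for t
    proof (rule Lim_null_comparison)
      show "\<forall>\<^sub>F k in sequentially. norm (L2_norm \<Omega> (\<lambda>x. U (d k t) x - U t x)) \<le> (\<Sum>n\<in>I. \<bar>a n (d k t) - a n t\<bar> * L2_norm \<Omega> (e n))"
        using Udiff by (simp add: L2_norm_nonneg)
      have "(\<lambda>k. \<Sum>n\<in>I. \<bar>a n (d k t) - a n t\<bar> * L2_norm \<Omega> (e n)) \<longlonglongrightarrow> (\<Sum>n\<in>I. 0)"
      proof (rule tendsto_sum)
        fix n assume n: "n \<in> I"
        have "isCont (a n) t" using a[OF n] by (simp add: continuous_on_eq_continuous_at)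
        then have "(\<lambda>k. a n (d k t)) \<longlonglongrightarrow> a n t" by (rule isCont_tendsto_compose[OF _ d(2)[OF t]])
        then show "(\<lambda>k. \<bar>a n (d k t) - a n t\<bar> * L2_norm \<Omega> (e n)) \<longlonglongrightarrow> 0"
          by (intro tendsto_mult_left_zero tendsto_rabs_zero LIM_zero)
      qed
      then show "(\<lambda>k. \<Sum>n\<in>I. \<bar>a n (d k t) - a n t\<bar> * L2_norm \<Omega> (e n)) \<longlonglongrightarrow> 0" by simp
    qed
    then show ?thesis
      unfolding strongly_measurable_HL_def using UH simple_function_compose1[OF d(1), of U]
      by (intro exI[of _ "\<lambda>k t. U (d k t)"]) (auto intro!: AE_I2)
  qed
  moreover have "integrable (lebesgue_on {0<..<T}) (\<lambda>t. (L2_norm \<Omega> (U t))\<^sup>2)"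
  proof -
    \<comment> \<open>The Gram matrix of the fields expresses the squared norm as a polynomial in
      the coefficients, so it is continuous in time and integrable up to the end points.\<close>
    have eq: "(L2_norm \<Omega> (U t))\<^sup>2 = (\<Sum>n\<in>I. a n t * (\<Sum>m\<in>I. a m t * L2_inner \<Omega> (e m) (e n)))" for t
    proof -
      have sL: "\<And>n. n \<in> I \<Longrightarrow> (\<lambda>x. a n t *\<^sub>R e n x) \<in> L2 \<Omega>" using eL L2_scaleR by blast
      have "L2_inner \<Omega> (U t) (U t) = (\<Sum>n\<in>I. L2_inner \<Omega> (\<lambda>x. a n t *\<^sub>R e n x) (U t))"
        unfolding U_def[abs_def] by (rule L2_inner_sum_left[OF sL L2_sum[OF sL]])
      also have "\<dots> = (\<Sum>n\<in>I. a n t * (\<Sum>m\<in>I. a m t * L2_inner \<Omega> (e m) (e n)))"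
      proof (rule sum.cong[OF refl])
        fix n assume n: "n \<in> I"
        have "L2_inner \<Omega> (U t) (e n) = (\<Sum>m\<in>I. L2_inner \<Omega> (\<lambda>x. a m t *\<^sub>R e m x) (e n))"
          unfolding U_def[abs_def] by (rule L2_inner_sum_left[OF sL eL[OF n]])
        then show "L2_inner \<Omega> (\<lambda>x. a n t *\<^sub>R e n x) (U t) = a n t * (\<Sum>m\<in>I. a m t * L2_inner \<Omega> (e m) (e n))"
          by (simp only: L2_inner_scaleR_left L2_inner_commute[of \<Omega> "e n" "U t"])
      qed
      finally show ?thesis by (simp add: power2_L2_norm)
    qed
    have "continuous_on UNIV (\<lambda>t. (L2_norm \<Omega> (U t))\<^sup>2)"
      unfolding eq using a by (intro continuous_intros) auto
    then have c: "continuous_on {0..T} (\<lambda>t. (L2_norm \<Omega> (U t))\<^sup>2)" by (rule continuous_on_subset) simp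
    have "set_integrable lebesgue {0..T} (\<lambda>t. (L2_norm \<Omega> (U t))\<^sup>2)"
      using continuous_imp_integrable_real[OF c] by (simp add: set_integrable_def integrable_restrict_space)
    then have "set_integrable lebesgue {0<..<T} (\<lambda>t. (L2_norm \<Omega> (U t))\<^sup>2)"
      by (rule set_integrable_subset) auto
    then show ?thesis by (simp add: set_integrable_def integrable_restrict_space)
  qed
  ultimately have "U \<in> L2_HL \<Omega> T" using UH by (simp add: L2_HL_def)
  then show ?thesis by (simp add: U_def[abs_def])
qed

section \<open>Coefficients of a source-free current and convergence of the series\<close>

context domain_modes
begin

lemma W_current_measurable:
  assumes J: "J \<in> L2_HL \<Omega> T" and n: "1 \<le> n"
  shows "(\<lambda>t. W (j n) (J t)) \<in> borel_measurable (lebesgue_on {0<..<T})"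
  using strongly_measurable_L2_inner[of \<Omega> T J "\<lambda>x. \<eta> x *\<^sub>R j n x"] J \<eta>_mult_L2[OF mode_L2[OF n]]
  unfolding L2_HL_def by (simp add: L2_inner_commute[of \<Omega> "J _"])

lemma W_current_integrable:
  assumes J: "J \<in> L2_HL \<Omega> T" and n: "1 \<le> n"
  shows "integrable (lebesgue_on {0<..<T}) (\<lambda>t. W (j n) (J t))"
proof (rule Bochner_Integration.integrable_bound)
  define a where "a = L2_norm \<Omega> (\<lambda>x. \<eta> x *\<^sub>R j n x)"
  interpret finite_measure "lebesgue_on {0<..<T}" by (rule finite_measure_lebesgue_on) simp
  \<comment> \<open>Only the square of the norm is known to be integrable; y \<le> 1 + y^2 reduces
    the first power to it on a bounded interval.\<close>
  show "integrable (lebesgue_on {0<..<T}) (\<lambda>t. a * (1 + (L2_norm \<Omega> (J t))\<^sup>2))"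
    using J by (auto simp: L2_HL_def)
  have "AE t in lebesgue_on {0<..<T}. J t \<in> HL \<Omega>" using J by (simp add: L2_HL_def)
  then show "AE t in lebesgue_on {0<..<T}. norm (W (j n) (J t)) \<le> norm (a * (1 + (L2_norm \<Omega> (J t))\<^sup>2))"
  proof eventually_elim
    case (elim t)
    have "norm (W (j n) (J t)) \<le> a * L2_norm \<Omega> (J t)"
      using L2_inner_cauchy_schwarz[OF \<eta>_mult_L2[OF mode_L2[OF n]] HL_L2[OF elim]] by (simp add: a_def)
    also have "\<dots> \<le> a * (1 + (L2_norm \<Omega> (J t))\<^sup>2)"
    proof (rule mult_left_mono)
      show "L2_norm \<Omega> (J t) \<le> 1 + (L2_norm \<Omega> (J t))\<^sup>2"
        using sum_squares_bound[of "L2_norm \<Omega> (J t)" 1] L2_norm_nonneg[of \<Omega> "J t"] by simp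
    qed (simp add: a_def L2_norm_nonneg)
    finally show ?case by simp
  qed
qed (rule W_current_measurable[OF assms])

text \<open>The identity is proved on the whole half-line at once, so that the constant does not
  depend on an end time.\<close>

lemma mode_coefficient_decay:
  assumes J: "source_free_current \<mu> \<Omega> \<eta> J" and n: "1 \<le> n"
  shows "\<exists>c. AE t in lebesgue_on {0<..}. W (j n) (J t) = c * exp (- t / \<tau> n)"
proof -
  have JT: "0 < T \<Longrightarrow> J \<in> L2_HL \<Omega> T" for T using J by (simp add: source_free_current_def)
  have JH: "AE t in lebesgue_on {0<..}. J t \<in> HL \<Omega>"
    by (rule AE_lebesgue_on_greaterThan_0) (use JT in \<open>auto simp: L2_HL_def\<close>)
  have i: "integrable (lebesgue_on {0<..<T}) (\<lambda>t. W (j n) (J t))" for T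
  proof (cases "0 < T")
    case True
    then show ?thesis by (intro W_current_integrable JT n)
  next
    case False
    then have "{0<..<T} = {}" by auto
    then show ?thesis by simp
  qed
  have F: "AE t in lebesgue_on {0<..}. B (J t) (j n) = \<tau> n * W (j n) (J t)"
    using JH
  proof eventually_elim
    case (elim t)
    show ?case using B_commute[OF HL_L2[OF elim] mode_L2[OF n]] eigen[OF n elim] by simp
  qed
  have "has_distr_deriv {0<..} (\<lambda>t. B (J t) (j n)) (\<lambda>t. - W (J t) (j n))"
    using J mode_HL[OF n] unfolding source_free_current_def by blast
  then have "has_distr_deriv {0<..} (\<lambda>t. B (J t) (j n)) (\<lambda>t. - W (j n) (J t))"
    by (simp only: W_commute[of "J _" "j n"])
  then show ?thesis by (rule distr_deriv_exponential_decay[OF \<tau>_pos[OF n] i F])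
qed

text \<open>Up to a null set of times, the error of the partial sum is a residual of
  \<open>J t\<close>, whose weighted energy \<open>E N t\<close> tends to zero and is dominated by a
  multiple of the squared norm of \<open>J t\<close>. The delicate point is the measurability of
  \<open>E N\<close> in time.\<close>

lemma partial_sums_converge:
  assumes JL: "J \<in> L2_HL \<Omega> T"
    and dec: "\<And>n. 1 \<le> n \<Longrightarrow> AE t in lebesgue_on {0<..<T}. W (j n) (J t) = c n * exp (- t / \<tau> n)"
  shows "converges_in_L2_HL \<Omega> T (\<lambda>N t x. \<Sum>n=1..N. (c n * exp (- t / \<tau> n)) *\<^sub>R j n x) J"
proof -
  define M where "M = lebesgue_on {0<..<T}"
  define U where "U N t x = (\<Sum>n=1..N. (c n * exp (- t / \<tau> n)) *\<^sub>R j n x)" for N t x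
  define E where "E N t = W (residual (Suc N) (J t)) (residual (Suc N) (J t))" for N t
  have JH: "AE t in M. J t \<in> HL \<Omega>" and Ji: "integrable M (\<lambda>t. (L2_norm \<Omega> (J t))\<^sup>2)"
    using JL unfolding L2_HL_def M_def by simp_all
  \<comment> \<open>There are countably many coefficients, so a single null set of times serves all
    of them and the partial sums become projections for every \<open>N\<close> at once.\<close>
  have "AE t in M. \<forall>n. 1 \<le> n \<longrightarrow> W (j n) (J t) = c n * exp (- t / \<tau> n)"
    unfolding AE_all_countable
  proof
    fix n show "AE t in M. 1 \<le> n \<longrightarrow> W (j n) (J t) = c n * exp (- t / \<tau> n)"
      using dec[of n] unfolding M_def by (cases "1 \<le> n") auto
  qed
  then have res: "AE t in M. \<forall>N. (\<lambda>x. J t x - U N t x) = residual (Suc N) (J t)"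
  proof eventually_elim
    case (elim t)
    show ?case
    proof (intro allI ext)
      fix N x
      \<comment> \<open>A sum up to \<open>N\<close> inclusive corresponds to the index
        \<open>Suc N\<close>, because \<open>proj\<close> sums over a half-open range.\<close>
      have "U N t x = proj (Suc N) (J t) x"
        unfolding U_def proj_def atLeastLessThanSuc_atLeastAtMost by (intro sum.cong) (use elim in auto)
      then show "J t x - U N t x = residual (Suc N) (J t) x" by (simp add: residual_def)
    qed
  qed
  obtain a where a: "0 < a" "\<And>v. v \<in> L2 \<Omega> \<Longrightarrow> a * (L2_norm \<Omega> v)\<^sup>2 \<le> W v v" using W_lower by blast
  obtain C where C: "0 \<le> C" "\<And>u v. \<lbrakk>u \<in> L2 \<Omega>; v \<in> L2 \<Omega>\<rbrakk> \<Longrightarrow> \<bar>W u v\<bar> \<le> C * L2_norm \<Omega> u * L2_norm \<Omega> v"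
    using W_upper by blast
  have Eeq: "E N t = W (J t) (J t) - (\<Sum>k=1..<Suc N. (W (j k) (J t))\<^sup>2)" if "J t \<in> HL \<Omega>" for N t
  proof -
    have v: "J t \<in> L2 \<Omega>" using that by (rule HL_L2)
    have "E N t = W (J t) (residual (Suc N) (J t))"
      unfolding E_def using W_residual_residual[OF v order_refl, of "Suc N"] W_commute[of "residual (Suc N) (J t)" "J t"] by simp
    also have "\<dots> = W (J t) (J t) - (\<Sum>k=1..<Suc N. W (j k) (J t) * W (J t) (j k))" by (rule W_residual[OF v v])
    finally show ?thesis unfolding power2_eq_square W_commute[of "J t" "j _"] .
  qed
  have E0: "AE t in M. (\<lambda>N. E N t) \<longlonglongrightarrow> 0"
    using JH unfolding E_def by eventually_elim (rule residual_energy_tendsto_0)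
  have fm: "(\<lambda>t. (W (j k) (J t))\<^sup>2) \<in> borel_measurable M" if "k \<in> {1..<n}" for k n
    using W_current_measurable[OF JL, of k] that unfolding M_def by (intro borel_measurable_power) auto
  \<comment> \<open>Measurability from Parseval: completeness, applied at almost every time,
    exhibits the energy as a limit of sums of squared coefficients, each of which is
    measurable.\<close>
  have Wm: "(\<lambda>t. W (J t) (J t)) \<in> borel_measurable M"
    unfolding M_def
  proof (rule borel_measurable_lebesgue_on_AE_LIMSEQ)
    show "(\<lambda>t. \<Sum>k=1..<Suc N. (W (j k) (J t))\<^sup>2) \<in> borel_measurable (lebesgue_on {0<..<T})" for N
      using fm unfolding M_def by (rule borel_measurable_sum)
    show "AE t in lebesgue_on {0<..<T}. (\<lambda>N. \<Sum>k=1..<Suc N. (W (j k) (J t))\<^sup>2) \<longlonglongrightarrow> W (J t) (J t)"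
      using E0 JH unfolding M_def
    proof eventually_elim
      case (elim t)
      have "(\<lambda>N. W (J t) (J t) - E N t) \<longlonglongrightarrow> W (J t) (J t) - 0" by (intro tendsto_diff tendsto_const elim(1))
      then show ?case using Eeq[OF elim(2)] by simp
    qed
  qed simp
  have Em: "E N \<in> borel_measurable M" for N
  proof -
    have "(\<lambda>t. W (J t) (J t) - (\<Sum>k=1..<Suc N. (W (j k) (J t))\<^sup>2)) \<in> borel_measurable M"
      by (intro borel_measurable_diff Wm borel_measurable_sum fm)
    moreover have "AE t in M. W (J t) (J t) - (\<Sum>k=1..<Suc N. (W (j k) (J t))\<^sup>2) = E N t"
      using JH by eventually_elim (simp only: Eeq)
    ultimately show ?thesis unfolding M_def by (rule borel_measurable_lebesgue_on_AE[rotated]) simp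
  qed
  have Ebound: "AE t in M. 0 \<le> E N t \<and> norm (E N t) \<le> C * (L2_norm \<Omega> (J t))\<^sup>2" for N
    using JH
  proof eventually_elim
    case (elim t)
    have v: "J t \<in> L2 \<Omega>" using elim by (rule HL_L2)
    have nonneg: "0 \<le> E N t" unfolding E_def by (rule W_nonneg[OF residual_L2[OF v]])
    have "0 \<le> (\<Sum>k=1..<Suc N. (W (j k) (J t))\<^sup>2)" by (intro sum_nonneg) simp
    then have "E N t \<le> W (J t) (J t)" using Eeq[OF elim, of N] by linarith
    also have "\<dots> \<le> C * L2_norm \<Omega> (J t) * L2_norm \<Omega> (J t)" using C(2)[OF v v] by linarith
    finally show ?case using nonneg by (simp add: power2_eq_square mult.assoc)
  qed
  have Ci: "integrable M (\<lambda>t. C * (L2_norm \<Omega> (J t))\<^sup>2)" using Ji by simp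
  have Ei: "integrable M (E N)" for N
    by (rule Bochner_Integration.integrable_bound[OF Ci Em])
      (use Ebound[of N] in \<open>eventually_elim, auto intro: order_trans[OF _ abs_ge_self]\<close>)
  have "(\<lambda>N. \<integral>t. E N t \<partial>M) \<longlonglongrightarrow> (\<integral>t. 0 \<partial>M)"
  proof (rule integral_dominated_convergence[OF _ Em Ci E0])
    show "AE t in M. norm (E N t) \<le> C * (L2_norm \<Omega> (J t))\<^sup>2" for N
      using Ebound[of N] by eventually_elim (rule conjunct2)
  qed simp
  then have limE: "(\<lambda>N. 1 / a * (\<integral>t. E N t \<partial>M)) \<longlonglongrightarrow> 0"
    by (intro tendsto_mult_right_zero) simp
  have le: "(\<integral>t. (L2_norm \<Omega> (\<lambda>x. U N t x - J t x))\<^sup>2 \<partial>M) \<le> 1 / a * (\<integral>t. E N t \<partial>M)" for N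
  proof -
    have "(\<integral>t. (L2_norm \<Omega> (\<lambda>x. U N t x - J t x))\<^sup>2 \<partial>M) \<le> (\<integral>t. 1 / a * E N t \<partial>M)"
    \<comment> \<open>This comparison asks integrability of the majorant only, which is provided by
      \<open>Ei\<close>.\<close>
    proof (rule integral_mono_AE')
      show "integrable M (\<lambda>t. 1 / a * E N t)" using Ei by simp
      show "AE t in M. 0 \<le> 1 / a * E N t" using Ebound[of N] by eventually_elim (use a(1) in simp)
      show "AE t in M. (L2_norm \<Omega> (\<lambda>x. U N t x - J t x))\<^sup>2 \<le> 1 / a * E N t"
        using res JH
      proof eventually_elim
        case (elim t)
        have "L2_norm \<Omega> (\<lambda>x. U N t x - J t x) = L2_norm \<Omega> (residual (Suc N) (J t))"
          using elim(1) L2_norm_minus_commute[of \<Omega> "U N t" "J t"] by simp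
        then show ?case
          using a(2)[OF residual_L2[OF HL_L2[OF elim(2)]], of "Suc N"] a(1) by (simp add: E_def field_simps)
      qed
    qed
    then show ?thesis by simp
  qed
  have "(\<lambda>N. \<integral>t. (L2_norm \<Omega> (\<lambda>x. U N t x - J t x))\<^sup>2 \<partial>M) \<longlonglongrightarrow> 0"
  proof (rule Lim_null_comparison[OF _ limE])
    show "\<forall>\<^sub>F N in sequentially. norm (\<integral>t. (L2_norm \<Omega> (\<lambda>x. U N t x - J t x))\<^sup>2 \<partial>M) \<le> 1 / a * (\<integral>t. E N t \<partial>M)"
      using le by (simp add: integral_nonneg)
  qed
  then have "(\<lambda>N. L2_HL_norm \<Omega> T (\<lambda>t x. U N t x - J t x)) \<longlonglongrightarrow> 0"
    unfolding L2_HL_norm_def M_def using tendsto_real_sqrt by fastforce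
  moreover have "U N \<in> L2_HL \<Omega> T" for N
    unfolding U_def[abs_def]
  proof (rule continuous_sum_in_L2_HL[OF open_\<Omega> bounded_\<Omega>])
    fix n assume "n \<in> {1..N}"
    then have n: "1 \<le> n" by simp
    then show "j n \<in> HL \<Omega>" by (rule mode_HL)
    show "continuous_on UNIV (\<lambda>t. c n * exp (- t / \<tau> n))"
      using \<tau>_pos[OF n] by (intro continuous_intros) auto
  qed simp
  ultimately show ?thesis using JL by (simp add: converges_in_L2_HL_def U_def[abs_def])
qed

end

theorem mainTheorem5:
  fixes \<Omega> :: "(real^3) set" and \<mu>\<^sub>0 :: real and \<eta> :: "real^3 \<Rightarrow> real"
    and \<tau> :: "nat \<Rightarrow> real" and j :: "nat \<Rightarrow> real^3 \<Rightarrow> real^3"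
    and J :: "real \<Rightarrow> real^3 \<Rightarrow> real^3"
  assumes "open \<Omega>" and "connected \<Omega>" and "\<Omega> \<noteq> {}" and "bounded \<Omega>" and "lipschitz_boundary \<Omega>"
    and "\<mu>\<^sub>0 > 0"
    and "\<eta> \<in> Linf_plus \<Omega>"
    and "time_constants_modes \<mu>\<^sub>0 \<Omega> \<eta> \<tau> j"
    and "source_free_current \<mu>\<^sub>0 \<Omega> \<eta> J"
  shows "\<exists>c :: nat \<Rightarrow> real. \<forall>T>0.
    converges_in_L2_HL \<Omega> T (\<lambda>N t x. \<Sum>n=1..N. (c n * exp (- t / \<tau> n)) *\<^sub>R j n x) J"
proof -
  interpret domain_modes \<Omega> \<mu>\<^sub>0 \<eta> \<tau> j
    using assms by unfold_locales auto
  \<comment> \<open>All constants are chosen before \<open>T\<close> is fixed, as the order of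
    quantifiers in the conclusion demands.\<close>
  have "\<exists>c. \<forall>n\<ge>1. AE t in lebesgue_on {0<..}. W (j n) (J t) = c n * exp (- t / \<tau> n)"
    using mode_coefficient_decay[OF assms(9)] by (intro choice_iff[THEN iffD1]) blast
  then obtain c where c: "\<And>n. 1 \<le> n \<Longrightarrow> AE t in lebesgue_on {0<..}. W (j n) (J t) = c n * exp (- t / \<tau> n)"
    by blast
  show ?thesis
  proof (intro exI[of _ c] allI impI)
    fix T :: real assume "0 < T"
    then have "J \<in> L2_HL \<Omega> T" using assms(9) by (simp add: source_free_current_def)
    then show "converges_in_L2_HL \<Omega> T (\<lambda>N t x. \<Sum>n=1..N. (c n * exp (- t / \<tau> n)) *\<^sub>R j n x) J"
      by (rule partial_sums_converge) (rule AE_lebesgue_on_subset[OF c], auto)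
  qed
qed

end
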